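(* Let $H$ be a finite-dimensional pointed Hopf algebra over $\mathbb{C}$ whose group $G(H)$ of group-like elements is isomorphic to the alternating group $\mathbb{A}_5$. Then $H$ is isomorphic, as a Hopf algebra, to the group algebra $\mathbb{C}\mathbb{A}_5$.
   Context: A Hopf algebra is pointed if all its simple subcoalgebras are one-dimensional, i.e. its coradical is the group algebra of its group of group-like elements $G(H)$. *)

theory Defs
  imports
    "HOL-Algebra.Sym_Groups"
    "HOL-Algebra.Algebraic_Closure_Type"
    "Jordan_Normal_Form.Missing_VectorSpace"
begin

section \<open>Free modules, quotients and tensor products\<close>

text \<open>
  The record type for modules extends the one for rings. Where no multiplication is meant, the
  ring fields get dummy values, as in \<open>direct_sum\<close>.
\<close>

definition supp :: "('k, 'm) ring_scheme \<Rightarrow> ('x \<Rightarrow> 'k) \<Rightarrow> 'x set"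
  where "supp K f = {x. f x \<noteq> \<zero>\<^bsub>K\<^esub>}"

definition delta :: "('k, 'm) ring_scheme \<Rightarrow> 'x \<Rightarrow> 'x \<Rightarrow> 'k"
  where "delta K x = (\<lambda>y. if y = x then \<one>\<^bsub>K\<^esub> else \<zero>\<^bsub>K\<^esub>)"

definition free_module :: "('k, 'm) ring_scheme \<Rightarrow> 'x set \<Rightarrow> ('k, 'x \<Rightarrow> 'k) module"
  where "free_module K S =
    \<lparr>carrier = {f. range f \<subseteq> carrier K \<and> finite (supp K f) \<and> supp K f \<subseteq> S},
     monoid.mult = (\<lambda>f g x. \<zero>\<^bsub>K\<^esub>), one = (\<lambda>x. \<zero>\<^bsub>K\<^esub>),
     zero = (\<lambda>x. \<zero>\<^bsub>K\<^esub>), add = (\<lambda>f g x. f x \<oplus>\<^bsub>K\<^esub> g x),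
     module.smult = (\<lambda>c f x. c \<otimes>\<^bsub>K\<^esub> f x)\<rparr>"

definition quotient_module ::
    "('k, 'v, 'm) module_scheme \<Rightarrow> 'v set \<Rightarrow> ('k, 'v set) module"
  where "quotient_module M N =
    \<lparr>carrier = a_rcosets\<^bsub>M\<^esub> N,
     monoid.mult = (\<lambda>S T. N), one = N,
     zero = N, add = set_add M,
     module.smult = (\<lambda>c S. \<Union>x\<in>S. N +>\<^bsub>M\<^esub> (c \<odot>\<^bsub>M\<^esub> x))\<rparr>"

definition self_module :: "('k, 'm) ring_scheme \<Rightarrow> ('k, 'k) module"
  where "self_module K =
    \<lparr>carrier = carrier K, monoid.mult = monoid.mult K, one = \<one>\<^bsub>K\<^esub>,
     zero = \<zero>\<^bsub>K\<^esub>, add = add K, module.smult = monoid.mult K\<rparr>"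

definition tensor_relators :: "('k, 'm) ring_scheme \<Rightarrow>
    ('k, 'v, 'n) module_scheme \<Rightarrow> ('k, 'w, 'p) module_scheme \<Rightarrow> ('v \<times> 'w \<Rightarrow> 'k) set"
  where "tensor_relators K V W = (let F = free_module K (carrier V \<times> carrier W) in
    {delta K (v \<oplus>\<^bsub>V\<^esub> v', w) \<ominus>\<^bsub>F\<^esub> (delta K (v, w) \<oplus>\<^bsub>F\<^esub> delta K (v', w)) | v v' w.
       v \<in> carrier V \<and> v' \<in> carrier V \<and> w \<in> carrier W} \<union>
    {delta K (v, w \<oplus>\<^bsub>W\<^esub> w') \<ominus>\<^bsub>F\<^esub> (delta K (v, w) \<oplus>\<^bsub>F\<^esub> delta K (v, w')) | v w w'.
       v \<in> carrier V \<and> w \<in> carrier W \<and> w' \<in> carrier W} \<union>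
    {delta K (c \<odot>\<^bsub>V\<^esub> v, w) \<ominus>\<^bsub>F\<^esub> (c \<odot>\<^bsub>F\<^esub> delta K (v, w)) | c v w.
       c \<in> carrier K \<and> v \<in> carrier V \<and> w \<in> carrier W} \<union>
    {delta K (v, c \<odot>\<^bsub>W\<^esub> w) \<ominus>\<^bsub>F\<^esub> (c \<odot>\<^bsub>F\<^esub> delta K (v, w)) | c v w.
       c \<in> carrier K \<and> v \<in> carrier V \<and> w \<in> carrier W})"

definition tensor_null :: "('k, 'm) ring_scheme \<Rightarrow>
    ('k, 'v, 'n) module_scheme \<Rightarrow> ('k, 'w, 'p) module_scheme \<Rightarrow> ('v \<times> 'w \<Rightarrow> 'k) set"
  where "tensor_null K V W =
    module.span K (free_module K (carrier V \<times> carrier W)) (tensor_relators K V W)"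

definition tensor :: "('k, 'm) ring_scheme \<Rightarrow>
    ('k, 'v, 'n) module_scheme \<Rightarrow> ('k, 'w, 'p) module_scheme \<Rightarrow>
    ('k, ('v \<times> 'w \<Rightarrow> 'k) set) module"
  where "tensor K V W =
    quotient_module (free_module K (carrier V \<times> carrier W)) (tensor_null K V W)"

definition pure_tensor :: "('k, 'm) ring_scheme \<Rightarrow>
    ('k, 'v, 'n) module_scheme \<Rightarrow> ('k, 'w, 'p) module_scheme \<Rightarrow>
    'v \<Rightarrow> 'w \<Rightarrow> ('v \<times> 'w \<Rightarrow> 'k) set"
  where "pure_tensor K V W v w =
    tensor_null K V W +>\<^bsub>free_module K (carrier V \<times> carrier W)\<^esub> delta K (v, w)"

text \<open>
  The linear map \<open>V \<otimes> W \<rightarrow> U\<close> induced by a bilinear map \<open>b\<close>. It is computed on an arbitrary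
  representative; bilinearity of \<open>b\<close> makes the result independent of the choice.
\<close>

definition tensor_lift :: "('k, 'm) ring_scheme \<Rightarrow>
    ('k, 'v, 'n) module_scheme \<Rightarrow> ('k, 'w, 'p) module_scheme \<Rightarrow> ('k, 'u, 'q) module_scheme \<Rightarrow>
    ('v \<Rightarrow> 'w \<Rightarrow> 'u) \<Rightarrow> ('v \<times> 'w \<Rightarrow> 'k) set \<Rightarrow> 'u"
  where "tensor_lift K V W U b S = (let f = (SOME f. f \<in> S) in
    \<Oplus>\<^bsub>U\<^esub>p\<in>supp K f. f p \<odot>\<^bsub>U\<^esub> b (fst p) (snd p))"

definition tensor_map :: "('k, 'm) ring_scheme \<Rightarrow>
    ('k, 'v, 'n) module_scheme \<Rightarrow> ('k, 'w, 'p) module_scheme \<Rightarrow>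
    ('k, 'v2, 'q) module_scheme \<Rightarrow> ('k, 'w2, 'r) module_scheme \<Rightarrow>
    ('v \<Rightarrow> 'v2) \<Rightarrow> ('w \<Rightarrow> 'w2) \<Rightarrow> ('v \<times> 'w \<Rightarrow> 'k) set \<Rightarrow> ('v2 \<times> 'w2 \<Rightarrow> 'k) set"
  where "tensor_map K V W V' W' f g =
    tensor_lift K V W (tensor K V' W') (\<lambda>v w. pure_tensor K V' W' (f v) (g w))"

text \<open>The associator \<open>(U \<otimes> V) \<otimes> W \<rightarrow> U \<otimes> (V \<otimes> W)\<close>.\<close>

definition tensor_assoc :: "('k, 'm) ring_scheme \<Rightarrow>
    ('k, 'u, 'n) module_scheme \<Rightarrow> ('k, 'v, 'p) module_scheme \<Rightarrow> ('k, 'w, 'q) module_scheme \<Rightarrow>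
    (('u \<times> 'v \<Rightarrow> 'k) set \<times> 'w \<Rightarrow> 'k) set \<Rightarrow> ('u \<times> ('v \<times> 'w \<Rightarrow> 'k) set \<Rightarrow> 'k) set"
  where "tensor_assoc K U V W =
    tensor_lift K (tensor K U V) W (tensor K U (tensor K V W))
      (\<lambda>x w. tensor_lift K U V (tensor K U (tensor K V W))
        (\<lambda>u v. pure_tensor K U (tensor K V W) u (pure_tensor K V W v w)) x)"

text \<open>The multiplication \<open>(a \<otimes> b) (c \<otimes> d) = (a c) \<otimes> (b d)\<close> on the tensor product of two algebras.\<close>

definition tensor_mult :: "('k, 'm) ring_scheme \<Rightarrow>
    ('k, 'v, 'n) module_scheme \<Rightarrow> ('k, 'w, 'p) module_scheme \<Rightarrow>
    ('v \<times> 'w \<Rightarrow> 'k) set \<Rightarrow> ('v \<times> 'w \<Rightarrow> 'k) set \<Rightarrow> ('v \<times> 'w \<Rightarrow> 'k) set"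
  where "tensor_mult K A B x y =
    tensor_lift K A B (tensor K A B)
      (\<lambda>a b. tensor_lift K A B (tensor K A B)
        (\<lambda>c d. pure_tensor K A B (a \<otimes>\<^bsub>A\<^esub> c) (b \<otimes>\<^bsub>B\<^esub> d)) y) x"


section \<open>Hopf algebras\<close>

record ('k, 'a) hopf = "('k, 'a) module" +
  comult :: "'a \<Rightarrow> ('a \<times> 'a \<Rightarrow> 'k) set"
  counit :: "'a \<Rightarrow> 'k"
  antipode :: "'a \<Rightarrow> 'a"

text \<open>The library locale \<open>algebra\<close> is restricted to commutative algebras.\<close>

locale assoc_algebra = vectorspace K H + alg: ring H for K and H +
  assumes smult_mult_left:
    "\<lbrakk>c \<in> carrier K; x \<in> carrier H; y \<in> carrier H\<rbrakk>
      \<Longrightarrow> (c \<odot>\<^bsub>H\<^esub> x) \<otimes>\<^bsub>H\<^esub> y = c \<odot>\<^bsub>H\<^esub> (x \<otimes>\<^bsub>H\<^esub> y)"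
  and smult_mult_right:
    "\<lbrakk>c \<in> carrier K; x \<in> carrier H; y \<in> carrier H\<rbrakk>
      \<Longrightarrow> x \<otimes>\<^bsub>H\<^esub> (c \<odot>\<^bsub>H\<^esub> y) = c \<odot>\<^bsub>H\<^esub> (x \<otimes>\<^bsub>H\<^esub> y)"

locale coalgebra = vectorspace K H
  for K :: "('k, 'm) ring_scheme" and H :: "('k, 'a, 'n) hopf_scheme" +
  assumes comult_linear: "comult H \<in> module_hom K H (tensor K H H)"
  and counit_linear: "counit H \<in> module_hom K H (self_module K)"
  and coassoc:
    "x \<in> carrier H \<Longrightarrow>
      tensor_assoc K H H H
        (tensor_map K H H (tensor K H H) H (comult H) (\<lambda>b. b) (comult H x)) =
      tensor_map K H H H (tensor K H H) (\<lambda>a. a) (comult H) (comult H x)"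
  and counit_left:
    "x \<in> carrier H \<Longrightarrow> tensor_lift K H H H (\<lambda>a b. counit H a \<odot>\<^bsub>H\<^esub> b) (comult H x) = x"
  and counit_right:
    "x \<in> carrier H \<Longrightarrow> tensor_lift K H H H (\<lambda>a b. counit H b \<odot>\<^bsub>H\<^esub> a) (comult H x) = x"

locale bialgebra = assoc_algebra K H + coalgebra K H
  for K :: "('k, 'm) ring_scheme" and H :: "('k, 'a, 'n) hopf_scheme" +
  assumes comult_mult:
    "\<lbrakk>x \<in> carrier H; y \<in> carrier H\<rbrakk>
      \<Longrightarrow> comult H (x \<otimes>\<^bsub>H\<^esub> y) = tensor_mult K H H (comult H x) (comult H y)"
  and comult_one: "comult H \<one>\<^bsub>H\<^esub> = pure_tensor K H H \<one>\<^bsub>H\<^esub> \<one>\<^bsub>H\<^esub>"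
  and counit_mult:
    "\<lbrakk>x \<in> carrier H; y \<in> carrier H\<rbrakk>
      \<Longrightarrow> counit H (x \<otimes>\<^bsub>H\<^esub> y) = counit H x \<otimes>\<^bsub>K\<^esub> counit H y"
  and counit_one: "counit H \<one>\<^bsub>H\<^esub> = \<one>\<^bsub>K\<^esub>"

locale hopf_algebra = bialgebra K H
  for K :: "('k, 'm) ring_scheme" and H :: "('k, 'a, 'n) hopf_scheme" +
  assumes antipode_linear: "antipode H \<in> module_hom K H H"
  and antipode_left:
    "x \<in> carrier H \<Longrightarrow>
      tensor_lift K H H H (\<lambda>a b. antipode H a \<otimes>\<^bsub>H\<^esub> b) (comult H x) =
        counit H x \<odot>\<^bsub>H\<^esub> \<one>\<^bsub>H\<^esub>"
  and antipode_right:
    "x \<in> carrier H \<Longrightarrow>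
      tensor_lift K H H H (\<lambda>a b. a \<otimes>\<^bsub>H\<^esub> antipode H b) (comult H x) =
        counit H x \<odot>\<^bsub>H\<^esub> \<one>\<^bsub>H\<^esub>"

definition hopf_hom :: "('k, 'm) ring_scheme \<Rightarrow>
    ('k, 'a, 'n) hopf_scheme \<Rightarrow> ('k, 'b, 'p) hopf_scheme \<Rightarrow> ('a \<Rightarrow> 'b) set"
  where "hopf_hom K H H' = {f \<in> module_hom K H H' \<inter> ring_hom H H'. \<forall>x\<in>carrier H.
    comult H' (f x) = tensor_map K H H H' H' f f (comult H x) \<and>
    counit H' (f x) = counit H x \<and>
    antipode H' (f x) = f (antipode H x)}"

definition hopf_isomorphic :: "('k, 'm) ring_scheme \<Rightarrow>
    ('k, 'a, 'n) hopf_scheme \<Rightarrow> ('k, 'b, 'p) hopf_scheme \<Rightarrow> bool"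
  where "hopf_isomorphic K H H' \<longleftrightarrow>
    (\<exists>f \<in> hopf_hom K H H'. bij_betw f (carrier H) (carrier H'))"


section \<open>Pointed Hopf algebras\<close>

definition subcoalgebra ::
    "('k, 'm) ring_scheme \<Rightarrow> 'a set \<Rightarrow> ('k, 'a, 'n) hopf_scheme \<Rightarrow> bool"
  where "subcoalgebra K C H \<longleftrightarrow> subspace K C H \<and>
    (\<forall>x\<in>C. comult H x \<in>
      module.span K (tensor K H H) {pure_tensor K H H c d | c d. c \<in> C \<and> d \<in> C})"

definition simple_subcoalgebra ::
    "('k, 'm) ring_scheme \<Rightarrow> 'a set \<Rightarrow> ('k, 'a, 'n) hopf_scheme \<Rightarrow> bool"
  where "simple_subcoalgebra K C H \<longleftrightarrow> subcoalgebra K C H \<and> C \<noteq> {\<zero>\<^bsub>H\<^esub>} \<and>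
    (\<forall>D. subcoalgebra K D H \<and> D \<subseteq> C \<longrightarrow> D = {\<zero>\<^bsub>H\<^esub>} \<or> D = C)"

definition pointed :: "('k, 'm) ring_scheme \<Rightarrow> ('k, 'a, 'n) hopf_scheme \<Rightarrow> bool"
  where "pointed K H \<longleftrightarrow>
    (\<forall>C. simple_subcoalgebra K C H \<longrightarrow> vectorspace.dim K (H\<lparr>carrier := C\<rparr>) = 1)"

definition grouplikes ::
    "('k, 'm) ring_scheme \<Rightarrow> ('k, 'a, 'n) hopf_scheme \<Rightarrow> 'a monoid"
  where "grouplikes K H =
    \<lparr>carrier = {g \<in> carrier H. comult H g = pure_tensor K H H g g \<and> counit H g = \<one>\<^bsub>K\<^esub>},
     monoid.mult = monoid.mult H, one = \<one>\<^bsub>H\<^esub>\<rparr>"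


section \<open>Group algebras\<close>

text \<open>
  Elements are the finitely supported functions on \<open>G\<close>, and \<open>delta K g\<close> is the basis element of \<open>g\<close>.
  The comultiplication is the linear extension of \<open>g \<mapsto> g \<otimes> g\<close>; the tensor product is that of the
  underlying vector space \<open>free_module K (carrier G)\<close>, which agrees with the tensor product of the
  group algebra because \<open>tensor\<close> does not depend on the ring multiplication.
\<close>

definition group_algebra ::
    "('k, 'm) ring_scheme \<Rightarrow> ('g, 'n) monoid_scheme \<Rightarrow> ('k, 'g \<Rightarrow> 'k) hopf"
  where "group_algebra K G = (let F = free_module K (carrier G) in
    \<lparr>carrier = carrier F,
     monoid.mult = (\<lambda>f h x. \<Oplus>\<^bsub>K\<^esub>p\<in>{p \<in> supp K f \<times> supp K h. fst p \<otimes>\<^bsub>G\<^esub> snd p = x}.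
       f (fst p) \<otimes>\<^bsub>K\<^esub> h (snd p)),
     one = delta K \<one>\<^bsub>G\<^esub>,
     zero = \<zero>\<^bsub>F\<^esub>, add = add F, module.smult = module.smult F,
     comult = (\<lambda>f. \<Oplus>\<^bsub>tensor K F F\<^esub>g\<in>supp K f.
       f g \<odot>\<^bsub>tensor K F F\<^esub> pure_tensor K F F (delta K g) (delta K g)),
     counit = (\<lambda>f. \<Oplus>\<^bsub>K\<^esub>g\<in>supp K f. f g),
     antipode = (\<lambda>f x. if x \<in> carrier G then f (inv\<^bsub>G\<^esub> x) else \<zero>\<^bsub>K\<^esub>)\<rparr>)"

abbreviation complex_field :: "complex ring"
  where "complex_field \<equiv> ring_of_type_algebra"

end

theory Submission
  imports Defs "HOL-Library.Function_Algebras"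
begin

text \<open>
  Suppose that \<open>H\<close> is larger than the span of its group-likes \<open>G\<close>. A Taft-Wilson argument gives a
  skew-primitive \<open>y\<close> outside that span, with \<open>\<Delta>(y) = y \<otimes> 1 + h \<otimes> y\<close>, and \<open>y\<close> may be taken to be an
  eigenvector of conjugation by \<open>h\<close>, with eigenvalue \<open>q\<close>. In \<open>A\<^sub>5\<close>, either \<open>h\<close> has odd order and is
  conjugate to its inverse, or \<open>h\<close> is an involution in a Klein four-group whose involutions are
  permuted cyclically by conjugation. If \<open>q = 1\<close>, the powers of \<open>y\<close> are linearly independent.
  Otherwise the conjugates of \<open>y\<close> span a braided vector space of affine Cartan type, \<open>A\<^sub>1\<close> at \<open>q\<close> in
  the first case and \<open>A\<^sub>2\<close> at \<open>-1\<close> in the second, and the powers of an imaginary root vector are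
  linearly independent. Both contradict finite dimension, so \<open>H\<close> is spanned by \<open>G\<close>.
\<close>

section \<open>Functionals\<close>

text \<open>\<open>H\<close> carries no grading, so exact skew derivations are not at hand. What can
  be arranged is a functional dual to one of the skew-primitives that vanishes on \<Gamma> and is
  constant on the \<Gamma>-translates of each of them; the operator it defines obeys the braided
  Leibniz rule up to shorter words. All computations therefore take place in the filtration by word
  length, and infinite dimension is forced by a pair of operators: some Z, and a composite D of
  derivations, such that D Z = c + Z D up to shorter words on the powers of Z, with a scalar c
  \<noteq> 0. In characteristic zero this keeps the powers independent, as differentiation does for
  polynomials. The division of A_5 into two cases is dictated by the eigenvalue q. A conjugate of y
  in the inverse degree completes the A_1 braiding, with c = 1/q - q; odd order excludes q = -1,
  where c vanishes. For an involution q = -1 is the only value besides 1, and the degree is its own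
  inverse, so three conjugates with distinct commuting degrees are needed.\<close>

locale linear_space = vector_space scale
  for scale :: "'a::field \<Rightarrow> 'b::ab_group_add \<Rightarrow> 'b" (infixr "*s" 75)
begin

definition functional :: "('b \<Rightarrow> 'a) \<Rightarrow> bool"
  where "functional f \<longleftrightarrow> (\<forall>x y. f (x + y) = f x + f y) \<and> (\<forall>c x. f (c *s x) = c * f x)"

lemma functional_add: "functional f \<Longrightarrow> f (x + y) = f x + f y"
  and functional_scale: "functional f \<Longrightarrow> f (c *s x) = c * f x"
  by (auto simp: functional_def)

lemma functional_zero: "functional f \<Longrightarrow> f 0 = 0"
  using functional_scale[of f 0 0] by simp

lemma functional_diff: "functional f \<Longrightarrow> f (x - y) = f x - f y"
  using functional_add[of f "x - y" y] by simp

lemma functional_sum: "functional f \<Longrightarrow> f (sum g A) = (\<Sum>x\<in>A. f (g x))"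
  by (induct A rule: infinite_finite_induct) (simp_all add: functional_zero functional_add)

lemmas functional_simps =
  functional_add functional_scale functional_zero functional_diff functional_sum

lemma functionalI:
  "(\<And>x y. f (x + y) = f x + f y) \<Longrightarrow> (\<And>c x. f (c *s x) = c * f x) \<Longrightarrow> functional f"
  by (simp add: functional_def)

lemma functional_combination:
  assumes "\<And>a. a \<in> A \<Longrightarrow> functional (f a)"
  shows "functional (\<lambda>v. \<Sum>a\<in>A. c a * f a v)"
proof (rule functionalI)
  show "(\<Sum>a\<in>A. c a * f a (x + y)) = (\<Sum>a\<in>A. c a * f a x) + (\<Sum>a\<in>A. c a * f a y)" for x y
    by (simp add: functional_add assms distrib_left sum.distrib cong: sum.cong)
  show "(\<Sum>a\<in>A. c a * f a (d *s x)) = d * (\<Sum>a\<in>A. c a * f a x)" for d x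
    by (simp add: functional_scale assms sum_distrib_left mult.left_commute cong: sum.cong)
qed

lemma functional_vanishes_on_span:
  "x \<in> span S \<Longrightarrow> functional f \<Longrightarrow> (\<And>s. s \<in> S \<Longrightarrow> f s = 0) \<Longrightarrow> f x = 0"
  by (induction x rule: span_induct_alt) (auto simp: functional_simps)

lemma functional_extend:
  assumes "independent A"
  shows "\<exists>f. functional f \<and> (\<forall>a\<in>A. f a = p a)"
proof -
  interpret c: vector_space "(*) :: 'a \<Rightarrow> 'a \<Rightarrow> 'a"
    by unfold_locales (auto simp: algebra_simps)
  interpret pr: vector_space_pair scale "(*) :: 'a \<Rightarrow> 'a \<Rightarrow> 'a" ..
  obtain f where "Vector_Spaces.linear (*s) (*) f" "\<forall>a\<in>A. f a = p a"
    using pr.linear_independent_extend[OF assms] by blast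
  then show ?thesis
    unfolding functional_def Vector_Spaces.linear_iff by (intro exI[of _ f]) simp
qed

lemma functional_separates:
  assumes "subspace S" "x \<notin> S"
  shows "\<exists>f. functional f \<and> (\<forall>s\<in>S. f s = 0) \<and> f x = 1"
proof -
  obtain A where A: "A \<subseteq> S" "independent A" "S \<subseteq> span A"
    using maximal_independent_subset by blast
  have sp: "span A = S"
    using A assms(1) span_subspace by blast
  then have "independent (insert x A)"
    using A assms(2) by (intro independent_insertI) auto
  then obtain f where f: "functional f" "\<forall>a\<in>insert x A. f a = (if a = x then 1 else 0)"
    using functional_extend[of "insert x A" "\<lambda>a. if a = x then 1 else 0"] by blast
  have "x \<notin> A" using A assms by auto
  then have "f s = 0" if "s \<in> S" for s
    using f(2) that sp by (intro functional_vanishes_on_span[OF _ f(1), of s A]) auto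
  with f show ?thesis by auto
qed

text \<open>Vectors are compared through their pairings throughout: under a functional the operators
  \<open>L\<close> and \<open>R\<close> trade places by \<open>L_R_dual\<close>, which turns
  coalgebra identities into rewriting.\<close>

lemma functional_eqI:
  assumes "\<And>f. functional f \<Longrightarrow> f x = f y"
  shows "x = y"
proof (rule ccontr)
  assume "x \<noteq> y"
  then obtain f where "functional f" "f (x - y) = 1"
    using functional_separates[OF subspace_single_0, of "x - y"] by auto
  then show False using assms[of f] by (simp add: functional_diff)
qed

lemma dim_strict_mono:
  assumes "subspace S" "S \<subset> T" "T \<subseteq> span F" "finite F"
  shows "dim S < dim T"
proof -
  obtain A where A: "A \<subseteq> S" "independent A" "S \<subseteq> span A" "card A = dim S"
    using basis_exists by blast
  obtain C where C: "A \<subseteq> C" "C \<subseteq> T" "independent C" "T \<subseteq> span C"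
    using maximal_independent_subset_extend[of A T] A assms(2) by blast
  have "span A = S"
    using A assms(1) span_subspace by blast
  then have "A \<noteq> C" using C assms(2) by auto
  moreover have "finite C"
    using independent_span_bound[OF assms(4) C(3)] C(2) assms(3) by auto
  ultimately have "card A < card C"
    using C(1) by (intro psubset_card_mono) auto
  then show ?thesis
    using A(4) basis_card_eq_dim[OF C(2,4,3)] by simp
qed

text \<open>Descent on the dimension, which the finite spanning set makes strict. It supplies both a
  minimal right coideal and a simple subcoalgebra in \<open>ex_weight_vector\<close>.\<close>

lemma minimal_subspace_exists:
  assumes "finite F" "P S" "\<And>S. P S \<Longrightarrow> subspace S \<and> S \<subseteq> span F"
  shows "\<exists>M. P M \<and> M \<subseteq> S \<and> (\<forall>T. P T \<and> T \<subseteq> M \<longrightarrow> T = M)"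
  using assms(2)
proof (induction "dim S" arbitrary: S rule: less_induct)
  case less
  show ?case
  proof (cases "\<forall>T. P T \<and> T \<subseteq> S \<longrightarrow> T = S")
    case False
    then obtain T where T: "P T" "T \<subset> S" by auto
    then have "dim T < dim S"
      using assms(1,3) less.prems by (intro dim_strict_mono) auto
    from less.hyps[OF this T(1)] T(2) show ?thesis by blast
  qed (use less.prems in auto)
qed

end

section \<open>Skew-primitive elements of pointed bialgebras\<close>

text \<open>The operators \<open>L f\<close> and \<open>R f\<close> stand for \<open>(f \<otimes> id) \<circ> \<Delta>\<close> and \<open>(id \<otimes> f) \<circ> \<Delta>\<close>, which avoids
  tensor products; the subspaces stable under all of them are the subcoalgebras.\<close>
locale pointed_bialgebra = linear_space scale
  for scale :: "complex \<Rightarrow> 'v::ab_group_add \<Rightarrow> 'v" (infixr "*s" 75) +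
  fixes V :: "'v set" and B :: "'v set" and coord :: "'v \<Rightarrow> 'v \<Rightarrow> complex"
    and mul :: "'v \<Rightarrow> 'v \<Rightarrow> 'v" (infixl "\<star>" 70) and unit :: 'v
    and eps :: "'v \<Rightarrow> complex"
    and L R :: "('v \<Rightarrow> complex) \<Rightarrow> 'v \<Rightarrow> 'v"
  assumes V_subspace: "subspace V"
    and finite_B: "finite B" and B_V: "B \<subseteq> V"
    and functional_coord: "b \<in> B \<Longrightarrow> functional (coord b)"
    and V_expand: "x \<in> V \<Longrightarrow> x = (\<Sum>b\<in>B. coord b x *s b)"
    and mul_V [simp]: "x \<star> y \<in> V"
    and mul_add_left: "(x + y) \<star> z = x \<star> z + y \<star> z"
    and mul_add_right: "z \<star> (x + y) = z \<star> x + z \<star> y"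
    and mul_scale_left: "(c *s x) \<star> y = c *s (x \<star> y)"
    and mul_scale_right: "x \<star> (c *s y) = c *s (x \<star> y)"
    and mul_assoc: "x \<star> y \<star> z = x \<star> (y \<star> z)"
    and unit_V [simp]: "unit \<in> V"
    and mul_unit_left [simp]: "x \<in> V \<Longrightarrow> unit \<star> x = x"
    and mul_unit_right [simp]: "x \<in> V \<Longrightarrow> x \<star> unit = x"
    and functional_eps: "functional eps"
    and L_V [simp]: "functional f \<Longrightarrow> L f x \<in> V"
    and R_V [simp]: "functional f \<Longrightarrow> R f x \<in> V"
    and L_add: "functional f \<Longrightarrow> L f (x + y) = L f x + L f y"
    and L_scale: "functional f \<Longrightarrow> L f (c *s x) = c *s L f x"
    and L_R_dual: "functional f \<Longrightarrow> functional g \<Longrightarrow> f (L g x) = g (R f x)"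
    and R_L_commute: "functional f \<Longrightarrow> functional g \<Longrightarrow> R f (L g x) = L g (R f x)"
    and L_eps: "x \<in> V \<Longrightarrow> L eps x = x"
    and R_eps: "x \<in> V \<Longrightarrow> R eps x = x"
    and L_mul: "functional f \<Longrightarrow> x \<in> V \<Longrightarrow>
      L f (x \<star> y) = (\<Sum>b\<in>B. L (coord b) x \<star> L (\<lambda>v. f (b \<star> v)) y)"
    and pointed: "\<lbrakk>subspace S; S \<subseteq> V; S \<noteq> {0};
      \<And>f x. functional f \<Longrightarrow> x \<in> S \<Longrightarrow> L f x \<in> S; \<And>f x. functional f \<Longrightarrow> x \<in> S \<Longrightarrow> R f x \<in> S;
      \<And>T. \<lbrakk>subspace T; T \<subseteq> S; T \<noteq> {0};
        \<And>f x. functional f \<Longrightarrow> x \<in> T \<Longrightarrow> L f x \<in> T; \<And>f x. functional f \<Longrightarrow> x \<in> T \<Longrightarrow> R f x \<in> T\<rbrakk>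
        \<Longrightarrow> T = S\<rbrakk>
      \<Longrightarrow> \<exists>u\<in>S. S \<subseteq> range (\<lambda>c. c *s u)"
begin

lemma V_span: "V \<subseteq> span B"
proof
  fix x assume "x \<in> V"
  then have "x = (\<Sum>b\<in>B. coord b x *s b)" by (rule V_expand)
  also have "\<dots> \<in> span B" by (intro span_sum span_scale span_base)
  finally show "x \<in> span B" .
qed

lemma functional_left_mul: "functional f \<Longrightarrow> functional (\<lambda>v. f (a \<star> v))"
  by (auto simp: functional_def mul_add_right mul_scale_right)

lemma mul_zero_left [simp]: "0 \<star> x = 0"
  using mul_scale_left[of 0 0 x] by simp

lemma mul_zero_right [simp]: "x \<star> 0 = 0"
  using mul_scale_right[of x 0 0] by simp

lemma mul_diff_left: "(x - y) \<star> z = x \<star> z - y \<star> z"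
  using mul_add_left[of "x - y" y z] by simp

lemma mul_diff_right: "z \<star> (x - y) = z \<star> x - z \<star> y"
  using mul_add_right[of z "x - y" y] by simp

lemma mul_neg_left: "(- x) \<star> z = - (x \<star> z)"
  using mul_diff_left[of 0 x z] by simp

lemma mul_neg_right: "z \<star> (- x) = - (z \<star> x)"
  using mul_diff_right[of z 0 x] by simp

lemma mul_sum_left: "sum f A \<star> z = (\<Sum>x\<in>A. f x \<star> z)"
  by (induct A rule: infinite_finite_induct) (simp_all add: mul_add_left)

lemma mul_sum_right: "z \<star> sum f A = (\<Sum>x\<in>A. z \<star> f x)"
  by (induct A rule: infinite_finite_induct) (simp_all add: mul_add_right)

lemmas mul_simps = mul_add_left mul_add_right mul_diff_left mul_diff_right
  mul_neg_left mul_neg_right mul_scale_left mul_scale_right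

lemma L_zero: "functional f \<Longrightarrow> L f 0 = 0"
  using L_scale[of f 0 0] by simp

lemma L_diff: "functional f \<Longrightarrow> L f (x - y) = L f x - L f y"
  using L_add[of f "x - y" y] by simp

lemma L_sum: "functional f \<Longrightarrow> L f (sum g A) = (\<Sum>x\<in>A. L f (g x))"
  by (induct A rule: infinite_finite_induct) (simp_all add: L_zero L_add)

text \<open>Pairing \<open>R f x\<close> with a functional \<open>g\<close> gives
  \<open>f (L g x)\<close>, so properties of \<open>R\<close> are read off from those of
  \<open>L\<close>.\<close>

lemma R_add: "functional f \<Longrightarrow> R f (x + y) = R f x + R f y"
  by (rule functional_eqI) (simp add: functional_simps L_R_dual[symmetric] L_add)

lemma R_scale: "functional f \<Longrightarrow> R f (c *s x) = c *s R f x"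
  by (rule functional_eqI) (simp add: functional_simps L_R_dual[symmetric] L_scale)

lemma R_zero: "functional f \<Longrightarrow> R f 0 = 0"
  using R_scale[of f 0 0] by simp

lemma R_diff: "functional f \<Longrightarrow> R f (x - y) = R f x - R f y"
  using R_add[of f "x - y" y] by simp

text \<open>Pairing \<open>L f x\<close> with a functional \<open>k\<close> evaluates
  \<open>f\<close> at \<open>R k x\<close>, which lies in \<open>V\<close>; so \<open>f\<close>
  matters only through its restriction to \<open>V\<close>.\<close>

lemma L_cong:
  assumes "functional f" "functional g" "\<And>v. v \<in> V \<Longrightarrow> f v = g v"
  shows "L f x = L g x"
  by (rule functional_eqI) (simp add: L_R_dual assms)

lemma L_functional_sum:
  assumes "\<And>a. a \<in> A \<Longrightarrow> functional (f a)"
  shows "L (\<lambda>v. \<Sum>a\<in>A. c a * f a v) x = (\<Sum>a\<in>A. c a *s L (f a) x)"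
proof (rule functional_eqI)
  fix k assume k: "functional k"
  have "k (L (\<lambda>v. \<Sum>a\<in>A. c a * f a v) x) = (\<Sum>a\<in>A. c a * f a (R k x))"
    by (rule L_R_dual[OF k functional_combination[OF assms]])
  also have "\<dots> = k (\<Sum>a\<in>A. c a *s L (f a) x)"
    by (simp add: k functional_sum functional_scale L_R_dual assms cong: sum.cong)
  finally show "k (L (\<lambda>v. \<Sum>a\<in>A. c a * f a v) x) = k (\<Sum>a\<in>A. c a *s L (f a) x)" .
qed

text \<open>Coassociativity in operator form, coming from \<open>R_L_commute\<close>: the functional
  \<open>\<lambda>v. g (R f v)\<close> is the convolution product of \<open>g\<close> and
  \<open>f\<close>.\<close>

lemma L_L: "functional f \<Longrightarrow> functional g \<Longrightarrow> L f (L g x) = L (\<lambda>v. g (R f v)) x"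
proof (rule functional_eqI)
  fix k assume a: "functional f" "functional g" "functional k"
  have F: "functional (\<lambda>v. g (R f v))"
    using a by (simp add: functional_def R_add R_scale)
  have "k (L f (L g x)) = f (R k (L g x))" by (simp add: a L_R_dual)
  also have "\<dots> = g (R f (R k x))" by (simp add: a R_L_commute L_R_dual)
  finally show "k (L f (L g x)) = k (L (\<lambda>v. g (R f v)) x)"
    by (simp add: a F L_R_dual)
qed

text \<open>Tested by all functionals on the left tensor factor, the condition reads \<Delta>(g) = g
  \<otimes> g.\<close>

definition grp :: "'v set"
  where "grp = {g \<in> V. g \<noteq> 0 \<and> (\<forall>f. functional f \<longrightarrow> L f g = f g *s g)}"

text \<open>This is \<Delta>(y) = y \<otimes> g + h \<otimes> y: the first index is the group-like
  that stands on the left.\<close>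

definition skew :: "'v \<Rightarrow> 'v \<Rightarrow> 'v \<Rightarrow> bool"
  where "skew h g y \<longleftrightarrow> y \<in> V \<and> (\<forall>f. functional f \<longrightarrow> L f y = f y *s g + f h *s y)"

lemma grp_V: "g \<in> grp \<Longrightarrow> g \<in> V"
  and grp_nonzero: "g \<in> grp \<Longrightarrow> g \<noteq> 0"
  and L_grp: "g \<in> grp \<Longrightarrow> functional f \<Longrightarrow> L f g = f g *s g"
  by (auto simp: grp_def)

lemma R_grp: "g \<in> grp \<Longrightarrow> functional f \<Longrightarrow> R f g = f g *s g"
  by (rule functional_eqI) (simp add: L_R_dual[symmetric] L_grp functional_simps)

lemma eps_grp: "g \<in> grp \<Longrightarrow> eps g = 1"
  using L_grp[of g eps] L_eps[of g] scale_cancel_right[of "eps g" g 1]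
  by (simp add: functional_eps grp_V grp_nonzero)

text \<open>On a line spanned by \<open>u\<close> each \<open>L f\<close> is a scalar
  \<open>c f\<close>, and pairing with the counit gives \<open>c f * eps u = f u\<close>. Hence
  \<open>eps u\<close> cannot vanish, and dividing \<open>u\<close> by it yields a
  group-like.\<close>

lemma simple_contains_grp:
  assumes S: "subspace S" "S \<subseteq> V" "S \<noteq> {0}"
    and L: "\<And>f x. functional f \<Longrightarrow> x \<in> S \<Longrightarrow> L f x \<in> S"
    and R: "\<And>f x. functional f \<Longrightarrow> x \<in> S \<Longrightarrow> R f x \<in> S"
    and "\<And>T. \<lbrakk>subspace T; T \<subseteq> S; T \<noteq> {0};
        \<And>f x. functional f \<Longrightarrow> x \<in> T \<Longrightarrow> L f x \<in> T; \<And>f x. functional f \<Longrightarrow> x \<in> T \<Longrightarrow> R f x \<in> T\<rbrakk>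
        \<Longrightarrow> T = S"
  shows "\<exists>g\<in>S. g \<in> grp"
proof -
  obtain u where u: "u \<in> S" "S \<subseteq> range (\<lambda>c. c *s u)"
    using pointed[OF assms] by blast
  have u0: "u \<noteq> 0"
  proof
    assume "u = 0"
    then have "S \<subseteq> {0}" using u(2) by auto
    then show False using S(3) subspace_0[OF S(1)] by blast
  qed
  have uV: "u \<in> V" using u S by blast
  have "\<exists>c. L f u = c *s u" if "functional f" for f
    using L[OF that u(1)] u(2) by blast
  then obtain c where c: "L f u = c f *s u" if "functional f" for f by metis
  have f_u: "c f * eps u = f u" if f: "functional f" for f
    using L_R_dual[OF functional_eps f, of u] R_eps[OF uV] c[OF f]
    by (simp add: functional_scale functional_eps)
  have "eps u \<noteq> 0"
  proof
    assume "eps u = 0"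
    then have "f u = f 0" if "functional f" for f using f_u[OF that] functional_zero[OF that] by simp
    then show False using u0 functional_eqI by blast
  qed
  then have "inverse (eps u) *s u \<in> grp"
    using u0 uV subspace_scale[OF V_subspace uV]
    by (auto simp: grp_def L_scale c functional_scale f_u[symmetric])
  then show ?thesis using subspace_scale[OF S(1) u(1)] by blast
qed

lemma skew_V: "skew h g y \<Longrightarrow> y \<in> V"
  and L_skew: "skew h g y \<Longrightarrow> functional f \<Longrightarrow> L f y = f y *s g + f h *s y"
  by (auto simp: skew_def)

lemma R_skew: "skew h g y \<Longrightarrow> functional f \<Longrightarrow> R f y = f g *s y + f y *s h"
  by (rule functional_eqI) (simp add: L_R_dual[symmetric] L_skew functional_simps algebra_simps)

lemma skewI_R:
  assumes "y \<in> V" "\<And>f. functional f \<Longrightarrow> R f y = f g *s y + f y *s h"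
  shows "skew h g y"
  unfolding skew_def
proof (intro conjI allI impI assms(1))
  fix f assume f: "functional f"
  show "L f y = f y *s g + f h *s y"
    by (rule functional_eqI) (simp add: f L_R_dual assms(2) functional_simps algebra_simps)
qed

text \<open>Undoes the expansion over \<open>B\<close> in \<open>L_mul\<close>: the coordinates of
  \<open>x\<close> recombine inside the functional into left multiplication by
  \<open>x\<close>.\<close>

lemma L_left_mul_expand:
  assumes "functional f" "x \<in> V"
  shows "(\<Sum>b\<in>B. coord b x *s L (\<lambda>v. f (b \<star> v)) y) = L (\<lambda>v. f (x \<star> v)) y"
proof -
  have *: "f (x \<star> v) = (\<Sum>b\<in>B. coord b x * f (b \<star> v))" for v
  proof -
    have "f (x \<star> v) = f ((\<Sum>b\<in>B. coord b x *s b) \<star> v)"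
      using V_expand[OF assms(2)] by simp
    then show ?thesis
      by (simp add: mul_sum_left mul_scale_left functional_simps assms)
  qed
  show ?thesis
    unfolding * by (subst L_functional_sum) (simp_all add: functional_left_mul assms)
qed

text \<open>Multiply out (x \<otimes> g + h \<otimes> x) \<Delta>(y): the left factors
  \<open>x\<close> and \<open>h\<close> are absorbed into \<open>f\<close>, the right factors
  \<open>g\<close> and \<open>x\<close> stay outside.\<close>

lemma L_skew_mul:
  assumes "functional f" "skew h g x" "h \<in> V"
  shows "L f (x \<star> y) = g \<star> L (\<lambda>v. f (x \<star> v)) y + x \<star> L (\<lambda>v. f (h \<star> v)) y"
proof -
  have "L f (x \<star> y) = (\<Sum>b\<in>B. (coord b x *s g + coord b h *s x) \<star> L (\<lambda>v. f (b \<star> v)) y)"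
    using assms by (simp add: L_mul L_skew skew_V functional_coord cong: sum.cong)
  also have "\<dots> = g \<star> (\<Sum>b\<in>B. coord b x *s L (\<lambda>v. f (b \<star> v)) y)
      + x \<star> (\<Sum>b\<in>B. coord b h *s L (\<lambda>v. f (b \<star> v)) y)"
    by (simp add: mul_sum_right mul_simps sum.distrib)
  finally show ?thesis
    by (simp add: L_left_mul_expand assms skew_V[OF assms(2)])
qed

lemma L_grp_mul:
  assumes "functional f" "g \<in> grp"
  shows "L f (g \<star> y) = g \<star> L (\<lambda>v. f (g \<star> v)) y"
proof -
  have "L f (g \<star> y) = (\<Sum>b\<in>B. (coord b g *s g) \<star> L (\<lambda>v. f (b \<star> v)) y)"
    using assms by (simp add: L_mul L_grp grp_V functional_coord cong: sum.cong)
  also have "\<dots> = g \<star> (\<Sum>b\<in>B. coord b g *s L (\<lambda>v. f (b \<star> v)) y)"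
    by (simp add: mul_sum_right mul_simps)
  finally show ?thesis
    by (simp add: L_left_mul_expand assms grp_V[OF assms(2)])
qed

lemma skew_mul_grp:
  assumes "skew h g x" "k \<in> grp" "h \<in> V"
  shows "skew (h \<star> k) (g \<star> k) (x \<star> k)"
  unfolding skew_def
  using assms by (auto simp: L_skew_mul L_grp functional_left_mul mul_simps)

lemma skew_grp_mul:
  assumes "skew h g x" "k \<in> grp"
  shows "skew (k \<star> h) (k \<star> g) (k \<star> x)"
  unfolding skew_def
  using assms by (auto simp: L_grp_mul L_skew functional_left_mul mul_simps)

text \<open>Dedekind's argument: every group-like \<open>g\<close> is an eigenvector of
  \<open>L f\<close> with eigenvalue \<open>f g\<close>. In a relation
  \<open>g = (\<Sum>s\<in>A. u s *s s)\<close> each \<open>s\<close> with non-zero coefficient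
  satisfies \<open>f s = f g\<close> for all \<open>f\<close>, so it equals
  \<open>g\<close>.\<close>

lemma independent_grp:
  assumes "finite A" "A \<subseteq> grp"
  shows "independent A"
  using assms
proof (induction A rule: finite_induct)
  case (insert g A)
  have ind: "independent A" and gg: "g \<in> grp" using insert by auto
  have "g \<notin> span A"
  proof
    assume "g \<in> span A"
    then obtain u where u: "g = (\<Sum>s\<in>A. u s *s s)"
      using insert.hyps(1) by (auto simp: span_finite)
    have "\<exists>s\<in>A. u s \<noteq> 0"
    proof (rule ccontr)
      assume "\<not> (\<exists>s\<in>A. u s \<noteq> 0)"
      then have "(\<Sum>s\<in>A. u s *s s) = 0" by (intro sum.neutral) auto
      then show False using u grp_nonzero[OF gg] by metis
    qed
    then obtain s where s: "s \<in> A" "u s \<noteq> 0" by blast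
    have "s = g"
    proof (rule functional_eqI)
      fix f assume f: "functional f"
      have "f g *s g = L f (\<Sum>s\<in>A. u s *s s)"
        using L_grp[OF gg f] arg_cong[OF u, of "L f"] by metis
      also have "\<dots> = (\<Sum>s\<in>A. (u s * f s) *s s)"
        using insert.prems by (auto simp: L_sum L_scale L_grp f subset_iff intro!: sum.cong)
      finally have "(\<Sum>s\<in>A. (u s * f s) *s s) - f g *s (\<Sum>s\<in>A. u s *s s) = 0"
        using arg_cong[OF u, of "(*s) (f g)"] by (metis diff_self)
      then have "(\<Sum>s\<in>A. (u s * f s - f g * u s) *s s) = 0"
        by (simp add: scale_sum_right sum_subtractf[symmetric] algebra_simps)
      from independentD[OF ind insert.hyps(1) order_refl this s(1)] s(2)
      show "f s = f g" by auto
    qed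
    then show False using s insert.hyps by simp
  qed
  then show ?case by (intro independent_insertI ind)
qed (rule independent_empty)

end

section \<open>Finite groups of group-likes and the Taft-Wilson step\<close>

locale pointed_bialgebra_group = pointed_bialgebra scale V B coord mul unit eps L R
  for scale :: "complex \<Rightarrow> 'v::ab_group_add \<Rightarrow> 'v" (infixr "*s" 75)
    and V B coord and mul (infixl "\<star>" 70) and unit eps L R +
  assumes finite_grp: "finite grp"
    and unit_grp: "unit \<in> grp"
    and mul_grp: "g \<in> grp \<Longrightarrow> h \<in> grp \<Longrightarrow> g \<star> h \<in> grp"
    and inv_grp: "g \<in> grp \<Longrightarrow> \<exists>h\<in>grp. g \<star> h = unit \<and> h \<star> g = unit"
begin

text \<open>Extends the dual basis of \<open>grp\<close> to the whole space, as independence of the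
  group-likes permits; off \<open>span grp\<close> the extension is arbitrary but fixed.\<close>

definition dual :: "'v \<Rightarrow> 'v \<Rightarrow> complex"
  where "dual h = (SOME f. functional f \<and> (\<forall>g\<in>grp. f g = (if g = h then 1 else 0)))"

lemma functional_dual: "functional (dual h)"
  and dual_grp: "g \<in> grp \<Longrightarrow> dual h g = (if g = h then 1 else 0)"
proof -
  have "\<exists>f. functional f \<and> (\<forall>g\<in>grp. f g = (if g = h then 1 else 0))"
    by (rule functional_extend[OF independent_grp[OF finite_grp order_refl]])
  then have "functional (dual h) \<and> (\<forall>g\<in>grp. dual h g = (if g = h then 1 else 0))"
    unfolding dual_def by (rule someI_ex)
  then show "functional (dual h)" "g \<in> grp \<Longrightarrow> dual h g = (if g = h then 1 else 0)"
    by auto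
qed

lemma span_grp_expand:
  assumes "z \<in> span grp"
  shows "z = (\<Sum>h\<in>grp. dual h z *s h)"
proof -
  obtain u where u: "z = (\<Sum>s\<in>grp. u s *s s)"
    using assms finite_grp by (auto simp: span_finite)
  have "dual h z = u h" if "h \<in> grp" for h
  proof -
    have "dual h z = (\<Sum>s\<in>grp. u s * (if s = h then 1 else 0))"
      unfolding u by (simp add: functional_simps functional_dual dual_grp)
    also have "\<dots> = u h"
      using that finite_grp by (simp add: if_distrib cong: if_cong)
    finally show ?thesis .
  qed
  then show ?thesis using u by simp
qed

lemma span_grp_V: "span grp \<subseteq> V"
  by (rule span_minimal) (auto simp: grp_V V_subspace)

lemma L_span_grp: "x \<in> span grp \<Longrightarrow> functional f \<Longrightarrow> L f x \<in> span grp"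
  by (induction x rule: span_induct_alt)
    (auto simp: L_zero L_add L_scale L_grp span_zero span_add span_scale span_base)

lemma R_span_grp: "x \<in> span grp \<Longrightarrow> functional f \<Longrightarrow> R f x \<in> span grp"
  by (induction x rule: span_induct_alt)
    (auto simp: R_zero R_add R_scale R_grp span_zero span_add span_scale span_base)

lemma L_span_grp_zero:
  assumes "functional f" "x \<in> span grp" "\<And>g. g \<in> grp \<Longrightarrow> f g = 0"
  shows "L f x = 0"
  using assms(2)
  by (induction x rule: span_induct_alt) (auto simp: L_zero L_add L_scale L_grp assms)

text \<open>For a right coideal \<open>M\<close> containing \<open>span grp\<close> and for
  \<open>A\<close> the functionals that vanish on \<open>span grp\<close>, these are the matrix
  coefficients of the comodule \<open>M\<close> modulo \<open>span grp\<close>.\<close>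

definition left_coeffs :: "('v \<Rightarrow> complex) set \<Rightarrow> 'v set \<Rightarrow> 'v set"
  where "left_coeffs A M = span {L f m | f m. f \<in> A \<and> m \<in> M}"

text \<open>For one functional the elements \<open>L f m\<close> already form a subspace, the linear
  image of \<open>M\<close>; so a single \<open>m\<close> absorbs the whole contribution of
  \<open>f\<close>.\<close>

lemma left_coeffs_insert:
  assumes "functional f" "subspace M" "z \<in> left_coeffs (insert f A) M"
  shows "\<exists>m\<in>M. z - L f m \<in> left_coeffs A M"
  using assms(3) unfolding left_coeffs_def
proof (induction z rule: span_induct_alt)
  case base
  show ?case using assms by (auto intro!: bexI[of _ 0] simp: L_zero span_zero subspace_0)
next
  case (step c x z)
  let ?S = "span {L f m | f m. f \<in> A \<and> m \<in> M}"
  obtain k n where k: "x = L k n" "k \<in> insert f A" "n \<in> M" using step by blast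
  obtain m where m: "m \<in> M" "z - L f m \<in> ?S" using step by blast
  show ?case
  proof (cases "k = f")
    case True
    have "c *s x + z - L f (c *s n + m) = z - L f m"
      using True assms(1) k by (simp add: L_add L_scale)
    moreover have "c *s n + m \<in> M"
      using m k(3) assms(2) by (simp add: subspace_add subspace_scale)
    ultimately show ?thesis
      using m(2) by (intro bexI[of _ "c *s n + m"]) (simp_all only:)
  next
    case False
    have "c *s x \<in> ?S" using False k by (intro span_scale span_base) auto
    from span_add[OF this m(2)] m(1) show ?thesis
      by (intro bexI[of _ m]) (auto simp: algebra_simps)
  qed
qed

lemma left_coeffs_finite:
  assumes "z \<in> left_coeffs A M"
  shows "\<exists>A'. finite A' \<and> A' \<subseteq> A \<and> z \<in> left_coeffs A' M"
  using assms unfolding left_coeffs_def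
proof (induction z rule: span_induct_alt)
  case base
  show ?case by (intro exI[of _ "{}"]) (auto simp: span_zero)
next
  case (step c x z)
  obtain k n where k: "x = L k n" "k \<in> A" "n \<in> M" using step by blast
  obtain A' where A': "finite A'" "A' \<subseteq> A" "z \<in> span {L f m | f m. f \<in> A' \<and> m \<in> M}"
    using step by blast
  have "x \<in> span {L f m | f m. f \<in> insert k A' \<and> m \<in> M}"
    using k by (intro span_base) auto
  moreover have "z \<in> span {L f m | f m. f \<in> insert k A' \<and> m \<in> M}"
    by (rule subsetD[OF span_mono A'(3)]) auto
  ultimately show ?case
    using A' k by (intro exI[of _ "insert k A'"]) (auto intro: span_add span_scale)
qed

text \<open>\<open>R k\<close> passes through \<open>L f\<close> by coassociativity and acts on the
  argument, which stays in the right coideal \<open>M\<close>.\<close>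

lemma R_left_coeffs:
  assumes "\<And>f. f \<in> A \<Longrightarrow> functional f" "functional k"
    and "\<And>f x. functional f \<Longrightarrow> x \<in> M \<Longrightarrow> R f x \<in> M" "z \<in> left_coeffs A M"
  shows "R k z \<in> left_coeffs A M"
  using assms(4) unfolding left_coeffs_def
proof (induction z rule: span_induct_alt)
  case (step c x z)
  then obtain f m where f: "x = L f m" "f \<in> A" "m \<in> M" by blast
  have "R k x \<in> span {L f m | f m. f \<in> A \<and> m \<in> M}"
    using f assms(1-3) by (intro span_base CollectI exI[of _ f] exI[of _ "R k m"]) (auto simp: R_L_commute)
  with step show ?case by (auto simp: R_add R_scale assms span_add span_scale)
qed (simp add: R_zero assms span_zero)

text \<open>A right coideal \<open>M\<close> minimal above the span of the group-likes: the left coefficients of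
  \<open>M\<close> modulo that span form a subcoalgebra, so they contain a group-like \<open>g\<close>, and \<open>g\<close> must be
  the weight of the simple quotient.\<close>
lemma ex_weight_vector:
  assumes "\<not> V \<subseteq> span grp"
  shows "\<exists>x g. x \<in> V \<and> x \<notin> span grp \<and> g \<in> grp \<and>
    (\<forall>f. functional f \<longrightarrow> R f x - f g *s x \<in> span grp)"
proof -
  define P where "P S \<longleftrightarrow> subspace S \<and> S \<subseteq> V \<and> span grp \<subset> S \<and>
    (\<forall>f x. functional f \<longrightarrow> x \<in> S \<longrightarrow> R f x \<in> S)" for S
  have "span grp \<subset> V" using assms span_grp_V by blast
  then have PV: "P V" unfolding P_def using V_subspace by simp
  have PS: "subspace S \<and> S \<subseteq> span B" if "P S" for S
    using that V_span unfolding P_def by (meson subset_trans)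
  obtain M where M: "P M" and Mmin: "\<And>T. P T \<Longrightarrow> T \<subseteq> M \<Longrightarrow> T = M"
    using minimal_subspace_exists[of B P, OF finite_B PV PS] by blast
  have subM: "subspace M" and MV: "M \<subseteq> V" and MH: "span grp \<subset> M"
    and RM: "\<And>f x. functional f \<Longrightarrow> x \<in> M \<Longrightarrow> R f x \<in> M"
    using M unfolding P_def by blast+
  \<comment> \<open>\<open>N\<close> is the dual of the quotient by \<open>span grp\<close>, so that
    \<open>C\<close> is the coefficient space of \<open>M\<close> modulo
    \<open>span grp\<close>.\<close>
  define N where "N = {f. functional f \<and> (\<forall>g\<in>grp. f g = 0)}"
  define C where "C = left_coeffs N M"
  have C_sub: "subspace C" by (simp add: C_def left_coeffs_def)
  have C_V: "C \<subseteq> V" unfolding C_def left_coeffs_def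
    by (rule span_minimal) (auto simp: N_def V_subspace)
  have C_R: "R f x \<in> C" if "functional f" "x \<in> C" for f x
    unfolding C_def
    by (rule R_left_coeffs[OF _ that(1) RM that(2)[unfolded C_def]]) (auto simp: N_def)
  have C_L: "L f x \<in> C" if f: "functional f" and x: "x \<in> C" for f x
    using x unfolding C_def left_coeffs_def
  proof (induction x rule: span_induct_alt)
    case (step c x z)
    then obtain k m where k: "x = L k m" "k \<in> N" "m \<in> M" by blast
    \<comment> \<open>Convolution with \<open>f\<close> preserves \<open>N\<close>, because
      \<open>R f\<close> multiplies each group-like by a scalar.\<close>
    have "(\<lambda>v. k (R f v)) \<in> N"
      using k(2) f by (auto simp: N_def functional_def R_add R_scale R_grp)
    then have "L f x \<in> span {L f m | f m. f \<in> N \<and> m \<in> M}"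
      using k f by (intro span_base) (auto simp: L_L N_def)
    with step show ?case by (auto simp: L_add L_scale f span_add span_scale)
  qed (simp add: L_zero f span_zero)
  have C_nz: "C \<noteq> {0}"
  proof
    assume C0: "C = {0}"
    obtain x where x: "x \<in> M" "x \<notin> span grp" using MH by auto
    then obtain f where f: "functional f" "\<forall>s\<in>span grp. f s = 0" "f x = 1"
      using functional_separates[OF subspace_span] by blast
    then have "f \<in> N" by (auto simp: N_def span_base)
    then have "L f x \<in> C" using x unfolding C_def left_coeffs_def by (intro span_base) auto
    then have "L f x = 0" using C0 by simp
    \<comment> \<open>The counit recovers \<open>f x = 1\<close> from the coefficient
      \<open>L f x\<close>, which therefore is not zero.\<close>
    moreover have "eps (L f x) = f (R eps x)" by (simp add: L_R_dual functional_eps f)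
    moreover have "R eps x = x" using x MV by (auto intro: R_eps)
    ultimately show False using f functional_zero[OF functional_eps] by simp
  qed
  define Q where "Q S \<longleftrightarrow> subspace S \<and> S \<subseteq> C \<and> S \<noteq> {0} \<and>
    (\<forall>f x. functional f \<longrightarrow> x \<in> S \<longrightarrow> L f x \<in> S) \<and>
    (\<forall>f x. functional f \<longrightarrow> x \<in> S \<longrightarrow> R f x \<in> S)" for S
  have QC: "Q C" unfolding Q_def using C_sub C_nz C_L C_R by simp
  have QS: "subspace S \<and> S \<subseteq> span B" if "Q S" for S
    using that V_span C_V unfolding Q_def by (meson subset_trans)
  obtain D where D: "Q D" and Dmin: "\<And>T. Q T \<Longrightarrow> T \<subseteq> D \<Longrightarrow> T = D"
    using minimal_subspace_exists[of B Q, OF finite_B QC QS] by blast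
  have DC: "D \<subseteq> C" and subD: "subspace D" and D0: "D \<noteq> {0}"
    and LD: "\<And>f x. functional f \<Longrightarrow> x \<in> D \<Longrightarrow> L f x \<in> D"
    and RD: "\<And>f x. functional f \<Longrightarrow> x \<in> D \<Longrightarrow> R f x \<in> D"
    using D unfolding Q_def by simp_all
  have "\<exists>g\<in>D. g \<in> grp"
  proof (rule simple_contains_grp[OF subD _ D0 LD RD])
    show "D \<subseteq> V" using DC C_V by (rule subset_trans)
    fix T assume T: "subspace T" "T \<subseteq> D" "T \<noteq> {0}"
      "\<And>f x. functional f \<Longrightarrow> x \<in> T \<Longrightarrow> L f x \<in> T" "\<And>f x. functional f \<Longrightarrow> x \<in> T \<Longrightarrow> R f x \<in> T"
    have "T \<subseteq> C" using T(2) DC by (rule subset_trans)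
    then have "Q T" unfolding Q_def using T by simp
    then show "T = D" using T(2) by (rule Dmin)
  qed
  then obtain g where g: "g \<in> C" "g \<in> grp"
    using DC by blast
  \<comment> \<open>A set of functionals of least size that still produces \<open>g\<close>: once a
    functional \<open>l\<close> is removed, \<open>g\<close> is no longer among the coefficients
    \<open>?Q\<close> of the others.\<close>
  obtain A where A: "finite A" "A \<subseteq> N" "g \<in> left_coeffs A M"
    and A_min: "\<And>A'. finite A' \<Longrightarrow> A' \<subseteq> N \<Longrightarrow> g \<in> left_coeffs A' M \<Longrightarrow> card A \<le> card A'"
  proof -
    let ?T = "\<lambda>A. finite A \<and> A \<subseteq> N \<and> g \<in> left_coeffs A M"
    obtain A0 where "?T A0" using left_coeffs_finite[OF g(1)[unfolded C_def]] by blast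
    from ex_has_least_nat[of ?T, OF this, of card]
    obtain A where "?T A \<and> (\<forall>A'. ?T A' \<longrightarrow> card A \<le> card A')" ..
    then show ?thesis by (intro that[of A]) simp_all
  qed
  have "A \<noteq> {}"
  proof
    assume "A = {}"
    then have "g \<in> span {}" using A(3) by (simp add: left_coeffs_def)
    then show False using grp_nonzero[OF g(2)] by simp
  qed
  then obtain l A' where A': "A = insert l A'" "l \<notin> A'" by (meson Set.set_insert ex_in_conv)
  then have l: "functional l" "\<And>g. g \<in> grp \<Longrightarrow> l g = 0" and A'N: "A' \<subseteq> N"
    using A(2) by (auto simp: N_def)
  let ?Q = "left_coeffs A' M"
  have Q_sub: "subspace ?Q" by (simp add: left_coeffs_def)
  have Q_R: "R f x \<in> ?Q" if "functional f" "x \<in> ?Q" for f x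
    by (rule R_left_coeffs[OF _ that(1) RM that(2)]) (use A'N in \<open>auto simp: N_def\<close>)
  have "finite A'" using A(1) A' by simp
  then have gQ: "g \<notin> ?Q" using A_min[OF _ A'N] A' by fastforce
  obtain x where x: "x \<in> M" "g - L l x \<in> ?Q"
    using left_coeffs_insert[OF l(1) subM, of g A'] A(3) A' by auto
  \<comment> \<open>\<open>L l\<close> commutes with the operators \<open>R f\<close>, which
    preserve \<open>?Q\<close>; so \<open>K\<close> is a right coideal between
    \<open>span grp\<close> and \<open>M\<close>. It misses \<open>x\<close>, and minimality of
    \<open>M\<close> leaves only \<open>K = span grp\<close>.\<close>
  define K where "K = {m \<in> M. L l m \<in> ?Q}"
  have xK: "x \<notin> K"
  proof
    assume "x \<in> K"
    then have "g - L l x + L l x \<in> ?Q"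
      unfolding K_def by (intro subspace_add[OF Q_sub x(2)]) simp
    then show False using gQ by simp
  qed
  have K_sub: "subspace K"
    unfolding K_def using subM Q_sub l(1)
    by (intro subspaceI) (simp_all add: L_zero L_add L_scale subspace_0 subspace_add subspace_scale)
  have K_R: "R f m \<in> K" if "functional f" "m \<in> K" for f m
    using that RM[OF that(1)] Q_R[OF that(1), of "L l m"] l(1)
    by (simp add: K_def R_L_commute[symmetric])
  have HK: "span grp \<subseteq> K"
  proof
    fix z assume z: "z \<in> span grp"
    then have "L l z = 0" by (rule L_span_grp_zero[OF l(1) _ l(2)])
    then show "z \<in> K" using z MH subspace_0[OF Q_sub] by (auto simp: K_def)
  qed
  have KM: "K \<subseteq> M" by (auto simp: K_def)
  have KH: "K = span grp"
  proof (rule ccontr)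
    assume "K \<noteq> span grp"
    then have "P K" unfolding P_def using K_sub KM MV HK K_R by blast
    from Mmin[OF this KM] xK x(1) show False by simp
  qed
  \<comment> \<open>Modulo \<open>?Q\<close> the vector \<open>L l x\<close> is \<open>g\<close>, on
    which \<open>R f\<close> acts as \<open>f g\<close>. So \<open>L l\<close> sends the difference
    into \<open>?Q\<close>, which puts the difference into \<open>K\<close>.\<close>
  have "R f x - f g *s x \<in> span grp" if f: "functional f" for f
  proof -
    have "R f (g - L l x) - f g *s (g - L l x) = - L l (R f x - f g *s x)"
      by (simp add: R_diff R_L_commute R_grp g(2) f l(1) L_diff L_scale scale_right_diff_distrib)
    moreover have "R f (g - L l x) - f g *s (g - L l x) \<in> ?Q"
      by (rule subspace_diff[OF Q_sub Q_R[OF f x(2)] subspace_scale[OF Q_sub x(2)]])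
    ultimately have "L l (R f x - f g *s x) \<in> ?Q"
      using subspace_neg[OF Q_sub, of "- L l (R f x - f g *s x)"] by simp
    moreover have "R f x - f g *s x \<in> M"
      by (rule subspace_diff[OF subM RM[OF f x(1)] subspace_scale[OF subM x(1)]])
    ultimately show ?thesis by (simp add: KH[symmetric] K_def)
  qed
  moreover have "x \<in> V" "x \<notin> span grp" using x(1) MV xK KH by blast+
  ultimately show ?thesis using g(2) by blast
qed

end

context pointed_bialgebra_group
begin

lemma span_grp_mul_right:
  assumes "x \<in> span grp" "k \<in> grp"
  shows "x \<star> k \<in> span grp"
  using assms(1)
proof (induction x rule: span_induct_alt)
  case (step c x y)
  then show ?case
    using span_add[OF span_scale[OF span_base[OF mul_grp[OF step(1) assms(2)]]] step(2)]
    by (simp add: mul_simps)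
qed (simp add: span_zero)

lemma span_grp_mul_left:
  assumes "x \<in> span grp" "k \<in> grp"
  shows "k \<star> x \<in> span grp"
  using assms(1)
proof (induction x rule: span_induct_alt)
  case (step c x y)
  then show ?case
    using span_add[OF span_scale[OF span_base[OF mul_grp[OF assms(2) step(1)]]] step(2)]
    by (simp add: mul_simps)
qed (simp add: span_zero)

definition ginv :: "'v \<Rightarrow> 'v"
  where "ginv g = (SOME h. h \<in> grp \<and> g \<star> h = unit \<and> h \<star> g = unit)"

lemma assumes "g \<in> grp"
  shows ginv_grp [simp]: "ginv g \<in> grp"
    and mul_inv_right [simp]: "g \<star> ginv g = unit"
    and mul_inv_left [simp]: "ginv g \<star> g = unit"
proof -
  have "\<exists>h. h \<in> grp \<and> g \<star> h = unit \<and> h \<star> g = unit"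
    using inv_grp[OF assms] by blast
  from someI_ex[OF this]
  show "ginv g \<in> grp" "g \<star> ginv g = unit" "ginv g \<star> g = unit" by (simp_all add: ginv_def)
qed

lemma mul_inv_cancel [simp]:
  assumes "g \<in> grp" "x \<in> V"
  shows "g \<star> (ginv g \<star> x) = x" "ginv g \<star> (g \<star> x) = x" "x \<star> ginv g \<star> g = x" "x \<star> g \<star> ginv g = x"
  using assms by (simp_all add: mul_assoc[symmetric]) (simp_all add: mul_assoc)

lemma not_span_grp_mul_right:
  "x \<in> V \<Longrightarrow> x \<notin> span grp \<Longrightarrow> k \<in> grp \<Longrightarrow> x \<star> k \<notin> span grp"
  using span_grp_mul_right[of "x \<star> k" "ginv k"] by auto

lemma not_span_grp_mul_left:
  "x \<in> V \<Longrightarrow> x \<notin> span grp \<Longrightarrow> k \<in> grp \<Longrightarrow> k \<star> x \<notin> span grp"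
  using span_grp_mul_left[of "k \<star> x" "ginv k"] by auto

text \<open>With \<open>\<Delta>(x) = x \<otimes> g + \<Sum>\<^sub>h h \<otimes> y\<^sub>h\<close>, coassociativity makes every \<open>y\<^sub>h\<close> skew-primitive.\<close>
lemma ex_skew_not_in_span:
  assumes "\<not> V \<subseteq> span grp"
  shows "\<exists>h y. h \<in> grp \<and> skew h unit y \<and> y \<notin> span grp"
proof -
  obtain x g where x: "x \<in> V" "x \<notin> span grp" and g: "g \<in> grp"
    and R: "\<And>f. functional f \<Longrightarrow> R f x - f g *s x \<in> span grp"
    using ex_weight_vector[OF assms] by blast
  \<comment> \<open>Applying \<open>dual h\<close> to the left factors of the expected expansion
    leaves \<open>dual h x *s g + y h\<close>; the definition solves this for
    \<open>y h\<close>.\<close>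
  define y where "y h = L (dual h) x - dual h x *s g" for h
  have Rx: "R f x = f g *s x + (\<Sum>h\<in>grp. f (y h) *s h)" if f: "functional f" for f
  proof -
    have "dual h (R f x - f g *s x) = f (y h)" for h
      by (simp add: y_def f functional_simps functional_dual L_R_dual)
    then show ?thesis
      using span_grp_expand[OF R[OF f]] by (simp add: algebra_simps)
  qed
  have skew: "skew h g (y h)" if h: "h \<in> grp" for h
  proof (rule skewI_R)
    show "y h \<in> V"
      using g by (auto simp: y_def functional_dual grp_V intro!: subspace_diff subspace_scale V_subspace)
    fix f assume f: "functional f"
    have Ry: "R f (y h) = L (dual h) (R f x) - (dual h x * f g) *s g"
      by (simp add: y_def R_diff R_scale R_L_commute R_grp f functional_dual g)
    have Lk: "L (dual h) k = (if k = h then k else 0)" if "k \<in> grp" for k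
      using that by (simp add: L_grp functional_dual dual_grp)
    have "L (dual h) (R f x)
        = f g *s L (dual h) x + (\<Sum>k\<in>grp. f (y k) *s (if k = h then k else 0))"
      by (simp add: Rx f functional_dual L_add L_scale L_sum Lk cong: sum.cong)
    also have "(\<Sum>k\<in>grp. f (y k) *s (if k = h then k else 0)) = f (y h) *s h"
      using h finite_grp by (simp add: if_distrib cong: if_cong)
    finally show "R f (y h) = f g *s y h + f (y h) *s h"
      using Ry by (simp add: y_def algebra_simps)
  qed
  \<comment> \<open>The counit, applied to the left factors, rebuilds \<open>x\<close> from the
    \<open>y h\<close>; as \<open>x\<close> is outside the span, so is one of them.\<close>
  have "x = eps x *s g + (\<Sum>h\<in>grp. y h)"
  proof (rule functional_eqI)
    fix f assume f: "functional f"
    have "f x = eps (R f x)" using L_R_dual[OF f functional_eps, of x] x by (simp add: L_eps)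
    then show "f x = f (eps x *s g + (\<Sum>h\<in>grp. y h))"
      by (simp add: Rx f functional_simps functional_eps eps_grp cong: sum.cong)
  qed
  moreover have "eps x *s g \<in> span grp" using g by (simp add: span_base span_scale)
  ultimately have "(\<Sum>h\<in>grp. y h) \<notin> span grp" using x(2) span_add by metis
  then obtain h where h: "h \<in> grp" "y h \<notin> span grp" using span_sum by metis
  \<comment> \<open>Right translation by the inverse of \<open>g\<close> normalises the second index
    to \<open>unit\<close>.\<close>
  have "skew (h \<star> ginv g) unit (y h \<star> ginv g)"
    using skew_mul_grp[OF skew[OF h(1)] ginv_grp[OF g]] g h(1) by (simp add: grp_V)
  then show ?thesis
    using g h not_span_grp_mul_right[OF skew_V[OF skew[OF h(1)]] h(2)]
    by (intro exI[of _ "h \<star> ginv g"] exI[of _ "y h \<star> ginv g"]) (simp add: mul_grp)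
qed

lemma skew_conj:
  assumes "skew h unit y" "h \<in> grp" "u \<in> grp"
  shows "skew (u \<star> h \<star> ginv u) unit (u \<star> y \<star> ginv u)"
  using skew_mul_grp[OF skew_grp_mul[OF assms(1,3)] ginv_grp[OF assms(3)]] assms(3)
  by (simp add: grp_V)

lemma skew_add: "skew h g x \<Longrightarrow> skew h g y \<Longrightarrow> skew h g (x + y)"
  by (auto simp: skew_def L_add functional_add algebra_simps intro: subspace_add[OF V_subspace])

lemma skew_scale: "skew h g x \<Longrightarrow> skew h g (c *s x)"
  by (auto simp: skew_def L_scale functional_scale algebra_simps intro: subspace_scale[OF V_subspace])

lemma skew_zero: "skew h g 0"
  by (auto simp: skew_def L_zero functional_zero intro: subspace_0[OF V_subspace])

end

section \<open>Diagonal braidings of affine type\<close>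

text \<open>Skew-primitives \<open>y\<^sub>i\<close> of degrees \<open>d\<^sub>i\<close> on which a finite group \<open>\<Gamma>\<close> of group-likes containing
  all \<open>d\<^sub>i\<close> acts by characters \<open>\<chi>\<^sub>i\<close>; the braiding matrix is \<open>q\<^sub>j\<^sub>i = \<chi>\<^sub>i(d\<^sub>j)\<close>.\<close>
locale diagonal_family = pointed_bialgebra_group scale V B coord mul unit eps L R
  for scale :: "complex \<Rightarrow> 'v::ab_group_add \<Rightarrow> 'v" (infixr "*s" 75)
    and V B coord and mul (infixl "\<star>" 70) and unit eps L R +
  fixes I :: "'i set" and \<Gamma> :: "'v set" and y d :: "'i \<Rightarrow> 'v" and \<chi> :: "'i \<Rightarrow> 'v \<Rightarrow> complex"
  assumes Gamma_grp: "\<Gamma> \<subseteq> grp"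
    and unit_Gamma: "unit \<in> \<Gamma>"
    and mul_Gamma: "a \<in> \<Gamma> \<Longrightarrow> b \<in> \<Gamma> \<Longrightarrow> a \<star> b \<in> \<Gamma>"
    and d_Gamma: "i \<in> I \<Longrightarrow> d i \<in> \<Gamma>"
    and d_inj: "inj_on d I"
    and y_not_span: "i \<in> I \<Longrightarrow> y i \<notin> span grp"
    and y_skew: "i \<in> I \<Longrightarrow> skew (d i) unit (y i)"
    and y_character: "i \<in> I \<Longrightarrow> a \<in> \<Gamma> \<Longrightarrow> a \<star> y i = \<chi> i a *s (y i \<star> a)"
begin

lemma finite_Gamma: "finite \<Gamma>"
  using Gamma_grp finite_grp finite_subset by blast

lemma Gamma_V: "a \<in> \<Gamma> \<Longrightarrow> a \<in> V"
  using Gamma_grp grp_V by blast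

text \<open>An injective self-map of a finite set is onto. This bijection and the next one reindex
  the averages over \<Gamma> in \<open>ex_coordinate_functional\<close>.\<close>

lemma bij_left_mul_Gamma:
  assumes "a \<in> \<Gamma>"
  shows "bij_betw (\<lambda>b. a \<star> b) \<Gamma> \<Gamma>"
proof -
  have "inj_on (\<lambda>b. a \<star> b) \<Gamma>"
  proof (rule inj_onI)
    fix b c assume "b \<in> \<Gamma>" "c \<in> \<Gamma>" "a \<star> b = a \<star> c"
    then have "ginv a \<star> (a \<star> b) = ginv a \<star> (a \<star> c)" by simp
    then show "b = c" using assms Gamma_grp \<open>b \<in> \<Gamma>\<close> \<open>c \<in> \<Gamma>\<close> by (simp add: subset_iff grp_V)
  qed
  moreover have "(\<lambda>b. a \<star> b) ` \<Gamma> \<subseteq> \<Gamma>" using mul_Gamma[OF assms] by blast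
  ultimately show ?thesis
    using endo_inj_surj[OF finite_Gamma] by (simp add: bij_betw_def)
qed

lemma bij_right_mul_Gamma:
  assumes "a \<in> \<Gamma>"
  shows "bij_betw (\<lambda>b. b \<star> a) \<Gamma> \<Gamma>"
proof -
  have "inj_on (\<lambda>b. b \<star> a) \<Gamma>"
  proof (rule inj_onI)
    fix b c assume "b \<in> \<Gamma>" "c \<in> \<Gamma>" "b \<star> a = c \<star> a"
    then have "b \<star> a \<star> ginv a = c \<star> a \<star> ginv a" by simp
    then show "b = c" using assms Gamma_grp \<open>b \<in> \<Gamma>\<close> \<open>c \<in> \<Gamma>\<close> by (simp add: subset_iff grp_V)
  qed
  moreover have "(\<lambda>b. b \<star> a) ` \<Gamma> \<subseteq> \<Gamma>" using mul_Gamma[OF _ assms] by blast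
  ultimately show ?thesis
    using endo_inj_surj[OF finite_Gamma] by (simp add: bij_betw_def)
qed

lemma y_V: "i \<in> I \<Longrightarrow> y i \<in> V"
  using y_skew skew_V by blast

lemma y_mul_nonzero:
  assumes "i \<in> I" "a \<in> \<Gamma>"
  shows "y i \<star> a \<noteq> 0"
  using not_span_grp_mul_right[OF y_V[OF assms(1)] y_not_span[OF assms(1)], of a] assms(2) Gamma_grp
    span_zero by auto

lemma character_mul:
  assumes "i \<in> I" "a \<in> \<Gamma>" "b \<in> \<Gamma>"
  shows "\<chi> i (a \<star> b) = \<chi> i a * \<chi> i b"
proof -
  have "\<chi> i (a \<star> b) *s (y i \<star> (a \<star> b)) = a \<star> (b \<star> y i)"
    using assms by (simp add: y_character[symmetric] mul_Gamma mul_assoc)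
  also have "\<dots> = \<chi> i b *s (a \<star> y i \<star> b)"
    using assms by (simp add: y_character[of i b] mul_simps mul_assoc)
  also have "\<dots> = (\<chi> i a * \<chi> i b) *s (y i \<star> (a \<star> b))"
    using assms by (simp add: y_character[of i a] mul_simps mul_assoc mult.commute)
  finally show ?thesis
    using y_mul_nonzero assms mul_Gamma by simp
qed

lemma character_nonzero:
  assumes "i \<in> I" "a \<in> \<Gamma>"
  shows "\<chi> i a \<noteq> 0"
proof
  assume "\<chi> i a = 0"
  then have "a \<star> y i = 0" using y_character[OF assms] by simp
  then have "y i = 0"
    using mul_inv_cancel(2)[of a "y i"] assms Gamma_grp by (auto simp: y_V subset_iff)
  then show False using y_not_span[OF assms(1)] span_zero by simp
qed

text \<open>A functional \<open>p\<close> that separates \<open>y i\<close> from the span of the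
  group-likes is cut down to the bidegree of \<open>y i\<close> and then averaged over translations
  by \<Gamma>. The cut removes the other \<open>y j\<close>; right averaging makes the value on
  \<open>y j \<star> a\<close> independent of \<open>a\<close>, and weighted left averaging makes
  the functional transform by \<open>\<chi> i\<close>.\<close>

lemma ex_coordinate_functional:
  assumes "i \<in> I"
  shows "\<exists>f. functional f \<and> (\<forall>a\<in>\<Gamma>. f a = 0) \<and>
    (\<forall>j\<in>I. \<forall>a\<in>\<Gamma>. f (y j \<star> a) = (if j = i then 1 else 0)) \<and>
    (\<forall>a\<in>\<Gamma>. \<forall>x. f (a \<star> x) = \<chi> i a * f x)"
proof -
  obtain p where p: "functional p" "\<forall>s\<in>span grp. p s = 0" "p (y i) = 1"
    using functional_separates[OF subspace_span y_not_span[OF assms]] by blast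
  \<comment> \<open>\<open>L (dual (d i))\<close> keeps the part with left factor
    \<open>d i\<close>, and \<open>R (dual unit)\<close> the part with right factor
    \<open>unit\<close>; group-like remainders die under \<open>p\<close>. Since \<Delta>(y_j a) =
    y_j a \<otimes> a + d_j a \<otimes> y_j a, only j = i with a = \<open>unit\<close> can
    survive.\<close>
  define r where "r x = p (R (dual unit) (L (dual (d i)) x))" for x
  have r: "functional r"
    unfolding r_def by (rule functionalI)
      (simp_all add: L_add L_scale R_add R_scale functional_dual functional_simps p(1))
  have dG: "d j \<in> grp" if "j \<in> I" for j using d_Gamma[OF that] Gamma_grp by blast
  have r_grp: "r g = 0" if "g \<in> grp" for g
    using that p(2) by (simp add: r_def L_span_grp R_span_grp functional_dual span_base)
  have r_y: "r (y j \<star> a) = (if j = i \<and> a = unit then 1 else 0)" if j: "j \<in> I" and a: "a \<in> \<Gamma>" for j a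
  proof -
    have sk: "skew (d j \<star> a) a (y j \<star> a)"
      using skew_mul_grp[OF y_skew[OF j], of a] a Gamma_grp dG[OF j] by (auto simp: grp_V subset_iff)
    have ag: "a \<in> grp" "d j \<star> a \<in> grp" using a Gamma_grp dG[OF j] mul_grp by auto
    have L1: "L (dual (d i)) (y j \<star> a)
        = dual (d i) (y j \<star> a) *s a + (if d j \<star> a = d i then 1 else 0) *s (y j \<star> a)"
      using L_skew[OF sk functional_dual] ag by (simp add: dual_grp)
    have R1: "R (dual unit) (y j \<star> a)
        = (if a = unit then 1 else 0) *s (y j \<star> a) + dual unit (y j \<star> a) *s (d j \<star> a)"
      using R_skew[OF sk functional_dual] ag by (simp add: dual_grp)
    have pa: "p a = 0" "p (d j \<star> a) = 0" using p(2) ag by (auto simp: span_base)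
    have "r (y j \<star> a) = (if d j \<star> a = d i then 1 else 0) * (if a = unit then 1 else 0) * p (y j \<star> a)"
      by (simp add: r_def L1 R_add R_scale functional_dual R_grp ag R1 functional_simps p(1) pa)
    \<comment> \<open>Distinctness of the degrees is what separates the members of the
      family.\<close>
    moreover have "d j \<star> a = d i \<and> a = unit \<longleftrightarrow> j = i \<and> a = unit"
      using inj_onD[OF d_inj _ j assms] grp_V[OF dG[OF j]] by auto
    ultimately show ?thesis
      using p(3) y_V[OF assms] by auto
  qed
  define c where "c = of_nat (card \<Gamma>) * (1::complex)"
  have c: "c \<noteq> 0" using finite_Gamma unit_Gamma by (auto simp: c_def)
  \<comment> \<open>The divisor is one factor \<open>card \<Gamma>\<close>, not two: on
    \<open>y j \<star> a\<close> each \<open>b\<close> contributes through exactly one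
    \<open>e\<close>, whereas all \<open>b\<close> contribute equally.\<close>
  define f where "f x = (\<Sum>b\<in>\<Gamma>. \<Sum>e\<in>\<Gamma>. inverse (\<chi> i b) * r (b \<star> x \<star> e)) / c" for x
  have f: "functional f"
  proof (rule functionalI)
    show "f (x + z) = f x + f z" for x z
      by (simp only: f_def mul_add_left mul_add_right functional_add[OF r] distrib_left sum.distrib
          add_divide_distrib)
    show "f (u *s x) = u * f x" for u x
      by (simp only: f_def mul_scale_left mul_scale_right functional_scale[OF r]
          mult.left_commute[of _ u] sum_distrib_left[symmetric] times_divide_eq_right)
  qed
  have f_Gamma: "f a = 0" if "a \<in> \<Gamma>" for a
    using that mul_grp Gamma_grp by (simp add: f_def r_grp subset_iff)
  have f_y: "f (y j \<star> a) = (if j = i then 1 else 0)" if j: "j \<in> I" and a: "a \<in> \<Gamma>" for j a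
  proof -
    have "(\<Sum>e\<in>\<Gamma>. inverse (\<chi> i b) * r (b \<star> (y j \<star> a) \<star> e)) = (if j = i then 1 else 0)"
      if b: "b \<in> \<Gamma>" for b
    proof -
      have ba: "b \<star> a \<in> \<Gamma>" using a b by (rule mul_Gamma[rotated])
      have "r (b \<star> (y j \<star> a) \<star> e) = \<chi> j b * r (y j \<star> (b \<star> a \<star> e))" for e
        using y_character[OF j b] r by (simp add: mul_assoc[symmetric] mul_simps functional_simps)
      then have "(\<Sum>e\<in>\<Gamma>. inverse (\<chi> i b) * r (b \<star> (y j \<star> a) \<star> e))
          = (\<Sum>e\<in>\<Gamma>. inverse (\<chi> i b) * \<chi> j b * r (y j \<star> (b \<star> a \<star> e)))"
        by (simp add: mult.assoc)
      also have "\<dots> = (\<Sum>e\<in>\<Gamma>. inverse (\<chi> i b) * \<chi> j b * r (y j \<star> e))"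
        by (rule sum.reindex_bij_betw[OF bij_left_mul_Gamma[OF ba]])
      also have "\<dots> = (\<Sum>e\<in>\<Gamma>. if e = unit then (if j = i then 1 else 0) else 0)"
        using character_nonzero[OF j b] by (intro sum.cong) (auto simp: r_y j)
      also have "\<dots> = (if j = i then 1 else 0)"
        using finite_Gamma unit_Gamma by simp
      finally show ?thesis .
    qed
    then show ?thesis using c by (simp add: f_def c_def)
  qed
  have f_left: "f (a \<star> x) = \<chi> i a * f x" if a: "a \<in> \<Gamma>" for a x
  proof -
    let ?h = "\<lambda>b. \<Sum>e\<in>\<Gamma>. inverse (\<chi> i b) * r (b \<star> x \<star> e)"
    have "(\<Sum>b\<in>\<Gamma>. \<Sum>e\<in>\<Gamma>. inverse (\<chi> i b) * r (b \<star> (a \<star> x) \<star> e)) = (\<Sum>b\<in>\<Gamma>. \<chi> i a * ?h (b \<star> a))"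
      using character_nonzero[OF assms] a
      by (intro sum.cong refl)
        (simp add: sum_distrib_left character_mul assms mul_assoc field_simps)
    also have "\<dots> = (\<Sum>b\<in>\<Gamma>. \<chi> i a * ?h b)"
      by (rule sum.reindex_bij_betw[OF bij_right_mul_Gamma[OF a]])
    finally show ?thesis
      by (simp add: f_def sum_distrib_left[symmetric])
  qed
  show ?thesis using f f_Gamma f_y f_left by blast
qed

end

section \<open>Skew derivations and the filtration by word length\<close>

context diagonal_family
begin

definition coordinate :: "'i \<Rightarrow> 'v \<Rightarrow> complex"
  where "coordinate i = (SOME f. functional f \<and> (\<forall>a\<in>\<Gamma>. f a = 0) \<and>
    (\<forall>j\<in>I. \<forall>a\<in>\<Gamma>. f (y j \<star> a) = (if j = i then 1 else 0)) \<and>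
    (\<forall>a\<in>\<Gamma>. \<forall>x. f (a \<star> x) = \<chi> i a * f x))"

lemma assumes "i \<in> I"
  shows functional_coordinate: "functional (coordinate i)"
    and coordinate_Gamma: "a \<in> \<Gamma> \<Longrightarrow> coordinate i a = 0"
    and coordinate_y: "j \<in> I \<Longrightarrow> a \<in> \<Gamma> \<Longrightarrow> coordinate i (y j \<star> a) = (if j = i then 1 else 0)"
    and coordinate_mul: "a \<in> \<Gamma> \<Longrightarrow> coordinate i (a \<star> x) = \<chi> i a * coordinate i x"
  using someI_ex[OF ex_coordinate_functional[OF assms]] unfolding coordinate_def[symmetric]
  by simp_all

text \<open>The operator (f \<otimes> id) \<Delta> with f = \<open>coordinate i\<close>: a braided
  derivation that strips a letter \<open>y i\<close>, up to shorter words.\<close>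

definition deriv :: "'i \<Rightarrow> 'v \<Rightarrow> 'v" (\<open>\<partial>\<close>)
  where "\<partial> i = L (coordinate i)"

definition word :: "'i list \<Rightarrow> 'v"
  where "word js = foldr (\<lambda>j x. y j \<star> x) js unit"

text \<open>With a strict bound and an integer index, \<open>W k\<close> is zero for all k \<le> 0,
  so derivatives of short words need no case distinction.\<close>

definition W :: "int \<Rightarrow> 'v set"
  where "W k = span {word js | js. int (length js) < k \<and> set js \<subseteq> I}"

lemma word_simps [simp]: "word [] = unit" "word (j # js) = y j \<star> word js"
  by (simp_all add: word_def)

lemma W_subspace: "subspace (W k)"
  by (simp add: W_def)

lemmas W_add = subspace_add[OF W_subspace]
  and W_diff = subspace_diff[OF W_subspace]
  and W_scale = subspace_scale[OF W_subspace]
  and W_0_mem [simp] = subspace_0[OF W_subspace]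

lemma W_nonpos: "k \<le> 0 \<Longrightarrow> W k = {0}"
  by (simp add: W_def)

lemma W_mono: "k \<le> l \<Longrightarrow> W k \<subseteq> W l"
  unfolding W_def by (rule span_mono) auto

lemma W_monoD: "x \<in> W k \<Longrightarrow> k \<le> l \<Longrightarrow> x \<in> W l"
  using W_mono by blast

lemma word_W: "set js \<subseteq> I \<Longrightarrow> int (length js) < k \<Longrightarrow> word js \<in> W k"
  unfolding W_def by (rule span_base) auto

lemma unit_W: "unit \<in> W 1"
  using word_W[of "[]"] by simp

lemma W_induct [consumes 1, case_names zero step]:
  assumes "x \<in> W k" "P 0"
    and "\<And>c js z. set js \<subseteq> I \<Longrightarrow> int (length js) < k \<Longrightarrow> z \<in> W k \<Longrightarrow> P z \<Longrightarrow> P (c *s word js + z)"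
  shows "P x"
proof -
  have "x \<in> W k \<and> P x"
    using assms(1)[unfolded W_def]
  proof (induction x rule: span_induct_alt)
    case (step c x z)
    then obtain js where js: "x = word js" "int (length js) < k" "set js \<subseteq> I" by blast
    then have "c *s x \<in> W k" by (intro W_scale) (simp add: word_W)
    with step js show ?case by (simp add: W_add assms(3))
  qed (simp add: assms(2))
  then show ?thesis by simp
qed

lemma W_V: "W k \<subseteq> V"
proof -
  have "word js \<in> V" for js by (cases js) simp_all
  then show ?thesis unfolding W_def by (intro span_minimal V_subspace) auto
qed

lemma y_W: "x \<in> W k \<Longrightarrow> j \<in> I \<Longrightarrow> y j \<star> x \<in> W (k + 1)"
proof (induction x rule: W_induct)
  case (step c js z)
  then have "word (j # js) \<in> W (k + 1)" by (intro word_W) auto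
  with step show ?case by (simp add: mul_simps W_add W_scale)
qed simp

text \<open>The right factors in \<Delta>(y_j) = y_j \<otimes> 1 + d_j \<otimes> y_j are the unit
  and the letter itself, so the coproduct of a word has only words of at most the same length as
  right factors.\<close>

lemma L_W_word:
  assumes "functional f" "set js \<subseteq> I"
  shows "L f (word js) \<in> W (int (length js) + 1)"
  using assms
proof (induction js arbitrary: f)
  case Nil
  then show ?case by (simp add: L_grp unit_grp W_scale unit_W)
next
  case (Cons j js)
  then have j: "j \<in> I" and js: "set js \<subseteq> I" by auto
  have "L f (word (j # js))
      = unit \<star> L (\<lambda>v. f (y j \<star> v)) (word js) + y j \<star> L (\<lambda>v. f (d j \<star> v)) (word js)"
    using L_skew_mul[OF Cons.prems(1) y_skew[OF j]] Gamma_V[OF d_Gamma[OF j]] by simp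
  moreover have "L (\<lambda>v. f (y j \<star> v)) (word js) \<in> W (int (length js) + 1)"
    "L (\<lambda>v. f (d j \<star> v)) (word js) \<in> W (int (length js) + 1)"
    using Cons.prems(1) js by (auto intro!: Cons.IH functional_left_mul)
  ultimately show ?case
    using y_W[OF _ j, of _ "int (length js) + 1"]
      W_monoD[of _ "int (length js) + 1" "int (length js) + 1 + 1"]
    by (simp add: W_add algebra_simps functional_left_mul Cons.prems(1))
qed

text \<open>Only the term that takes the letter as right factor every time has a word of full length
  on the right. Its left factor is the product of the degrees, an element of \<Gamma>, where
  \<open>f\<close> has the value \<open>c\<close>.\<close>

lemma L_const_word:
  assumes "functional f" "set js \<subseteq> I" "\<And>a. a \<in> \<Gamma> \<Longrightarrow> f a = c"
  shows "L f (word js) - c *s word js \<in> W (int (length js))"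
  using assms
proof (induction js arbitrary: f)
  case Nil
  then show ?case by (simp add: L_grp unit_grp unit_Gamma)
next
  case (Cons j js)
  then have j: "j \<in> I" and js: "set js \<subseteq> I" by auto
  have "L f (word (j # js)) - c *s word (j # js)
      = L (\<lambda>v. f (y j \<star> v)) (word js) + y j \<star> (L (\<lambda>v. f (d j \<star> v)) (word js) - c *s word js)"
    using L_skew_mul[OF Cons.prems(1) y_skew[OF j]] Gamma_V[OF d_Gamma[OF j]] Cons.prems(1)
    by (simp add: mul_simps functional_left_mul)
  moreover have "L (\<lambda>v. f (y j \<star> v)) (word js) \<in> W (int (length js) + 1)"
    by (rule L_W_word[OF functional_left_mul[OF Cons.prems(1)] js])
  moreover have "L (\<lambda>v. f (d j \<star> v)) (word js) - c *s word js \<in> W (int (length js))"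
    using Cons.prems(3) mul_Gamma[OF d_Gamma[OF j]]
    by (intro Cons.IH functional_left_mul Cons.prems(1) js) simp
  ultimately show ?case
    using W_add[OF _ y_W[OF _ j, of _ "int (length js)"]] by (simp add: add.commute)
qed

lemma L_const_W:
  assumes "functional f" "x \<in> W (k + 1)" "\<And>a. a \<in> \<Gamma> \<Longrightarrow> f a = c"
  shows "L f x - c *s x \<in> W k"
  using assms(2)
proof (induction x rule: W_induct)
  case (step e js z)
  have "L f (word js) - c *s word js \<in> W k"
    using L_const_word[OF assms(1) step(1) assms(3)] W_mono[of "int (length js)" k] step(2) by auto
  moreover have "L f (e *s word js + z) - c *s (e *s word js + z)
      = e *s (L f (word js) - c *s word js) + (L f z - c *s z)"
    by (simp add: L_add L_scale assms(1) algebra_simps)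
  ultimately show ?case using step by (simp add: W_add W_scale)
qed (simp add: L_zero assms(1))

lemma deriv_W:
  assumes "i \<in> I" "x \<in> W (k + 1)"
  shows "\<partial> i x \<in> W k"
  using L_const_W[OF functional_coordinate[OF assms(1)] assms(2), of 0] coordinate_Gamma[OF assms(1)]
  by (simp add: deriv_def)

lemma deriv_add: "i \<in> I \<Longrightarrow> \<partial> i (x + z) = \<partial> i x + \<partial> i z"
  and deriv_diff: "i \<in> I \<Longrightarrow> \<partial> i (x - z) = \<partial> i x - \<partial> i z"
  and deriv_scale: "i \<in> I \<Longrightarrow> \<partial> i (c *s x) = c *s \<partial> i x"
  and deriv_zero: "i \<in> I \<Longrightarrow> \<partial> i 0 = 0"
  by (simp_all add: deriv_def L_add L_diff L_scale L_zero functional_coordinate)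

lemma deriv_neg: "i \<in> I \<Longrightarrow> \<partial> i (- x) = - \<partial> i x"
  using deriv_diff[of i 0 x] by (simp add: deriv_zero)

lemmas deriv_linear = deriv_add deriv_diff deriv_scale deriv_zero deriv_neg

text \<open>The term y_j \<otimes> 1 contributes a functional that is constant on \<Gamma>, hence a
  scalar up to shorter words; the term d_j \<otimes> y_j contributes the exact twist
  \<open>\<chi> i (d j)\<close>. This is the braided Leibniz rule, with an error two letters shorter
  than \<open>y j \<star> x\<close>.\<close>

lemma deriv_y:
  assumes "i \<in> I" "j \<in> I" "x \<in> W (k + 1)"
  shows "\<partial> i (y j \<star> x) - ((if j = i then x else 0) + \<chi> i (d j) *s (y j \<star> \<partial> i x)) \<in> W k"
proof -
  let ?f = "\<lambda>v. coordinate i (y j \<star> v)" and ?g = "\<lambda>v. coordinate i (d j \<star> v)"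
  have f: "functional (coordinate i)" by (rule functional_coordinate[OF assms(1)])
  \<comment> \<open>The sum over \<open>{()}\<close> is a scalar multiple in disguise, so that
    \<open>L_functional_sum\<close> also yields homogeneity in the functional.\<close>
  have g: "functional (\<lambda>v. \<Sum>a\<in>{()}. \<chi> i (d j) * coordinate i v)"
    by (rule functional_combination) (rule f)
  have "L ?g x = L (\<lambda>v. \<Sum>a\<in>{()}. \<chi> i (d j) * coordinate i v) x"
    using f d_Gamma[OF assms(2)]
    by (intro L_cong functional_left_mul g) (simp_all add: coordinate_mul assms(1))
  also have "\<dots> = \<chi> i (d j) *s L (coordinate i) x"
    by (subst L_functional_sum) (simp_all add: f)
  finally have "\<partial> i (y j \<star> x) = L ?f x + \<chi> i (d j) *s (y j \<star> \<partial> i x)"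
    using L_skew_mul[OF f y_skew[OF assms(2)]] Gamma_V[OF d_Gamma[OF assms(2)]]
    by (simp add: deriv_def mul_simps functional_left_mul f)
  moreover have "L ?f x - (if j = i then 1 else 0) *s x \<in> W k"
    using L_const_W[OF functional_left_mul[OF f] assms(3), of "y j" "if j = i then 1 else 0"]
      coordinate_y[OF assms(1,2)] by simp
  moreover have "(if j = i then 1 else 0) *s x = (if j = i then x else 0)" by simp
  ultimately show ?thesis by (simp add: algebra_simps)
qed

text \<open>An operator \<open>D\<close> lowering the word length by \<open>m\<close> and acting on \<open>Z\<^sup>n 1\<close> like \<open>c d/dZ\<close> up to
  shorter words keeps \<open>Z\<^sup>n 1\<close> away from shorter words, so the filtration by \<open>W\<close> never stabilises.\<close>
lemma no_divided_powers:
  fixes m :: nat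
  assumes "m > 0" "c \<noteq> 0"
    and Z_add: "\<And>x z. Z (x + z) = Z x + Z z" and Z_scale: "\<And>e x. Z (e *s x) = e *s Z x"
    and Z_W: "\<And>k x. x \<in> W k \<Longrightarrow> Z x \<in> W (k + int m)"
    and D_W: "\<And>k x. x \<in> W (k + int m) \<Longrightarrow> D x \<in> W k"
    and D_Z: "\<And>n. D (Z ((Z ^^ n) unit)) - (c *s (Z ^^ n) unit + Z (D ((Z ^^ n) unit))) \<in> W (int m * n)"
  shows False
proof -
  define z where "z n = (Z ^^ n) unit" for n
  have z_Suc: "z (Suc n) = Z (z n)" and z_0: "z 0 = unit" for n by (simp_all add: z_def)
  have z_W: "z n \<in> W (int m * n + 1)" for n
  proof (induction n)
    case 0
    show ?case by (simp add: z_0 unit_W)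
  next
    case (Suc n)
    from Z_W[OF this] show ?case by (simp add: z_Suc algebra_simps)
  qed
  have Z_diff: "Z (x - w) = Z x - Z w" for x w
    using Z_add[of "x - w" w] by simp
  \<comment> \<open>Iterating \<open>D_Z\<close>, the operator \<open>D\<close> differentiates the
    powers up to the factor \<open>c\<close>; the error consists of words of length below
    \<open>m * n\<close>.\<close>
  have D_z: "D (z (Suc n)) - (of_nat (Suc n) * c) *s z n \<in> W (int m * n)" for n
  proof (induction n)
    case 0
    have "D unit \<in> W (1 - int m)" by (rule D_W) (simp add: unit_W)
    then have "D unit = 0" using assms(1) by (simp add: W_nonpos)
    moreover have "Z 0 = 0" using Z_scale[of 0 0] by simp
    ultimately show ?case using D_Z[of 0] by (simp add: z_Suc z_0)
  next
    case (Suc n)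
    let ?E = "D (z (Suc n)) - (of_nat (Suc n) * c) *s z n"
    have "(of_nat (Suc (Suc n)) * c) *s z (Suc n) = c *s z (Suc n) + Z ((of_nat (Suc n) * c) *s z n)"
      by (simp only: of_nat_Suc[of "Suc n"] distrib_right mult_1_left scale_left_distrib Z_scale
          z_Suc[symmetric])
    then have "D (z (Suc (Suc n))) - (of_nat (Suc (Suc n)) * c) *s z (Suc n)
        = (D (Z (z (Suc n))) - (c *s z (Suc n) + Z (D (z (Suc n))))) + Z ?E"
      by (simp add: z_Suc[of "Suc n"] Z_diff del: of_nat_Suc)
    moreover have "Z ?E \<in> W (int m * Suc n)"
      using Z_W[OF Suc.IH] by (simp add: algebra_simps)
    ultimately show ?case
      using W_add[OF D_Z[of "Suc n", folded z_def]] by metis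
  qed
  have z_notin: "z n \<notin> W (int m * n)" for n
  proof (induction n)
    case 0
    show ?case using grp_nonzero[OF unit_grp] by (simp add: W_nonpos z_0)
  next
    case (Suc n)
    show ?case
    proof
      assume "z (Suc n) \<in> W (int m * Suc n)"
      then have "D (z (Suc n)) \<in> W (int m * n)" by (intro D_W) (simp add: algebra_simps)
      from W_diff[OF this D_z] have "(of_nat (Suc n) * c) *s z n \<in> W (int m * n)" by simp
      \<comment> \<open>Characteristic zero enters here: the coefficient must be invertible for
        \<open>z n\<close> to be recovered from \<open>z (Suc n)\<close>.\<close>
      moreover have "of_nat (Suc n) * c \<noteq> 0"
        using assms(2) of_nat_neq_0[of n, where 'a = complex] by simp
      ultimately have "z n \<in> W (int m * n)"
        using W_scale[of "(of_nat (Suc n) * c) *s z n" _ "inverse (of_nat (Suc n) * c)"]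
        by (simp del: of_nat_Suc inverse_mult_distrib)
      then show False using Suc by simp
    qed
  qed
  \<comment> \<open>Each \<open>z n\<close> is new in the filtration, so the dimensions exceed every
    bound, whereas \<open>card B\<close> bounds them all.\<close>
  have "n \<le> dim (W (int m * int n))" for n
  proof (induction n)
    case (Suc n)
    have "W (int m * n) \<subset> W (int m * Suc n)"
    proof
      show "W (int m * n) \<subseteq> W (int m * Suc n)" by (rule W_mono) (simp add: algebra_simps)
      have "z n \<in> W (int m * Suc n)"
        using assms(1) by (intro W_monoD[OF z_W]) (simp add: algebra_simps)
      then show "W (int m * n) \<noteq> W (int m * Suc n)" using z_notin by metis
    qed
    then have "dim (W (int m * n)) < dim (W (int m * Suc n))"
      using W_V V_span finite_B by (intro dim_strict_mono W_subspace) auto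
    with Suc show ?case by simp
  qed simp
  moreover have "dim (W k) \<le> card B" for k
    using W_V V_span finite_B by (intro dim_le_card) auto
  ultimately show False
    by (metis Suc_n_not_le_n le_trans)
qed

text \<open>Trivial self-braiding removes the twist from the Leibniz rule, so left multiplication by
  \<open>y i\<close> and \<open>\<partial> i\<close> form a pair as in
  \<open>no_divided_powers\<close>, with word length 1 and scalar 1.\<close>

lemma unit_braiding_impossible:
  assumes i: "i \<in> I" and q: "\<chi> i (d i) = 1"
  shows False
proof (rule no_divided_powers[of 1 1 "\<lambda>x. y i \<star> x" "\<partial> i"])
  fix n :: nat
  let ?x = "((\<lambda>x. y i \<star> x) ^^ n) unit"
  have "?x \<in> W (int n + 1)"
  proof (induction n)
    case (Suc n)
    from y_W[OF this i] show ?case by (simp add: algebra_simps)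
  qed (simp add: unit_W)
  from deriv_y[OF i i this] show "\<partial> i (y i \<star> ?x) - (1 *s ?x + y i \<star> \<partial> i ?x) \<in> W (int 1 * n)"
    by (simp add: q)
qed (use i in \<open>auto simp: mul_simps y_W intro: deriv_W\<close>)

lemma yy_W: "x \<in> W k \<Longrightarrow> a \<in> I \<Longrightarrow> b \<in> I \<Longrightarrow> y a \<star> (y b \<star> x) \<in> W (k + 2)"
  using y_W[OF y_W, of x k b a] by (simp add: add.assoc)

text \<open>The Leibniz rule for each of the two letters. The inner error gains one letter by the
  outer multiplication and so falls into the same filtration step as the outer error.\<close>

lemma deriv_yy:
  assumes "i \<in> I" "a \<in> I" "b \<in> I" "x \<in> W (k + 1)"
  shows "\<partial> i (y a \<star> (y b \<star> x)) - ((if a = i then y b \<star> x else 0)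
      + \<chi> i (d a) *s (y a \<star> ((if b = i then x else 0) + \<chi> i (d b) *s (y b \<star> \<partial> i x)))) \<in> W (k + 1)"
proof -
  let ?r = "(if b = i then x else 0) + \<chi> i (d b) *s (y b \<star> \<partial> i x)"
  have "\<partial> i (y a \<star> (y b \<star> x)) - ((if a = i then y b \<star> x else 0) + \<chi> i (d a) *s (y a \<star> \<partial> i (y b \<star> x)))
      \<in> W (k + 1)"
    using deriv_y[OF assms(1,2) y_W[OF assms(4,3)]] by simp
  moreover have "\<chi> i (d a) *s (y a \<star> (\<partial> i (y b \<star> x) - ?r)) \<in> W (k + 1)"
    by (intro W_scale y_W deriv_y assms)
  ultimately have "\<partial> i (y a \<star> (y b \<star> x)) - ((if a = i then y b \<star> x else 0) + \<chi> i (d a) *s (y a \<star> \<partial> i (y b \<star> x)))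
      + \<chi> i (d a) *s (y a \<star> (\<partial> i (y b \<star> x) - ?r)) \<in> W (k + 1)"
    by (rule W_add)
  then show ?thesis by (simp add: mul_simps algebra_simps)
qed

lemma deriv_yyy:
  assumes "i \<in> I" "a \<in> I" "b \<in> I" "c \<in> I" "x \<in> W (k + 1)"
  shows "\<partial> i (y a \<star> (y b \<star> (y c \<star> x))) - ((if a = i then y b \<star> (y c \<star> x) else 0)
      + \<chi> i (d a) *s (y a \<star> ((if b = i then y c \<star> x else 0)
      + \<chi> i (d b) *s (y b \<star> ((if c = i then x else 0) + \<chi> i (d c) *s (y c \<star> \<partial> i x)))))) \<in> W (k + 2)"
proof -
  let ?r = "(if b = i then y c \<star> x else 0)
      + \<chi> i (d b) *s (y b \<star> ((if c = i then x else 0) + \<chi> i (d c) *s (y c \<star> \<partial> i x)))"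
  have "y b \<star> (y c \<star> x) \<in> W (k + 2 + 1)"
    using y_W[OF y_W[OF assms(5,4)] assms(3)] by (simp add: algebra_simps)
  from deriv_y[OF assms(1,2) this]
  have "\<partial> i (y a \<star> (y b \<star> (y c \<star> x))) - ((if a = i then y b \<star> (y c \<star> x) else 0)
      + \<chi> i (d a) *s (y a \<star> \<partial> i (y b \<star> (y c \<star> x)))) \<in> W (k + 2)" .
  moreover have "\<chi> i (d a) *s (y a \<star> (\<partial> i (y b \<star> (y c \<star> x)) - ?r)) \<in> W (k + 2)"
    using W_scale[OF y_W[OF deriv_yy[OF assms(1,3,4,5)] assms(2)], of "\<chi> i (d a)"]
    by (simp add: algebra_simps)
  ultimately have "\<partial> i (y a \<star> (y b \<star> (y c \<star> x))) - ((if a = i then y b \<star> (y c \<star> x) else 0)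
      + \<chi> i (d a) *s (y a \<star> \<partial> i (y b \<star> (y c \<star> x))))
      + \<chi> i (d a) *s (y a \<star> (\<partial> i (y b \<star> (y c \<star> x)) - ?r)) \<in> W (k + 2)"
    by (rule W_add)
  then show ?thesis by (simp add: mul_simps algebra_simps)
qed

text \<open>Affine type \<open>A\<^sub>1\<close>: the imaginary root vector \<open>Z = [y\<^sub>i, y\<^sub>j]\<close> has trivial self-braiding and
  is killed by \<open>\<partial>\<^sub>i\<close>, while \<open>\<partial>\<^sub>i \<partial>\<^sub>j Z\<close> is a non-zero scalar.\<close>
lemma affine_A1_braiding_impossible:
  assumes i: "i \<in> I" and j: "j \<in> I" and ij: "i \<noteq> j" and q: "q \<noteq> 0" "q\<^sup>2 \<noteq> 1"
    and "\<chi> i (d i) = q" "\<chi> j (d j) = q" "\<chi> i (d j) = inverse q" "\<chi> j (d i) = inverse q"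
  shows False
proof -
  \<comment> \<open>The coefficient \<open>q\<close> is the inverse of
    \<open>\<chi> i (d j)\<close>: it makes the two terms \<open>y j \<star> x\<close> in
    \<open>\<partial> i (Z x)\<close> cancel. In \<open>\<partial> j (Z x)\<close> the terms
    \<open>y i \<star> x\<close> then survive with coefficient \<open>inverse q - q\<close>.\<close>
  define Z where "Z x = y i \<star> (y j \<star> x) - q *s (y j \<star> (y i \<star> x))" for x
  have Z_add: "Z (x + w) = Z x + Z w" and Z_scale: "Z (e *s x) = e *s Z x" for x w e
    by (simp_all add: Z_def mul_simps algebra_simps)
  have Z_W: "Z x \<in> W (k + 2)" if "x \<in> W k" for x k
    unfolding Z_def using that i j by (intro W_diff W_scale yy_W)
  have Di: "\<partial> i (Z x) - Z (\<partial> i x) \<in> W (k + 1)" if "x \<in> W (k + 1)" for x k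
  proof -
    note W_diff[OF deriv_yy[OF i i j that] W_scale[OF deriv_yy[OF i j i that], of q]]
    then show ?thesis using q ij by (simp add: Z_def assms(6-9) deriv_linear i mul_simps algebra_simps)
  qed
  have Dj: "\<partial> j (Z x) - ((inverse q - q) *s (y i \<star> x) + Z (\<partial> j x)) \<in> W (k + 1)" if "x \<in> W (k + 1)" for x k
  proof -
    note W_diff[OF deriv_yy[OF j i j that] W_scale[OF deriv_yy[OF j j i that], of q]]
    then show ?thesis using q ij by (simp add: Z_def assms(6-9) deriv_linear j mul_simps algebra_simps)
  qed
  let ?z = "\<lambda>n. (Z ^^ n) unit"
  have z_W: "?z n \<in> W (2 * int n + 1)" for n
  proof (induction n)
    case (Suc n)
    from Z_W[OF this] show ?case by (simp add: algebra_simps)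
  qed (simp add: unit_W)
  \<comment> \<open>One step below what \<open>deriv_W\<close> gives: \<open>\<partial> i\<close>
    passes through every \<open>Z\<close> until it reaches \<open>unit\<close>, which it kills. This
    makes the twisted term \<open>y i \<star> \<partial> i (?z n)\<close> negligible in the final
    computation.\<close>
  have z_i: "\<partial> i (?z n) \<in> W (2 * int n - 1)" for n
  proof (induction n)
    case 0
    show ?case using deriv_W[OF i, of unit 0] unit_W by (simp add: W_nonpos)
  next
    case (Suc n)
    from W_add[OF Di[OF z_W[of n]], of "Z (\<partial> i (?z n))"] Z_W[OF Suc]
    show ?case by (simp add: algebra_simps)
  qed
  show False
  proof (rule no_divided_powers[of 2 "inverse q - q" Z "\<lambda>x. \<partial> i (\<partial> j x)"])
    \<comment> \<open>At q = -1 this scalar would vanish, so a degree that acts by -1 requires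
      another root vector.\<close>
    show "inverse q - q \<noteq> 0" using q by (simp add: field_simps power2_eq_square)
    show "\<partial> i (\<partial> j x) \<in> W k" if "x \<in> W (k + int 2)" for x k
      using that by (intro deriv_W i j) (simp add: add.commute)
    fix n :: nat
    let ?x = "?z n" and ?c = "inverse q - q"
    let ?e = "\<partial> j (Z ?x) - (?c *s (y i \<star> ?x) + Z (\<partial> j ?x))"
    have "\<partial> i ?e \<in> W (2 * int n)"
      by (rule deriv_W[OF i Dj[OF z_W]])
    moreover have "?c *s (\<partial> i (y i \<star> ?x) - (?x + q *s (y i \<star> \<partial> i ?x))) \<in> W (2 * int n)"
      using W_scale[OF deriv_y[OF i i z_W]] by (simp add: assms(6))
    moreover have "(?c * q) *s (y i \<star> \<partial> i ?x) \<in> W (2 * int n)"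
      using W_scale[OF y_W[OF z_i i]] by simp
    moreover have "\<partial> i (Z (\<partial> j ?x)) - Z (\<partial> i (\<partial> j ?x)) \<in> W (2 * int n)"
      using Di[of "\<partial> j ?x" "2 * int n - 1"] deriv_W[OF j z_W] by simp
    ultimately have "\<partial> i ?e + ?c *s (\<partial> i (y i \<star> ?x) - (?x + q *s (y i \<star> \<partial> i ?x)))
        + (?c * q) *s (y i \<star> \<partial> i ?x) + (\<partial> i (Z (\<partial> j ?x)) - Z (\<partial> i (\<partial> j ?x))) \<in> W (2 * int n)"
      by (intro W_add)
    moreover have "\<partial> i ?e + ?c *s (\<partial> i (y i \<star> ?x) - (?x + q *s (y i \<star> \<partial> i ?x)))
        + (?c * q) *s (y i \<star> \<partial> i ?x) + (\<partial> i (Z (\<partial> j ?x)) - Z (\<partial> i (\<partial> j ?x)))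
      = \<partial> i (\<partial> j (Z ?x)) - (?c *s ?x + Z (\<partial> i (\<partial> j ?x)))"
      by (simp only: deriv_linear[OF i]) (simp add: algebra_simps)
    ultimately show "\<partial> i (\<partial> j (Z ?x)) - (?c *s ?x + Z (\<partial> i (\<partial> j ?x))) \<in> W (int 2 * n)"
      by simp
  qed (simp_all add: Z_add Z_scale Z_W)
qed

text \<open>Affine type \<open>A\<^sub>2\<close> at \<open>-1\<close>, again through an imaginary root vector.\<close>
lemma affine_A2_braiding_impossible:
  assumes i: "i \<in> I" and j: "j \<in> I" and l: "l \<in> I" and ne: "i \<noteq> j" "i \<noteq> l" "j \<noteq> l"
    and "\<chi> i (d i) = -1" "\<chi> j (d j) = -1" "\<chi> l (d l) = -1"
    and "\<chi> i (d j) = 1" "\<chi> i (d l) = -1" "\<chi> j (d l) = 1" "\<chi> j (d i) = -1"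
    and "\<chi> l (d i) = 1" "\<chi> l (d j) = -1"
  shows False
proof -
  note chi = assms(7-15)
  \<comment> \<open>The anticommutator of \<open>y l\<close> with the commutator of
    \<open>y i\<close> and \<open>y j\<close>. The signs are such that both
    \<open>\<partial> i\<close> and \<open>\<partial> l\<close> pass through \<open>Z\<close>, so
    that only \<open>\<partial> j\<close> detects it.\<close>
  define Z where "Z x = y i \<star> (y j \<star> (y l \<star> x)) - y j \<star> (y i \<star> (y l \<star> x))
    + (y l \<star> (y i \<star> (y j \<star> x)) - y l \<star> (y j \<star> (y i \<star> x)))" for x
  \<comment> \<open>This is what \<open>\<partial> j\<close> leaves of \<open>Z\<close>. Under
    \<open>\<partial> l\<close> each of its two terms yields \<open>y i \<star> x\<close>, which
    explains the scalar -2 * 2 = -4 at the end.\<close>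
  define U where "U x = (-2) *s (y i \<star> (y l \<star> x) + y l \<star> (y i \<star> x))" for x
  have Z_add: "Z (x + w) = Z x + Z w" and Z_scale: "Z (e *s x) = e *s Z x" for x w e
    by (simp_all add: Z_def mul_simps algebra_simps)
  have Z_W: "Z x \<in> W (k + 3)" if "x \<in> W k" for x k
  proof -
    have "y a \<star> (y b \<star> (y c \<star> x)) \<in> W (k + 3)" if "a \<in> I" "b \<in> I" "c \<in> I" for a b c
      using yy_W[OF y_W[OF \<open>x \<in> W k\<close> that(3)] that(1,2)] by (simp add: add.assoc)
    then show ?thesis
      unfolding Z_def using i j l by (intro W_diff W_add)
  qed
  \<comment> \<open>For each of the three derivations the product of its twists along
    \<open>i\<close>, \<open>j\<close> and \<open>l\<close> is 1, so no sign appears when it moves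
    past \<open>Z\<close>.\<close>
  have Di: "\<partial> i (Z x) - Z (\<partial> i x) \<in> W (k + 2)" if "x \<in> W (k + 1)" for x k
  proof -
    note W_add[OF W_diff[OF deriv_yyy[OF i i j l that] deriv_yyy[OF i j i l that]]
        W_diff[OF deriv_yyy[OF i l i j that] deriv_yyy[OF i l j i that]]]
    then show ?thesis
      using ne by (simp add: Z_def chi deriv_linear i mul_simps algebra_simps)
  qed
  have Dl: "\<partial> l (Z x) - Z (\<partial> l x) \<in> W (k + 2)" if "x \<in> W (k + 1)" for x k
  proof -
    note W_add[OF W_diff[OF deriv_yyy[OF l i j l that] deriv_yyy[OF l j i l that]]
        W_diff[OF deriv_yyy[OF l l i j that] deriv_yyy[OF l l j i that]]]
    then show ?thesis
      using ne by (simp add: Z_def chi deriv_linear l mul_simps algebra_simps)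
  qed
  have two: "2 *s x = x + x" for x
    using scale_left_distrib[of 1 1 x] by simp
  have Dj: "\<partial> j (Z x) - (U x + Z (\<partial> j x)) \<in> W (k + 2)" if "x \<in> W (k + 1)" for x k
  proof -
    note W_add[OF W_diff[OF deriv_yyy[OF j i j l that] deriv_yyy[OF j j i l that]]
        W_diff[OF deriv_yyy[OF j l i j that] deriv_yyy[OF j l j i that]]]
    then show ?thesis
      using ne by (simp add: Z_def U_def chi deriv_linear j mul_simps algebra_simps two)
  qed
  have DlU: "\<partial> l (U x) - ((-4) *s (y i \<star> x) - U (\<partial> l x)) \<in> W (k + 1)" if "x \<in> W (k + 1)" for x k
  proof -
    have "(-2) *s (\<partial> l (y i \<star> (y l \<star> x)) - (y i \<star> x - y i \<star> (y l \<star> \<partial> l x))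
        + (\<partial> l (y l \<star> (y i \<star> x)) - (y i \<star> x - y l \<star> (y i \<star> \<partial> l x)))) \<in> W (k + 1)"
      using W_scale[OF W_add[OF deriv_yy[OF l i l that] deriv_yy[OF l l i that]], of "-2"] ne
      by (simp add: chi mul_simps algebra_simps)
    moreover have "4 *s w = 2 *s (w + w)" for w
      by (simp add: scale_right_distrib[symmetric] two[symmetric])
    ultimately show ?thesis
      by (simp add: U_def deriv_linear l algebra_simps)
  qed
  let ?z = "\<lambda>n. (Z ^^ n) unit"
  have z_W: "?z n \<in> W (3 * int n + 1)" for n
  proof (induction n)
    case (Suc n)
    from Z_W[OF this] show ?case by (simp add: algebra_simps)
  qed (simp add: unit_W)
  have z_kill: "\<partial> h (?z n) \<in> W (3 * int n - 1)"
    if h: "h \<in> I" and Dh: "\<And>x k. x \<in> W (k + 1) \<Longrightarrow> \<partial> h (Z x) - Z (\<partial> h x) \<in> W (k + 2)" for h n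
  proof (induction n)
    case 0
    show ?case using deriv_W[OF h, of unit 0] unit_W by (simp add: W_nonpos)
  next
    case (Suc n)
    from W_add[OF Dh[OF z_W[of n]], of "Z (\<partial> h (?z n))"] Z_W[OF Suc]
    show ?case by (simp add: algebra_simps)
  qed
  have U_W: "U x \<in> W (k + 2)" if "x \<in> W k" for x k
    unfolding U_def using that i l by (intro W_scale W_add yy_W)
  show False
  proof (rule no_divided_powers[of 3 "-4" Z "\<lambda>x. \<partial> i (\<partial> l (\<partial> j x))"])
    show "\<partial> i (\<partial> l (\<partial> j x)) \<in> W k" if "x \<in> W (k + int 3)" for x k
      using that by (intro deriv_W i j l) (simp add: add.commute)
    fix n :: nat
    let ?x = "?z n" and ?k = "3 * int n"
    note x = z_W[of n]
    have jx: "\<partial> j ?x \<in> W ?k" by (rule deriv_W[OF j x])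
    have e1: "\<partial> l (\<partial> j (Z ?x) - (U ?x + Z (\<partial> j ?x))) \<in> W (?k + 1)"
      using deriv_W[OF l, of _ "?k + 1"] Dj[OF x] by (simp add: add.assoc)
    have e2: "\<partial> l (U ?x) - ((-4) *s (y i \<star> ?x) - U (\<partial> l ?x)) \<in> W (?k + 1)"
      by (rule DlU[OF x])
    have e3: "U (\<partial> l ?x) \<in> W (?k + 1)"
      using U_W[OF z_kill[OF l Dl, of n]] by (simp add: add.commute)
    have e4: "\<partial> l (Z (\<partial> j ?x)) - Z (\<partial> l (\<partial> j ?x)) \<in> W (?k + 1)"
      using Dl[of "\<partial> j ?x" "?k - 1"] jx by (simp add: add.commute)
    from W_add[OF W_add[OF e1 W_diff[OF e2 e3]] e4]
    have "\<partial> l (\<partial> j (Z ?x)) - ((-4) *s (y i \<star> ?x) + Z (\<partial> l (\<partial> j ?x))) \<in> W (?k + 1)"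
      by (simp add: deriv_linear l diff_diff_eq2)
    then have "\<partial> i (\<partial> l (\<partial> j (Z ?x)) - ((-4) *s (y i \<star> ?x) + Z (\<partial> l (\<partial> j ?x)))) \<in> W ?k"
      by (rule deriv_W[OF i])
    moreover have "(-4) *s (\<partial> i (y i \<star> ?x) - (?x - y i \<star> \<partial> i ?x)) \<in> W ?k"
      using W_scale[OF deriv_y[OF i i x], of "-4"] by (simp add: chi)
    moreover have "4 *s (y i \<star> \<partial> i ?x) \<in> W ?k"
      using W_scale[OF y_W[OF z_kill[OF i Di] i], of 4] by simp
    moreover have "\<partial> i (Z (\<partial> l (\<partial> j ?x))) - Z (\<partial> i (\<partial> l (\<partial> j ?x))) \<in> W ?k"
      using Di[of "\<partial> l (\<partial> j ?x)" "?k - 2"] deriv_W[OF l, of "\<partial> j ?x" "?k - 1"] jx by simp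
    ultimately have "\<partial> i (\<partial> l (\<partial> j (Z ?x)) - ((-4) *s (y i \<star> ?x) + Z (\<partial> l (\<partial> j ?x))))
        + (-4) *s (\<partial> i (y i \<star> ?x) - (?x - y i \<star> \<partial> i ?x)) + 4 *s (y i \<star> \<partial> i ?x)
        + (\<partial> i (Z (\<partial> l (\<partial> j ?x))) - Z (\<partial> i (\<partial> l (\<partial> j ?x)))) \<in> W ?k"
      by (intro W_add)
    moreover have "\<partial> i (\<partial> l (\<partial> j (Z ?x)) - ((-4) *s (y i \<star> ?x) + Z (\<partial> l (\<partial> j ?x))))
        + (-4) *s (\<partial> i (y i \<star> ?x) - (?x - y i \<star> \<partial> i ?x)) + 4 *s (y i \<star> \<partial> i ?x)
        + (\<partial> i (Z (\<partial> l (\<partial> j ?x))) - Z (\<partial> i (\<partial> l (\<partial> j ?x))))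
      = \<partial> i (\<partial> l (\<partial> j (Z ?x))) - ((-4) *s ?x + Z (\<partial> i (\<partial> l (\<partial> j ?x))))"
      by (simp only: deriv_linear[OF i]) (simp add: algebra_simps)
    ultimately show "\<partial> i (\<partial> l (\<partial> j (Z ?x))) - ((-4) *s ?x + Z (\<partial> i (\<partial> l (\<partial> j ?x)))) \<in> W (int 3 * n)"
      by (simp only: of_nat_numeral)
  qed (simp_all add: Z_add Z_scale Z_W)
qed

end

section \<open>Eigenvectors of operators of finite order\<close>

lemma sum_powers_root_of_unity:
  fixes w :: "'a :: field"
  assumes "w ^ n = 1" "w \<noteq> 1"
  shows "(\<Sum>k<n. w ^ k) = 0"
  using geometric_sum[of w n] assms by simp

text \<open>A discrete Fourier transform along the orbit of \<open>y\<close>: the sums of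
  \<open>w ^ (j * k) *s (T ^^ j) y\<close> over \<open>j\<close> are eigenvectors for
  \<open>inverse w ^ k\<close>, and their total over \<open>k\<close> is \<open>n\<close> times
  \<open>y\<close>. As \<open>y\<close> is outside \<open>S\<close>, so is one of them.\<close>

lemma (in linear_space) ex_eigenvector:
  fixes w :: 'a
  assumes w: "w ^ n = 1" "\<And>j. 0 < j \<Longrightarrow> j < n \<Longrightarrow> w ^ j \<noteq> 1" and n: "of_nat n \<noteq> (0 :: 'a)"
    and T: "\<And>x z. T (x + z) = T x + T z" "\<And>c x. T (c *s x) = c *s T x"
    and P: "subspace P" "\<And>x. x \<in> P \<Longrightarrow> T x \<in> P"
    and y: "y \<in> P" "y \<notin> S" "(T ^^ n) y = y" and S: "subspace S"
  shows "\<exists>q x. q ^ n = 1 \<and> x \<in> P \<and> x \<notin> S \<and> T x = q *s x"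
proof -
  have n0: "n > 0" using n by (cases n) auto
  have w0: "w \<noteq> 0" using w n0 by (auto simp: power_0_left split: if_splits)
  have T0: "T 0 = 0" using T(2)[of 0 0] by simp
  have T_sum: "T (sum f A) = (\<Sum>a\<in>A. T (f a))" for f and A :: "nat set"
    by (induct A rule: infinite_finite_induct) (simp_all add: T T0)
  have TP: "(T ^^ j) y \<in> P" for j by (induct j) (simp_all add: y P)
  define x where "x k = (\<Sum>j<n. w ^ (j * k) *s (T ^^ j) y)" for k
  have xP: "x k \<in> P" for k
    unfolding x_def by (intro subspace_sum subspace_scale P(1) TP)
  have Tx: "T (x k) = inverse w ^ k *s x k" for k
  proof -
    let ?g = "\<lambda>j. w ^ (j * k) *s (T ^^ j) y"
    have "?g n = ?g 0" using w(1) y(3) by (simp add: power_mult)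
    then have "(\<Sum>j<n. ?g (Suc j)) = (\<Sum>j<n. ?g j)"
      using sum.lessThan_Suc_shift[of ?g n] by simp
    moreover have "w ^ k *s T (x k) = (\<Sum>j<n. ?g (Suc j))"
      by (simp add: x_def T_sum T scale_sum_right power_add)
    ultimately have "inverse w ^ k *s (w ^ k *s T (x k)) = inverse w ^ k *s x k"
      by (simp only: x_def)
    then show ?thesis using w0 by (simp add: power_inverse)
  qed
  have "(\<Sum>k<n. x k) = (\<Sum>j<n. (\<Sum>k<n. (w ^ j) ^ k) *s (T ^^ j) y)"
    unfolding x_def by (subst sum.swap) (simp add: scale_sum_left power_mult)
  also have "\<dots> = (\<Sum>j<n. if j = 0 then of_nat n *s y else 0)"
  proof (intro sum.cong refl)
    fix j assume "j \<in> {..<n}"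
    moreover have "(w ^ j) ^ n = 1" using w(1) by (metis mult.commute power_mult power_one)
    ultimately show "(\<Sum>k<n. (w ^ j) ^ k) *s (T ^^ j) y = (if j = 0 then of_nat n *s y else 0)"
      using w(2)[of j] by (simp add: sum_powers_root_of_unity)
  qed
  also have "\<dots> = of_nat n *s y" using n0 by simp
  finally have sum: "(\<Sum>k<n. x k) = of_nat n *s y" .
  have "of_nat n *s y \<notin> S"
    using subspace_scale[OF S, of "of_nat n *s y" "inverse (of_nat n)"] y(2) n by auto
  then obtain k where "x k \<notin> S" using sum subspace_sum[OF S, of "{..<n}" x] by metis
  moreover have "(inverse w ^ k) ^ n = 1"
    using w(1) by (metis inverse_1 mult.commute power_inverse power_mult power_one)
  ultimately show ?thesis using xP Tx by blast
qed

lemma ex_primitive_root_of_unity: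
  assumes "n > 0"
  shows "\<exists>w :: complex. w ^ n = 1 \<and> (\<forall>j. 0 < j \<longrightarrow> j < n \<longrightarrow> w ^ j \<noteq> 1)"
proof (intro exI[of _ "cis (2 * pi / n)"] conjI allI impI)
  show "cis (2 * pi / n) ^ n = 1" using assms by (simp add: DeMoivre)
  fix j assume j: "0 < j" "j < n"
  have "inj_on (\<lambda>k. cis (2 * pi * real k / real n)) {..<n}"
    using bij_betw_roots_unity[OF assms] by (simp add: bij_betw_def)
  from inj_onD[OF this, of j 0] j show "cis (2 * pi / n) ^ j \<noteq> 1"
    by (auto simp: DeMoivre mult_ac)
qed

section \<open>Braided families obtained by conjugation\<close>

context pointed_bialgebra_group
begin

text \<open>\<Gamma> is taken as large as possible: all group-likes that commute with every
  \<open>y j\<close> up to a scalar, a set closed under products. Since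
  \<open>y j \<star> d i\<close> is not zero, the scalar \<open>\<chi> j (d i)\<close> can only be
  \<open>q i j\<close>.\<close>

lemma diagonal_familyI:
  fixes I :: "'i set"
  assumes d: "\<And>i. i \<in> I \<Longrightarrow> d i \<in> grp" "inj_on d I"
    and y: "\<And>i. i \<in> I \<Longrightarrow> y i \<notin> span grp" "\<And>i. i \<in> I \<Longrightarrow> skew (d i) unit (y i)"
    and q: "\<And>i j. i \<in> I \<Longrightarrow> j \<in> I \<Longrightarrow> d i \<star> y j = q i j *s (y j \<star> d i)"
  obtains \<Gamma> \<chi> where "diagonal_family scale V B coord mul unit eps L R I \<Gamma> y d \<chi>"
    and "\<And>i j. i \<in> I \<Longrightarrow> j \<in> I \<Longrightarrow> \<chi> j (d i) = q i j"
proof -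
  define \<Gamma> where "\<Gamma> = {a \<in> grp. \<forall>j\<in>I. \<exists>c. a \<star> y j = c *s (y j \<star> a)}"
  define \<chi> where "\<chi> j a = (SOME c. a \<star> y j = c *s (y j \<star> a))" for j a
  have yV: "y i \<in> V" if "i \<in> I" for i using y(2)[OF that] by (rule skew_V)
  have chi: "a \<star> y j = \<chi> j a *s (y j \<star> a)" if "j \<in> I" "a \<in> \<Gamma>" for j a
    using that someI_ex[of "\<lambda>c. a \<star> y j = c *s (y j \<star> a)"] by (auto simp: \<Gamma>_def \<chi>_def)
  have "diagonal_family scale V B coord mul unit eps L R I \<Gamma> y d \<chi>"
  proof
    show "\<Gamma> \<subseteq> grp" by (auto simp: \<Gamma>_def)
    have "unit \<star> y j = 1 *s (y j \<star> unit)" if "j \<in> I" for j using yV[OF that] by simp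
    then show "unit \<in> \<Gamma>" using unit_grp unfolding \<Gamma>_def by blast
    show "a \<star> b \<in> \<Gamma>" if a: "a \<in> \<Gamma>" and b: "b \<in> \<Gamma>" for a b
    proof -
      have "a \<star> b \<star> y j = (\<chi> j a * \<chi> j b) *s (y j \<star> (a \<star> b))" if j: "j \<in> I" for j
      proof -
        have "a \<star> b \<star> y j = \<chi> j b *s (a \<star> y j \<star> b)"
          using chi[OF j b] by (simp add: mul_assoc mul_simps)
        also have "\<dots> = (\<chi> j a * \<chi> j b) *s (y j \<star> (a \<star> b))"
          unfolding chi[OF j a] by (simp add: mul_assoc mul_simps mult.commute)
        finally show ?thesis .
      qed
      then show ?thesis using a b mul_grp by (auto simp: \<Gamma>_def)
    qed
    show "d i \<in> \<Gamma>" if "i \<in> I" for i using that d q by (auto simp: \<Gamma>_def)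
  qed (use d y chi in auto)
  moreover have "\<chi> j (d i) = q i j" if i: "i \<in> I" and j: "j \<in> I" for i j
  proof -
    have "d i \<in> \<Gamma>" using i d q by (auto simp: \<Gamma>_def)
    from chi[OF j this] q[OF i j] have "\<chi> j (d i) *s (y j \<star> d i) = q i j *s (y j \<star> d i)" by metis
    moreover have "y j \<star> d i \<noteq> 0"
      using not_span_grp_mul_right[OF yV[OF j] y(1)[OF j] d(1)[OF i]] span_zero by metis
    ultimately show ?thesis by simp
  qed
  ultimately show ?thesis using that by blast
qed

definition conj :: "'v \<Rightarrow> 'v \<Rightarrow> 'v"
  where "conj u x = u \<star> x \<star> ginv u"

lemma conj_mul: "u \<in> grp \<Longrightarrow> x \<in> V \<Longrightarrow> z \<in> V \<Longrightarrow> conj u (x \<star> z) = conj u x \<star> conj u z"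
proof -
  assume u: "u \<in> grp" and x: "x \<in> V" "z \<in> V"
  have "conj u x \<star> conj u z = u \<star> x \<star> (ginv u \<star> (u \<star> (z \<star> ginv u)))"
    by (simp add: conj_def mul_assoc)
  then show ?thesis using u x by (simp add: conj_def mul_assoc)
qed

lemma conj_scale: "conj u (c *s x) = c *s conj u x"
  by (simp add: conj_def mul_simps)

lemma skew_conj': "skew h unit y \<Longrightarrow> h \<in> grp \<Longrightarrow> u \<in> grp \<Longrightarrow> skew (conj u h) unit (conj u y)"
  unfolding conj_def by (rule skew_conj)

lemma conj_not_span: "u \<in> grp \<Longrightarrow> y \<in> V \<Longrightarrow> y \<notin> span grp \<Longrightarrow> conj u y \<notin> span grp"
  unfolding conj_def by (intro not_span_grp_mul_right not_span_grp_mul_left) simp_all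

lemma conj_eqI: "u \<in> grp \<Longrightarrow> z \<in> V \<Longrightarrow> u \<star> x = z \<star> u \<Longrightarrow> conj u x = z"
  by (simp add: conj_def)

text \<open>Conjugation is linear and multiplicative, so it carries a q-commutation relation to the
  conjugates with the same scalar.\<close>

lemma conj_commute:
  assumes "u \<in> grp" "a \<in> grp" "y \<in> V" "a \<star> y = c *s (y \<star> a)"
  shows "conj u a \<star> conj u y = c *s (conj u y \<star> conj u a)"
  using assms conj_scale by (simp add: conj_mul[symmetric] grp_V)

lemma inv_commute:
  assumes "a \<in> grp" "y \<in> V" "a \<star> y = c *s (y \<star> a)" "c \<noteq> 0"
  shows "ginv a \<star> y = inverse c *s (y \<star> ginv a)"
proof -
  have "y \<star> ginv a = ginv a \<star> (a \<star> y) \<star> ginv a" using assms(1,2) by simp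
  also have "\<dots> = c *s (ginv a \<star> y)"
    unfolding assms(3) using assms(1,2) by (simp add: mul_simps mul_assoc grp_V)
  finally show ?thesis using assms(4) by simp
qed

lemma eigen_conj_commute: "u \<in> grp \<Longrightarrow> y \<in> V \<Longrightarrow> conj u y = q *s y \<Longrightarrow> u \<star> y = q *s (y \<star> u)"
proof -
  assume u: "u \<in> grp" "y \<in> V" "conj u y = q *s y"
  have "u \<star> y = conj u y \<star> u" using u(1,2) by (simp add: conj_def)
  then show ?thesis by (simp add: u(3) mul_simps)
qed

text \<open>Outside the span, \<open>y\<close> would be a one-member family with self-braiding
  1.\<close>

lemma commuting_skew_in_span:
  assumes "h \<in> grp" "skew h unit y" "h \<star> y = y \<star> h"
  shows "y \<in> span grp"
proof (rule ccontr)
  assume ns: "y \<notin> span grp"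
  obtain \<Gamma> \<chi> where df: "diagonal_family scale V B coord mul unit eps L R {()} \<Gamma> (\<lambda>_. y) (\<lambda>_. h) \<chi>"
    and chi: "\<And>i j. i \<in> {()} \<Longrightarrow> j \<in> {()} \<Longrightarrow> \<chi> j h = 1"
  proof (rule diagonal_familyI[of "{()}" "\<lambda>_. h" "\<lambda>_. y" "\<lambda>_ _. 1"])
  qed (use assms ns in auto)
  show False
    by (rule diagonal_family.unit_braiding_impossible[OF df]) (use chi in auto)
qed

text \<open>Conjugation by \<open>u\<close> turns \<open>y\<close> into a skew-primitive of the
  inverse degree, on which \<open>h\<close> acts by \<open>inverse q\<close>. Outside the span, the
  two would have braiding \<open>q\<close> on the diagonal and \<open>inverse q\<close> off
  it.\<close>

lemma real_skew_in_span:
  assumes h: "h \<in> grp" "u \<in> grp" "u \<star> h = ginv h \<star> u" and y: "skew h unit y"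
    and q: "h \<star> y = q *s (y \<star> h)" "q \<noteq> 0" "q\<^sup>2 \<noteq> 1"
  shows "y \<in> span grp"
proof (rule ccontr)
  assume ns: "y \<notin> span grp"
  have yV: "y \<in> V" using y by (rule skew_V)
  let ?z = "conj u y" and ?k = "ginv h"
  have zV: "?z \<in> V" by (simp add: conj_def)
  have hu: "conj u h = ?k" using h by (intro conj_eqI) (simp_all add: grp_V)
  have "h \<star> u \<star> h = u" using h by (simp add: mul_assoc grp_V)
  then have "u \<star> ?k = h \<star> u" using h mul_inv_cancel(4)[OF h(1), of "h \<star> u"] by simp
  then have ku: "conj u ?k = h" using h by (intro conj_eqI) (simp_all add: grp_V)
  have ky: "?k \<star> y = inverse q *s (y \<star> ?k)" using inv_commute[OF h(1) yV q(1,2)] .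
  have hz: "h \<star> ?z = inverse q *s (?z \<star> h)"
    using conj_commute[OF h(2) ginv_grp[OF h(1)] yV ky] by (simp add: ku)
  have kz: "?k \<star> ?z = q *s (?z \<star> ?k)"
    using conj_commute[OF h(2,1) yV q(1)] by (simp add: hu)
  \<comment> \<open>If \<open>h\<close> were its own inverse, it would act on \<open>y\<close> both
    by \<open>q\<close> and by \<open>inverse q\<close>.\<close>
  have ne: "h \<noteq> ?k"
  proof
    assume "h = ?k"
    then have "q *s (y \<star> h) = inverse q *s (y \<star> h)" using q(1) ky by metis
    moreover have "y \<star> h \<noteq> 0" using not_span_grp_mul_right[OF yV ns h(1)] span_zero by metis
    ultimately have "q = inverse q" by simp
    then show False using q by (simp add: power2_eq_square field_simps)
  qed
  have sk: "skew ?k unit ?z" using skew_conj'[OF y h(1,2)] by (simp add: hu)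
  have nz: "?z \<notin> span grp" using conj_not_span[OF h(2) yV ns] .
  let ?I = "{False, True}" and ?y = "\<lambda>i. if i then ?z else y" and ?d = "\<lambda>i. if i then ?k else h"
  let ?q = "\<lambda>i j. if i = j then q else inverse q"
  obtain \<Gamma> \<chi> where df: "diagonal_family scale V B coord mul unit eps L R ?I \<Gamma> ?y ?d \<chi>"
    and chi: "\<And>i j. i \<in> ?I \<Longrightarrow> j \<in> ?I \<Longrightarrow> \<chi> j (?d i) = ?q i j"
  proof (rule diagonal_familyI[of ?I ?d ?y ?q])
    show "inj_on ?d ?I" using ne by (auto simp: inj_on_def)
  qed (use h y ns nz sk q ky hz kz in \<open>auto split: if_splits\<close>)
  show False
    by (rule diagonal_family.affine_A1_braiding_impossible[OF df, of False True q])
      (use q chi[of False False] chi[of True True] chi[of False True] chi[of True False] in auto)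
qed

text \<open>Conjugation by \<open>s\<close> rotates the involutions \<open>h\<close>,
  \<open>t\<close>, \<open>h \<star> t\<close>, so \<open>y\<close> and its first two conjugates
  have these three degrees. The signs with which \<open>h\<close> and \<open>t\<close> act on
  \<open>y\<close> then determine all nine braidings.\<close>

lemma klein_skew_in_span:
  assumes h: "h \<in> grp" "h \<noteq> unit" "h \<star> h = unit" and t: "t \<in> grp" "t \<star> t = unit" "h \<star> t = t \<star> h" "t \<noteq> h"
    and s: "s \<in> grp" "conj s h = t" "conj s t = h \<star> t" and y: "skew h unit y"
    and hy: "h \<star> y = (-1) *s (y \<star> h)" and ty: "t \<star> y = y \<star> t"
  shows "y \<in> span grp"
proof (rule ccontr)
  assume ns: "y \<notin> span grp"
  have V: "y \<in> V" "h \<in> V" "t \<in> V" using y h t by (auto simp: grp_V skew_V)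
  let ?r = "h \<star> t"
  have r: "?r \<in> grp" using h t mul_grp by simp
  have rs: "conj s ?r = h"
    using conj_mul[OF s(1) V(2,3)] s t V by (simp add: mul_assoc[symmetric])
  have ty': "t \<star> y = 1 *s (y \<star> t)" using ty by simp
  have ry: "?r \<star> y = (-1) *s (y \<star> ?r)"
  proof -
    have "?r \<star> y = h \<star> y \<star> t" using ty by (simp add: mul_assoc)
    then show ?thesis using hy by (simp add: mul_assoc mul_simps)
  qed
  let ?y2 = "conj s y" let ?y3 = "conj s ?y2"
  have V': "?y2 \<in> V" "?y3 \<in> V" by (simp_all add: conj_def)
  note y2 = conj_commute[OF s(1) h(1) V(1) hy] conj_commute[OF s(1) t(1) V(1) ty']
    conj_commute[OF s(1) r V(1) ry]
  note y2' = y2[unfolded s(2,3) rs]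
  note y3 = conj_commute[OF s(1) t(1) V'(1) y2'(1)] conj_commute[OF s(1) r V'(1) y2'(2)]
    conj_commute[OF s(1) h(1) V'(1) y2'(3)]
  note y3' = y3[unfolded s(2,3) rs]
  have sk2: "skew t unit ?y2" using skew_conj'[OF y h(1) s(1)] by (simp add: s)
  have sk3: "skew ?r unit ?y3" using skew_conj'[OF sk2 t(1) s(1)] by (simp add: s)
  have ns2: "?y2 \<notin> span grp" using conj_not_span[OF s(1) V(1) ns] .
  have ns3: "?y3 \<notin> span grp" using conj_not_span[OF s(1) V'(1) ns2] .
  \<comment> \<open>\<open>t\<close> is conjugate to \<open>h\<close>, which is not the
    unit.\<close>
  have "t \<noteq> unit"
  proof
    assume "t = unit"
    then have "s \<star> h \<star> ginv s = unit" using s(2) by (simp add: conj_def)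
    then have "s \<star> h \<star> ginv s \<star> s = unit \<star> s" by simp
    then have "ginv s \<star> (s \<star> h) = ginv s \<star> s" using s(1) V by (simp add: grp_V)
    then show False using s(1) V h(2) by simp
  qed
  have ne: "h \<noteq> ?r" "t \<noteq> ?r"
  proof -
    show "h \<noteq> ?r"
    proof
      assume "h = ?r"
      then have "h \<star> h = h \<star> ?r" by simp
      then have "unit = t" using h V by (simp add: mul_assoc[symmetric])
      then show False using \<open>t \<noteq> unit\<close> by simp
    qed
    show "t \<noteq> ?r"
    proof
      assume "t = ?r"
      then have "t \<star> t = h \<star> (t \<star> t)" by (metis mul_assoc)
      then show False using h(2) V(2) unfolding t(2) by simp
    qed
  qed
  let ?I = "{0, 1, 2 :: nat}"
  let ?y = "\<lambda>i. if i = 0 then y else if i = 1 then ?y2 else ?y3"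
  let ?d = "\<lambda>i. if i = 0 then h else if i = 1 then t else ?r"
  \<comment> \<open>In cyclic order, each degree commutes with the preceding vector and anticommutes
    with the other two; by rotation this follows from the three relations for
    \<open>y\<close>.\<close>
  let ?q = "\<lambda>i j. if i = Suc j \<or> i = 0 \<and> j = 2 then 1 else (-1 :: complex)"
  obtain \<Gamma> \<chi> where df: "diagonal_family scale V B coord mul unit eps L R ?I \<Gamma> ?y ?d \<chi>"
    and chi: "\<And>i j. i \<in> ?I \<Longrightarrow> j \<in> ?I \<Longrightarrow> \<chi> j (?d i) = ?q i j"
  proof (rule diagonal_familyI[of ?I ?d ?y ?q])
    show "inj_on ?d ?I" using ne t(4) by (auto simp: inj_on_def)
  qed (use h t r y ns ns2 ns3 sk2 sk3 hy ty ry y2' y3' in \<open>auto split: if_splits\<close>)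
  show False
    by (rule diagonal_family.affine_A2_braiding_impossible[OF df, of 0 1 2])
      (use chi[of 0 0] chi[of 1 1] chi[of 2 2] chi[of 0 1] chi[of 1 0] chi[of 0 2] chi[of 2 0]
        chi[of 1 2] chi[of 2 1] in auto)
qed

lemma skew_subspace: "subspace {y. skew h g y}"
  by (intro subspaceI) (simp_all add: skew_zero skew_add skew_scale)

lemma conj_add: "conj u (x + z) = conj u x + conj u z"
  by (simp add: conj_def mul_simps)

lemma conj_V [simp]: "conj u x \<in> V"
  by (simp add: conj_def)

lemma conj_unit: "x \<in> V \<Longrightarrow> conj unit x = x"
  using mul_inv_left[OF unit_grp] grp_V[OF ginv_grp[OF unit_grp]]
  by (simp add: conj_def)

lemma conj_conj: "u \<in> grp \<Longrightarrow> v \<in> grp \<Longrightarrow> x \<in> V \<Longrightarrow> conj u (conj v x) = conj (u \<star> v) x"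
proof -
  assume u: "u \<in> grp" "v \<in> grp" "x \<in> V"
  have "conj u (conj v x) = conj u (conj v x) \<star> (u \<star> v) \<star> ginv (u \<star> v)"
    using u mul_grp by simp
  also have "conj u (conj v x) \<star> (u \<star> v) = u \<star> v \<star> x"
    using u by (simp add: conj_def mul_assoc[symmetric])
  finally show ?thesis by (simp add: conj_def)
qed

definition gpow :: "'v \<Rightarrow> nat \<Rightarrow> 'v"
  where "gpow g n = ((\<star>) g ^^ n) unit"

lemma gpow_grp: "g \<in> grp \<Longrightarrow> gpow g n \<in> grp"
  by (induct n) (simp_all add: gpow_def unit_grp mul_grp)

lemma conj_gpow: "g \<in> grp \<Longrightarrow> x \<in> V \<Longrightarrow> (conj g ^^ n) x = conj (gpow g n) x"
proof (induct n)
  case (Suc n)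
  then show ?case using conj_conj[OF Suc(2) gpow_grp[OF Suc(2)], of x n] by (simp add: gpow_def)
qed (simp add: gpow_def conj_unit)

text \<open>The alternatives isolate what the argument asks of the group: \<open>h\<close> has odd
  order and is inverted by a conjugation, or it is an involution in a four-group whose involutions
  some \<open>s\<close> rotates. A_5 enters only by meeting this condition.\<close>

theorem V_eq_span_grp:
  assumes "\<And>h. h \<in> grp \<Longrightarrow>
    (\<exists>n u. odd n \<and> gpow h n = unit \<and> u \<in> grp \<and> u \<star> h = ginv h \<star> u) \<or>
    (\<exists>t s. h \<star> h = unit \<and> h \<noteq> unit \<and> t \<in> grp \<and> t \<star> t = unit \<and> h \<star> t = t \<star> h \<and> t \<noteq> h \<and>
      s \<in> grp \<and> s \<star> h = t \<star> s \<and> s \<star> t = h \<star> t \<star> s)"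
  shows "V = span grp"
proof (rule ccontr)
  assume "V \<noteq> span grp"
  then have "\<not> V \<subseteq> span grp" using span_grp_V by blast
  then obtain h y where h: "h \<in> grp" and y: "skew h unit y" "y \<notin> span grp"
    using ex_skew_not_in_span by blast
  have hh: "conj h h = h" using h by (simp add: conj_def grp_V)
  \<comment> \<open>Conjugation by \<open>u\<close> has order dividing \<open>n\<close>, so a stable
    subspace with a vector outside \<open>span grp\<close> also has an eigenvector outside
    it.\<close>
  have eigen: "\<exists>q x. q ^ n = 1 \<and> x \<in> P \<and> x \<notin> span grp \<and> u \<star> x = q *s (x \<star> u)"
    if u: "u \<in> grp" "gpow u n = unit" "n > 0" and P: "subspace P" "P \<subseteq> V" "\<And>x. x \<in> P \<Longrightarrow> conj u x \<in> P"
      and z: "z \<in> P" "z \<notin> span grp" for u n P z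
  proof -
    obtain w :: complex where w: "w ^ n = 1" "\<And>j. 0 < j \<Longrightarrow> j < n \<Longrightarrow> w ^ j \<noteq> 1"
      using ex_primitive_root_of_unity[OF u(3)] by blast
    have "(conj u ^^ n) z = z" using z P u by (auto simp: conj_gpow conj_unit)
    with ex_eigenvector[of w n "conj u" P z "span grp"] w u P z
    obtain q x where "q ^ n = 1" "x \<in> P" "x \<notin> span grp" "conj u x = q *s x"
      by (auto simp: conj_add conj_scale)
    then show ?thesis using eigen_conj_commute[OF u(1), of x q] P(2) by blast
  qed
  have "subspace {y. skew h unit y}" "{y. skew h unit y} \<subseteq> V"
    "\<And>x. x \<in> {y. skew h unit y} \<Longrightarrow> conj h x \<in> {y. skew h unit y}"
    using skew_conj'[OF _ h h] by (auto simp: skew_subspace skew_V hh)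
  note eigen_h = eigen[OF h _ _ this, of _ y]
  from assms[OF h] show False
  proof (elim disjE exE conjE)
    fix n u assume n: "odd n" "gpow h n = unit" and u: "u \<in> grp" "u \<star> h = ginv h \<star> u"
    obtain q x where q: "q ^ n = 1" and x: "skew h unit x" "x \<notin> span grp" "h \<star> x = q *s (x \<star> h)"
      using eigen_h[OF n(2)] n(1) y by (auto simp: odd_pos)
    have "q \<noteq> 1" using commuting_skew_in_span[OF h x(1)] x(2,3) by auto
    \<comment> \<open>An odd power of -1 is -1, so the odd order of \<open>h\<close> excludes this
      eigenvalue.\<close>
    moreover have "q \<noteq> -1" using q n(1) by (auto simp: power_minus_odd)
    ultimately have "q\<^sup>2 \<noteq> 1" by (simp add: power2_eq_1_iff)
    moreover have "q \<noteq> 0" using q n(1) by (auto simp: odd_pos power_0_left split: if_splits)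
    ultimately show False using real_skew_in_span[OF h u x(1,3)] x(2) by blast
  next
    fix t s
    assume h2: "h \<star> h = unit" "h \<noteq> unit" and t: "t \<in> grp" "t \<star> t = unit" "h \<star> t = t \<star> h" "t \<noteq> h"
      and s: "s \<in> grp" "s \<star> h = t \<star> s" "s \<star> t = h \<star> t \<star> s"
    have V: "h \<in> V" "t \<in> V" "s \<in> V" using h t s by (simp_all add: grp_V)
    obtain q x where q: "q ^ 2 = 1" and x: "skew h unit x" "x \<notin> span grp" "h \<star> x = q *s (x \<star> h)"
      using eigen_h[of 2] h2 y V by (auto simp: gpow_def numeral_2_eq_2)
    have "q \<noteq> 1" using commuting_skew_in_span[OF h x(1)] x(2,3) by auto
    then have q: "q = -1" using q by (auto simp: power2_eq_1_iff)
    \<comment> \<open>\<open>t\<close> commutes with \<open>h\<close>, so conjugation by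
      \<open>t\<close> preserves the degree as well as the eigenvalue -1 of \<open>h\<close>; this
      provides a simultaneous eigenvector.\<close>
    let ?P = "{y. skew h unit y \<and> h \<star> y = (-1) *s (y \<star> h)}"
    have th: "conj t h = h" using t V by (intro conj_eqI) (auto simp: mul_assoc)
    have P: "subspace ?P" "?P \<subseteq> V"
      by (intro subspaceI) (auto simp: skew_zero skew_add skew_scale mul_simps skew_V)
    have "conj t x \<in> ?P" if "x \<in> ?P" for x
      using that skew_conj'[OF _ h t(1), of x] conj_commute[OF t(1) h, of x "-1"] by (auto simp: th skew_V)
    from eigen[OF t(1) _ _ P this, of 2 x] obtain p z where p: "p ^ 2 = 1" and
      z: "skew h unit z" "h \<star> z = (-1) *s (z \<star> h)" "z \<notin> span grp" "t \<star> z = p *s (z \<star> t)"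
      using x q t(2) V by (auto simp: gpow_def numeral_2_eq_2)
    let ?r = "h \<star> t"
    have st: "conj s h = t" "conj s t = ?r" using s by (auto intro!: conj_eqI simp: V)
    show False
    proof (cases "p = 1")
      case True
      then show False
        using klein_skew_in_span[OF h h2(2,1) t s(1) st z(1,2)] z(3,4) by simp
    next
      case False
      \<comment> \<open>If \<open>t\<close> acts by -1 too, then \<open>h \<star> t\<close> acts by
        1. So \<open>t\<close> and \<open>s\<close> are replaced by \<open>h \<star> t\<close> and
        the inverse of \<open>s\<close>, which rotates the involutions the other way round.\<close>
      then have p: "p = -1" using p by (auto simp: power2_eq_1_iff)
      have rz: "?r \<star> z = z \<star> ?r"
      proof -
        have "?r \<star> z = h \<star> (t \<star> z)" by (simp add: mul_assoc)
        also have "\<dots> = - (h \<star> z \<star> t)" unfolding z(4) p by (simp add: mul_simps mul_assoc)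
        also have "\<dots> = z \<star> ?r" unfolding z(2) by (simp add: mul_simps mul_assoc)
        finally show ?thesis .
      qed
      have r: "?r \<in> grp" using h t mul_grp by simp
      have rr: "?r \<star> ?r = unit"
      proof -
        have "?r \<star> ?r = h \<star> (t \<star> h) \<star> t" by (simp add: mul_assoc)
        also have "\<dots> = h \<star> h \<star> (t \<star> t)" unfolding t(3)[symmetric] by (simp add: mul_assoc)
        finally show ?thesis using h2 t by simp
      qed
      have hr: "h \<star> ?r = t" using h2 V by (simp add: mul_assoc[symmetric])
      have rh: "?r \<star> h = t" unfolding t(3) using h2 V by (simp add: mul_assoc)
      have "?r \<noteq> h"
      proof
        assume "?r = h"
        then have "t = unit" using hr h2 by simp
        then have "s \<star> h = s" using s V by simp
        then have "ginv s \<star> (s \<star> h) = ginv s \<star> s" by simp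
        then show False using s(1) V h2 by simp
      qed
      have s': "ginv s \<in> grp" using s by simp
      have sr: "s \<star> ?r = h \<star> s"
      proof -
        have "s \<star> ?r = t \<star> (s \<star> t)" using s(2) by (simp add: mul_assoc[symmetric])
        also have "\<dots> = t \<star> ?r \<star> s" using s(3) by (simp add: mul_assoc)
        also have "t \<star> ?r = h" using t V by (simp add: t(3) mul_assoc[symmetric])
        finally show ?thesis .
      qed
      have "conj (ginv s) h = ?r"
      proof (rule conj_eqI[OF s'])
        show "ginv s \<star> h = ?r \<star> ginv s"
          using arg_cong[OF sr, of "\<lambda>v. ginv s \<star> v \<star> ginv s"] s(1) V by (simp add: mul_assoc)
      qed simp
      moreover have "conj (ginv s) ?r = h \<star> ?r"
      proof (rule conj_eqI[OF s'])
        show "ginv s \<star> ?r = h \<star> ?r \<star> ginv s"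
          unfolding hr using arg_cong[OF s(3), of "\<lambda>v. ginv s \<star> v \<star> ginv s"] s(1) V by (simp add: mul_assoc)
      qed simp
      ultimately show False
        using klein_skew_in_span[OF h h2(2,1) r rr _ \<open>?r \<noteq> h\<close> s' _ _ z(1,2) rz] z(3) hr rh by simp
    qed
  qed
qed

end

section \<open>The alternating group on five letters\<close>

text \<open>Even permutations are tables of values, so that statements about all of them can be decided by
  rewriting.\<close>

datatype five = F1 | F2 | F3 | F4 | F5

type_synonym table = "five \<times> five \<times> five \<times> five \<times> five"

fun nat_of_five :: "five \<Rightarrow> nat"
  where "nat_of_five F1 = 1" | "nat_of_five F2 = 2" | "nat_of_five F3 = 3"
  | "nat_of_five F4 = 4" | "nat_of_five F5 = 5"

fun entry :: "table \<Rightarrow> five \<Rightarrow> five"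
  where "entry (a, b, c, d, e) F1 = a" | "entry (a, b, c, d, e) F2 = b" | "entry (a, b, c, d, e) F3 = c"
  | "entry (a, b, c, d, e) F4 = d" | "entry (a, b, c, d, e) F5 = e"

fun table_comp :: "table \<Rightarrow> table \<Rightarrow> table"
  where "table_comp p (a, b, c, d, e) = (entry p a, entry p b, entry p c, entry p d, entry p e)"

definition table_id :: table
  where "table_id = (F1, F2, F3, F4, F5)"

definition table_fun :: "table \<Rightarrow> nat \<Rightarrow> nat"
  where "table_fun p = (\<lambda>n. if n = 1 then nat_of_five (entry p F1) else if n = 2 then nat_of_five (entry p F2)
    else if n = 3 then nat_of_five (entry p F3) else if n = 4 then nat_of_five (entry p F4)
    else if n = 5 then nat_of_five (entry p F5) else n)"

lemma table_fun_nat_of_five: "table_fun p (nat_of_five x) = nat_of_five (entry p x)"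
  by (cases x) (simp_all add: table_fun_def)

lemma nat_of_five_eq_iff [simp]: "nat_of_five x = nat_of_five y \<longleftrightarrow> x = y"
  by (cases x; cases y) simp_all

lemma entry_comp: "entry (table_comp p q) x = entry p (entry q x)"
  by (cases q; cases x) simp_all

lemma table_fun_comp: "table_fun (table_comp p q) = table_fun p \<circ> table_fun q"
proof
  fix n
  have "(\<exists>x. n = nat_of_five x) \<or> n \<notin> {1, 2, 3, 4, 5}"
    using nat_of_five.simps by (metis insertE singletonD)
  then show "table_fun (table_comp p q) n = (table_fun p \<circ> table_fun q) n"
  proof
    assume "\<exists>x. n = nat_of_five x"
    then show ?thesis by (auto simp: table_fun_nat_of_five entry_comp)
  qed (simp add: table_fun_def)
qed

lemma table_fun_id: "table_fun table_id = id"
  by (rule ext) (simp add: table_fun_def table_id_def)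

lemma table_fun_inject: "table_fun p = table_fun q \<longleftrightarrow> p = q"
proof
  assume eq: "table_fun p = table_fun q"
  have "entry p x = entry q x" for x
    using fun_cong[OF eq, of "nat_of_five x"] by (simp add: table_fun_nat_of_five)
  from this[of F1] this[of F2] this[of F3] this[of F4] this[of F5]
  show "p = q" by (cases p; cases q) simp
qed simp

text \<open>Coset representatives, identity or a three-cycle, along the chain of point stabilisers.\<close>
definition reps5 :: "table list" where "reps5 = [table_id, (F2, F5, F3, F4, F1), (F5, F1, F3, F4, F2),
  (F5, F2, F1, F4, F3), (F5, F2, F3, F1, F4)]"
definition reps4 :: "table list" where "reps4 = [table_id, (F2, F4, F3, F1, F5), (F4, F1, F3, F2, F5),
  (F4, F2, F1, F3, F5)]"
definition reps3 :: "table list" where "reps3 = [table_id, (F2, F3, F1, F4, F5), (F3, F1, F2, F4, F5)]"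

text \<open>Along a stabiliser chain every element is a product of one representative per level,
  which accounts for 5 * 4 * 3 = 60 products.\<close>

definition even_tables :: "table list"
  where "even_tables = concat (map (\<lambda>p. concat (map (\<lambda>q. map (\<lambda>r. table_comp p (table_comp q r)) reps3) reps4)) reps5)"

lemma distinct_even_tables: "distinct even_tables"
  by code_simp

lemma length_even_tables: "length even_tables = 60"
  by code_simp

lemma three_cycle_alt_group:
  assumes "a \<in> {1..n}" "b \<in> {1..n}" "c \<in> {1..n}" "a \<noteq> b" "b \<noteq> c"
  shows "transpose a b \<circ> transpose b c \<in> carrier (alt_group n)"
  using assms
  by (simp add: alt_group_carrier permutes_compose permutes_swap_id evenperm_comp evenperm_swap
      permutation_swap_id)

lemma reps_alt_group:
  assumes "p \<in> set reps5 \<union> set reps4 \<union> set reps3"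
  shows "table_fun p \<in> carrier (alt_group 5)"
proof -
  have id: "table_fun table_id \<in> carrier (alt_group 5)"
    by (simp add: table_fun_id alt_group_carrier permutes_id)
  have cycles:
    "table_fun (F2, F5, F3, F4, F1) = transpose 5 1 \<circ> transpose 1 2"
    "table_fun (F5, F1, F3, F4, F2) = transpose 5 2 \<circ> transpose 2 1"
    "table_fun (F5, F2, F1, F4, F3) = transpose 5 3 \<circ> transpose 3 1"
    "table_fun (F5, F2, F3, F1, F4) = transpose 5 4 \<circ> transpose 4 1"
    "table_fun (F2, F4, F3, F1, F5) = transpose 4 1 \<circ> transpose 1 2"
    "table_fun (F4, F1, F3, F2, F5) = transpose 4 2 \<circ> transpose 2 1"
    "table_fun (F4, F2, F1, F3, F5) = transpose 4 3 \<circ> transpose 3 1"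
    "table_fun (F2, F3, F1, F4, F5) = transpose 1 2 \<circ> transpose 2 3"
    "table_fun (F3, F1, F2, F4, F5) = transpose 1 3 \<circ> transpose 3 2"
    by (rule ext, simp add: table_fun_def transpose_def)+
  have "table_fun q \<in> carrier (alt_group 5)"
    if "q \<in> {(F2, F5, F3, F4, F1), (F5, F1, F3, F4, F2), (F5, F2, F1, F4, F3), (F5, F2, F3, F1, F4), (F2, F4, F3, F1, F5), (F4, F1, F3, F2, F5), (F4, F2, F1, F3, F5), (F2, F3, F1, F4, F5), (F3, F1, F2, F4, F5)}" for q
    using that cycles
    by (elim insertE emptyE) (simp_all only: three_cycle_alt_group, simp_all add: three_cycle_alt_group)
  then show ?thesis
    using assms id unfolding reps5_def reps4_def reps3_def by auto
qed

text \<open>The representatives are even, which gives one inclusion; counting gives the other, 60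
  distinct tables against half of 5 factorial.\<close>

lemma alt_group_5_eq_tables: "carrier (alt_group 5) = table_fun ` set even_tables"
proof (rule sym, rule card_subset_eq)
  have fin: "finite {p. p permutes {1..5::nat}}" by (rule finite_permutations) simp
  then show "finite (carrier (alt_group 5))"
    by (rule finite_subset[rotated]) (auto simp: alt_group_carrier)
  interpret group "alt_group 5" by (rule alt_group_is_group)
  show "table_fun ` set even_tables \<subseteq> carrier (alt_group 5)"
  proof
    fix f assume "f \<in> table_fun ` set even_tables"
    then obtain p q r where "p \<in> set reps5" "q \<in> set reps4" "r \<in> set reps3"
      "f = table_fun (table_comp p (table_comp q r))"
      unfolding even_tables_def by auto
    moreover have "g \<circ> h \<in> carrier (alt_group 5)"
      if "g \<in> carrier (alt_group 5)" "h \<in> carrier (alt_group 5)" for g h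
      using m_closed[OF that] by (simp add: alt_group_mult)
    ultimately show "f \<in> carrier (alt_group 5)"
      by (simp add: table_fun_comp reps_alt_group)
  qed
  have "card (table_fun ` set even_tables) = 60"
    using distinct_card[OF distinct_even_tables] length_even_tables
    by (subst card_image) (auto simp: inj_on_def table_fun_inject)
  moreover have "2 * card (carrier (alt_group 5)) = fact 5"
    by (rule alt_group_card_carrier) simp
  ultimately show "card (table_fun ` set even_tables) = card (carrier (alt_group 5))"
    by (simp add: fact_numeral)
qed

text \<open>Short-circuiting, as are the nested conditionals below: rewriting would otherwise evaluate
  every branch of the search.\<close>
fun lazy_ex :: "('a \<Rightarrow> bool) \<Rightarrow> 'a list \<Rightarrow> bool"
  where "lazy_ex P [] = False"
  | "lazy_ex P (x # xs) = (if P x then True else lazy_ex P xs)"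

lemma lazy_ex_iff: "lazy_ex P xs \<longleftrightarrow> (\<exists>x\<in>set xs. P x)"
  by (induct xs) simp_all

text \<open>The equation p u p = u says that \<open>u\<close> conjugates \<open>p\<close> to its
  inverse, without forming an inverse. The exponents 1, 3 and 5 are the odd orders in A_5.\<close>

definition real_odd_table :: "table list \<Rightarrow> table \<Rightarrow> bool"
  where "real_odd_table T p = (if lazy_ex (\<lambda>u. table_comp p (table_comp u p) = u) T then
    (let p2 = table_comp p p; p3 = table_comp p p2 in
      if p = table_id then True else if p3 = table_id then True else table_comp p2 p3 = table_id)
    else False)"

definition klein_table :: "table list \<Rightarrow> table \<Rightarrow> bool"
  where "klein_table T p = (if p = table_id then False else if table_comp p p = table_id then
    lazy_ex (\<lambda>t. if t = p then False else if table_comp t t = table_id then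
      (if table_comp p t = table_comp t p then
        lazy_ex (\<lambda>s. if table_comp s p = table_comp t s then
          table_comp s t = table_comp p (table_comp t s) else False) T
       else False) else False) T else False)"

text \<open>The search succeeds because each involution of A_5 lies in a Klein four-group rotated by
  a three-cycle, while three-cycles and five-cycles are conjugate to their inverses within
  A_5.\<close>

lemma even_tables_check:
  "list_all (\<lambda>p. if klein_table even_tables p then True else real_odd_table even_tables p) even_tables"
  by code_simp

lemma alt_group_5_element_cases:
  assumes "p \<in> carrier (alt_group 5)"
  shows "(\<exists>u\<in>carrier (alt_group 5). p \<circ> (u \<circ> p) = u \<and>
      (p = id \<or> p \<circ> (p \<circ> p) = id \<or> p \<circ> p \<circ> (p \<circ> (p \<circ> p)) = id)) \<or>
    (p \<noteq> id \<and> p \<circ> p = id \<and> (\<exists>t\<in>carrier (alt_group 5). \<exists>s\<in>carrier (alt_group 5).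
      t \<noteq> p \<and> t \<circ> t = id \<and> p \<circ> t = t \<circ> p \<and> s \<circ> p = t \<circ> s \<and> s \<circ> t = p \<circ> (t \<circ> s)))"
proof -
  obtain x where x: "p = table_fun x" "x \<in> set even_tables"
    using assms by (auto simp: alt_group_5_eq_tables)
  have id: "id = table_fun table_id" by (simp add: table_fun_id)
  have "klein_table even_tables x \<or> real_odd_table even_tables x"
    using even_tables_check x(2) by (auto simp: list_all_iff split: if_splits)
  then show ?thesis
    unfolding x(1) id alt_group_5_eq_tables table_fun_comp[symmetric] table_fun_inject bex_simps image_iff
    by (auto simp: klein_table_def real_odd_table_def lazy_ex_iff Let_def split: if_splits)
qed

section \<open>Tensor products\<close>

lemma carrier_free_module:
    "carrier (free_module K S) = {f. range f \<subseteq> carrier K \<and> finite (supp K f) \<and> supp K f \<subseteq> S}"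
  and zero_free_module: "\<zero>\<^bsub>free_module K S\<^esub> = (\<lambda>x. \<zero>\<^bsub>K\<^esub>)"
  and add_free_module: "f \<oplus>\<^bsub>free_module K S\<^esub> g = (\<lambda>x. f x \<oplus>\<^bsub>K\<^esub> g x)"
  and smult_free_module: "c \<odot>\<^bsub>free_module K S\<^esub> f = (\<lambda>x. c \<otimes>\<^bsub>K\<^esub> f x)"
  by (simp_all add: free_module_def)

lemmas free_module_sel = carrier_free_module zero_free_module add_free_module smult_free_module

lemma free_module_closed: "f \<in> carrier (free_module K S) \<Longrightarrow> f x \<in> carrier K"
  by (auto simp: free_module_sel)

lemma free_moduleI:
  assumes "\<And>x. f x \<in> carrier K" "finite A" "A \<subseteq> S" "\<And>x. x \<notin> A \<Longrightarrow> f x = \<zero>\<^bsub>K\<^esub>"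
  shows "f \<in> carrier (free_module K S)"
proof -
  have "supp K f \<subseteq> A" using assms(4) by (auto simp: supp_def)
  then show ?thesis using assms finite_subset by (auto simp: free_module_sel)
qed

lemma free_module_module:
  assumes "cring K"
  shows "module K (free_module K S)"
proof -
  interpret cring K by fact
  let ?F = "free_module K S"
  have cl: "f x \<in> carrier K" if "f \<in> carrier ?F" for f x using that by (rule free_module_closed)
  have fin: "finite (supp K f)" "supp K f \<subseteq> S" if "f \<in> carrier ?F" for f
    using that by (auto simp: free_module_sel)
  have out: "f x = \<zero>\<^bsub>K\<^esub>" if "x \<notin> supp K f" for f x using that by (simp add: supp_def)
  show ?thesis
  proof (rule module_criteria[OF assms])
    show "\<zero>\<^bsub>?F\<^esub> \<in> carrier ?F" by (rule free_moduleI[of _ _ "{}"]) (auto simp: free_module_sel)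
    show "\<forall>v w. v \<in> carrier ?F \<and> w \<in> carrier ?F \<longrightarrow> v \<oplus>\<^bsub>?F\<^esub> w \<in> carrier ?F"
    proof (intro allI impI, elim conjE)
      fix v w assume vw: "v \<in> carrier ?F" "w \<in> carrier ?F"
      show "v \<oplus>\<^bsub>?F\<^esub> w \<in> carrier ?F"
        by (rule free_moduleI[of _ _ "supp K v \<union> supp K w"])
          (use vw cl fin in \<open>auto simp: free_module_sel(3) out\<close>)
    qed
    show "\<forall>v\<in>carrier ?F. \<exists>n\<in>carrier ?F. v \<oplus>\<^bsub>?F\<^esub> n = \<zero>\<^bsub>?F\<^esub>"
    proof
      fix v assume v: "v \<in> carrier ?F"
      have "(\<lambda>x. \<ominus>\<^bsub>K\<^esub> v x) \<in> carrier ?F"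
        by (rule free_moduleI[of _ _ "supp K v"]) (use v cl fin in \<open>auto simp: out\<close>)
      moreover have "v \<oplus>\<^bsub>?F\<^esub> (\<lambda>x. \<ominus>\<^bsub>K\<^esub> v x) = \<zero>\<^bsub>?F\<^esub>"
        using cl[OF v] by (simp add: free_module_sel r_neg)
      ultimately show "\<exists>n\<in>carrier ?F. v \<oplus>\<^bsub>?F\<^esub> n = \<zero>\<^bsub>?F\<^esub>" by blast
    qed
    show "\<forall>c v. c \<in> carrier K \<and> v \<in> carrier ?F \<longrightarrow> c \<odot>\<^bsub>?F\<^esub> v \<in> carrier ?F"
    proof (intro allI impI, elim conjE)
      fix c v assume c: "c \<in> carrier K" and v: "v \<in> carrier ?F"
      show "c \<odot>\<^bsub>?F\<^esub> v \<in> carrier ?F"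
        by (rule free_moduleI[of _ _ "supp K v"]) (use c v cl fin in \<open>auto simp: free_module_sel(4) out\<close>)
    qed
  qed (use cl in \<open>auto simp: free_module_sel(2-4) a_assoc m_assoc l_distr r_distr intro!: ext a_comm\<close>)
qed

lemma delta_closed: "cring K \<Longrightarrow> x \<in> S \<Longrightarrow> delta K x \<in> carrier (free_module K S)"
proof -
  assume "cring K" "x \<in> S"
  interpret cring K by fact
  show ?thesis by (rule free_moduleI[of _ _ "{x}"]) (auto simp: delta_def \<open>x \<in> S\<close>)
qed

lemma free_module_induct [consumes 2, case_names zero step]:
  assumes "cring K" "f \<in> carrier (free_module K S)"
    and "P \<zero>\<^bsub>free_module K S\<^esub>"
    and "\<And>c x f. c \<in> carrier K \<Longrightarrow> x \<in> S \<Longrightarrow> f \<in> carrier (free_module K S) \<Longrightarrow> P f \<Longrightarrow>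
      P (c \<odot>\<^bsub>free_module K S\<^esub> delta K x \<oplus>\<^bsub>free_module K S\<^esub> f)"
  shows "P f"
proof -
  interpret cring K by fact
  have "finite A \<Longrightarrow> supp K f = A \<Longrightarrow> f \<in> carrier (free_module K S) \<Longrightarrow> P f" for A f
  proof (induction A arbitrary: f rule: finite_induct)
    case empty
    then have "f = \<zero>\<^bsub>free_module K S\<^esub>" by (auto simp: supp_def free_module_sel)
    then show ?case using assms(3) by simp
  next
    case (insert x A)
    let ?g = "f(x := \<zero>\<^bsub>K\<^esub>)"
    have g: "supp K ?g = A" using insert by (auto simp: supp_def)
    have fx: "f x \<in> carrier K" "\<And>y. f y \<in> carrier K" using insert.prems(2) by (auto dest: free_module_closed)
    have gc: "?g \<in> carrier (free_module K S)"
      by (rule free_moduleI[of _ _ A]) (use insert fx g in \<open>auto simp: free_module_sel supp_def\<close>)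
    have "x \<in> S" using insert.prems by (auto simp: free_module_sel)
    have "f = f x \<odot>\<^bsub>free_module K S\<^esub> delta K x \<oplus>\<^bsub>free_module K S\<^esub> ?g"
      using fx by (auto simp: free_module_sel delta_def)
    with assms(4)[OF fx(1) \<open>x \<in> S\<close> gc insert.IH[OF g gc]] show ?case by metis
  qed
  with assms(2) show ?thesis by (auto simp: free_module_sel)
qed

text \<open>The linear extension of \<open>b\<close> to the free module, and the same sum that
  \<open>tensor_lift\<close> evaluates at a chosen representative.\<close>

definition free_lift :: "('k, 'm) ring_scheme \<Rightarrow> ('k, 'u, 'n) module_scheme \<Rightarrow> ('x \<Rightarrow> 'u) \<Rightarrow>
    ('x \<Rightarrow> 'k) \<Rightarrow> 'u"
  where "free_lift K U b f = (\<Oplus>\<^bsub>U\<^esub>p\<in>supp K f. f p \<odot>\<^bsub>U\<^esub> b p)"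

text \<open>Enlarging the index set adds only zero terms. A common index set permits termwise
  comparison, since cancellation can shrink the support of a sum.\<close>

lemma free_lift_superset:
  assumes "module K U" "b \<in> S \<rightarrow> carrier U" "f \<in> carrier (free_module K S)"
    and "finite A" "supp K f \<subseteq> A" "A \<subseteq> S"
  shows "free_lift K U b f = (\<Oplus>\<^bsub>U\<^esub>p\<in>A. f p \<odot>\<^bsub>U\<^esub> b p)"
proof -
  interpret module K U by fact
  have b: "b p \<in> carrier U" if "p \<in> A" for p using assms(2,6) that by auto
  have "(\<Oplus>\<^bsub>U\<^esub>p\<in>A. f p \<odot>\<^bsub>U\<^esub> b p) = (\<Oplus>\<^bsub>U\<^esub>p\<in>supp K f. f p \<odot>\<^bsub>U\<^esub> b p)"
    using assms(3-5) b
    by (intro M.add.finprod_mono_neutral_cong_right)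
      (auto simp: supp_def free_module_closed)
  then show ?thesis by (simp add: free_lift_def)
qed

lemma free_lift_hom:
  assumes "module K U" "b \<in> S \<rightarrow> carrier U"
  shows "free_lift K U b \<in> module_hom K (free_module K S) U"
proof -
  interpret module K U by fact
  let ?F = "free_module K S"
  interpret F: module K ?F by (rule free_module_module) (rule R.is_cring)
  have b: "b x \<in> carrier U" if "x \<in> S" for x using assms(2) that by auto
  have cl: "f x \<in> carrier K" if "f \<in> carrier ?F" for f x using that by (rule free_module_closed)
  have fin: "finite (supp K f)" "supp K f \<subseteq> S" if "f \<in> carrier ?F" for f
    using that by (auto simp: free_module_sel)
  have "free_lift K U b f \<in> carrier U" if f: "f \<in> carrier ?F" for f
    unfolding free_lift_def using fin[OF f] cl[OF f] b by (intro M.finsum_closed) auto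
  moreover have "free_lift K U b (f \<oplus>\<^bsub>?F\<^esub> g) = free_lift K U b f \<oplus>\<^bsub>U\<^esub> free_lift K U b g"
    if f: "f \<in> carrier ?F" and g: "g \<in> carrier ?F" for f g
  proof -
    let ?A = "supp K f \<union> supp K g"
    have A: "finite ?A" "?A \<subseteq> S" using fin f g by auto
    have sup: "supp K (f \<oplus>\<^bsub>?F\<^esub> g) \<subseteq> ?A" using cl f g by (auto simp: supp_def free_module_sel(3))
    have "free_lift K U b (f \<oplus>\<^bsub>?F\<^esub> g) = (\<Oplus>\<^bsub>U\<^esub>p\<in>?A. (f p \<oplus>\<^bsub>K\<^esub> g p) \<odot>\<^bsub>U\<^esub> b p)"
      using free_lift_superset[OF assms F.M.a_closed[OF f g] A(1) sup A(2)] by (simp add: free_module_sel(3))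
    also have "\<dots> = (\<Oplus>\<^bsub>U\<^esub>p\<in>?A. f p \<odot>\<^bsub>U\<^esub> b p \<oplus>\<^bsub>U\<^esub> g p \<odot>\<^bsub>U\<^esub> b p)"
      using A cl f g b by (intro M.finsum_cong') (auto simp: smult_l_distr subset_iff)
    also have "\<dots> = (\<Oplus>\<^bsub>U\<^esub>p\<in>?A. f p \<odot>\<^bsub>U\<^esub> b p) \<oplus>\<^bsub>U\<^esub> (\<Oplus>\<^bsub>U\<^esub>p\<in>?A. g p \<odot>\<^bsub>U\<^esub> b p)"
      using A cl f g b by (intro M.finsum_addf) (auto simp: subset_iff)
    also have "\<dots> = free_lift K U b f \<oplus>\<^bsub>U\<^esub> free_lift K U b g"
      using free_lift_superset[OF assms f A(1) _ A(2)] free_lift_superset[OF assms g A(1) _ A(2)] by simp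
    finally show ?thesis .
  qed
  moreover have "free_lift K U b (c \<odot>\<^bsub>?F\<^esub> f) = c \<odot>\<^bsub>U\<^esub> free_lift K U b f"
    if c: "c \<in> carrier K" and f: "f \<in> carrier ?F" for c f
  proof -
    have sup: "supp K (c \<odot>\<^bsub>?F\<^esub> f) \<subseteq> supp K f" using c cl f by (auto simp: supp_def free_module_sel(4))
    have "free_lift K U b (c \<odot>\<^bsub>?F\<^esub> f) = (\<Oplus>\<^bsub>U\<^esub>p\<in>supp K f. (c \<otimes>\<^bsub>K\<^esub> f p) \<odot>\<^bsub>U\<^esub> b p)"
      using free_lift_superset[OF assms F.smult_closed[OF c f] fin(1)[OF f] sup fin(2)[OF f]]
      by (simp add: free_module_sel(4))
    also have "\<dots> = (\<Oplus>\<^bsub>U\<^esub>p\<in>supp K f. c \<odot>\<^bsub>U\<^esub> (f p \<odot>\<^bsub>U\<^esub> b p))"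
      using fin[OF f] c cl[OF f] b by (intro M.finsum_cong') (auto simp: smult_assoc1 subset_iff)
    also have "\<dots> = c \<odot>\<^bsub>U\<^esub> free_lift K U b f"
      unfolding free_lift_def using fin[OF f] c cl[OF f] b
      by (intro finsum_smult_ldistr[symmetric]) auto
    finally show ?thesis .
  qed
  ultimately show ?thesis by (auto simp: module_hom_def)
qed

lemma free_lift_delta:
  assumes "module K U" "b \<in> S \<rightarrow> carrier U" "x \<in> S"
  shows "free_lift K U b (delta K x) = b x"
proof -
  interpret module K U by fact
  have "delta K x \<in> carrier (free_module K S)" using assms(3) R.is_cring by (rule delta_closed[rotated])
  then have "free_lift K U b (delta K x) = (\<Oplus>\<^bsub>U\<^esub>p\<in>{x}. delta K x p \<odot>\<^bsub>U\<^esub> b p)"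
    using assms by (intro free_lift_superset) (auto simp: supp_def delta_def split: if_splits)
  also have "\<dots> = b x" using assms by (simp add: delta_def Pi_iff)
  finally show ?thesis .
qed

lemma submodule_abelian_subgroup:
  assumes "submodule K N M"
  shows "abelian_subgroup N M"
proof -
  interpret submodule K N M by fact
  interpret module K M by (rule module)
  have neg: "\<ominus>\<^bsub>M\<^esub> x \<in> N" if "x \<in> N" for x
  proof -
    have "(\<ominus>\<^bsub>K\<^esub> \<one>\<^bsub>K\<^esub>) \<odot>\<^bsub>M\<^esub> x \<in> N"
      using that by (intro submodule.smult_closed[OF assms]) simp_all
    then show ?thesis using smult_minus_1[of x] that subset by (metis subsetD)
  qed
  have ne: "N \<noteq> {}" using submodule.zero_closed[OF assms] by blast
  show ?thesis
  proof (rule abelian_subgroupI3)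
    show "additive_subgroup N M"
      by (rule additive_subgroupI, rule M.add.subgroupI)
        (use subset neg ne in \<open>auto simp: a_inv_def\<close>)
  qed (rule M.abelian_group_axioms)
qed

lemma quotient_module_sel:
    "carrier (quotient_module M N) = a_rcosets\<^bsub>M\<^esub> N"
    "\<zero>\<^bsub>quotient_module M N\<^esub> = N"
    "S \<oplus>\<^bsub>quotient_module M N\<^esub> T = S <+>\<^bsub>M\<^esub> T"
    "c \<odot>\<^bsub>quotient_module M N\<^esub> S = (\<Union>x\<in>S. N +>\<^bsub>M\<^esub> (c \<odot>\<^bsub>M\<^esub> x))"
  by (simp_all add: quotient_module_def)

lemma
  assumes "submodule K N M"
  shows quotient_module_module: "module K (quotient_module M N)"
    and quotient_projection_hom: "(\<lambda>x. N +>\<^bsub>M\<^esub> x) \<in> module_hom K M (quotient_module M N)"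
proof -
  interpret submodule K N M by fact
  interpret module K M by (rule module)
  interpret abelian_subgroup N M using assms by (rule submodule_abelian_subgroup)
  let ?Q = "quotient_module M N"
  let ?p = "\<lambda>x. N +>\<^bsub>M\<^esub> x"
  have car: "carrier ?Q = ?p ` carrier M"
    by (auto simp: quotient_module_sel A_RCOSETS_def RCOSETS_def a_r_coset_def)
  have pc: "?p x \<in> carrier ?Q" if "x \<in> carrier M" for x using car that by auto
  have zero: "\<zero>\<^bsub>?Q\<^esub> = ?p \<zero>\<^bsub>M\<^esub>"
    using subset by (simp add: quotient_module_sel)
  have add: "?p x \<oplus>\<^bsub>?Q\<^esub> ?p y = ?p (x \<oplus>\<^bsub>M\<^esub> y)" if "x \<in> carrier M" "y \<in> carrier M" for x y
    using that by (simp add: quotient_module_sel a_rcos_sum)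
  \<comment> \<open>The scalar multiple of a coset is defined as a union of cosets over its
    elements; all of them coincide because \<open>N\<close> is stable under scalars.\<close>
  have smult: "c \<odot>\<^bsub>?Q\<^esub> ?p x = ?p (c \<odot>\<^bsub>M\<^esub> x)" if c: "c \<in> carrier K" and x: "x \<in> carrier M" for c x
  proof -
    have "?p (c \<odot>\<^bsub>M\<^esub> y) = ?p (c \<odot>\<^bsub>M\<^esub> x)" if y: "y \<in> ?p x" for y
    proof -
      obtain n where n: "n \<in> N" "y = n \<oplus>\<^bsub>M\<^esub> x" using y by (auto simp: a_r_coset_def')
      then have "c \<odot>\<^bsub>M\<^esub> y = c \<odot>\<^bsub>M\<^esub> n \<oplus>\<^bsub>M\<^esub> c \<odot>\<^bsub>M\<^esub> x"
        using c x subset by (auto simp: smult_r_distr)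
      then have "c \<odot>\<^bsub>M\<^esub> y \<in> ?p (c \<odot>\<^bsub>M\<^esub> x)" using n c by (auto simp: a_r_coset_def')
      then show ?thesis using a_repr_independence' c x by simp
    qed
    moreover have "x \<in> ?p x" using x by (rule a_rcos_self)
    ultimately show ?thesis unfolding quotient_module_sel by blast
  qed
  show mod: "module K ?Q"
  proof (rule module_criteria[OF R.is_cring])
    show "\<forall>v\<in>carrier ?Q. \<exists>n\<in>carrier ?Q. v \<oplus>\<^bsub>?Q\<^esub> n = \<zero>\<^bsub>?Q\<^esub>"
    proof
      fix v assume "v \<in> carrier ?Q"
      then obtain x where x: "x \<in> carrier M" "v = ?p x" using car by auto
      then have "v \<oplus>\<^bsub>?Q\<^esub> ?p (\<ominus>\<^bsub>M\<^esub> x) = \<zero>\<^bsub>?Q\<^esub>" by (simp add: add zero M.r_neg)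
      then show "\<exists>n\<in>carrier ?Q. v \<oplus>\<^bsub>?Q\<^esub> n = \<zero>\<^bsub>?Q\<^esub>" using pc[of "\<ominus>\<^bsub>M\<^esub> x"] x by blast
    qed
    show "\<zero>\<^bsub>?Q\<^esub> \<in> carrier ?Q" unfolding zero by (rule pc) simp
  qed (auto simp: car add smult zero M.a_ac smult_assoc1 smult_l_distr smult_r_distr
      intro!: imageI)
  show "?p \<in> module_hom K M ?Q"
    using pc add smult by (auto simp: module_hom_def)
qed

lemma quotient_module_rep:
  "S \<in> carrier (quotient_module M N) \<Longrightarrow> \<exists>x\<in>carrier M. S = N +>\<^bsub>M\<^esub> x"
  by (auto simp: quotient_module_sel A_RCOSETS_def RCOSETS_def a_r_coset_def)

section \<open>Bilinear maps and the universal property of the tensor product\<close>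

definition bilinear :: "('k, 'm) ring_scheme \<Rightarrow>
    ('k, 'v, 'n) module_scheme \<Rightarrow> ('k, 'w, 'p) module_scheme \<Rightarrow> ('k, 'u, 'q) module_scheme \<Rightarrow>
    ('v \<Rightarrow> 'w \<Rightarrow> 'u) \<Rightarrow> bool"
  where "bilinear K V W U b \<longleftrightarrow>
    (\<forall>v\<in>carrier V. b v \<in> module_hom K W U) \<and>
    (\<forall>w\<in>carrier W. (\<lambda>v. b v w) \<in> module_hom K V U)"

lemma bilinearI:
  assumes "\<And>v w. v \<in> carrier V \<Longrightarrow> w \<in> carrier W \<Longrightarrow> b v w \<in> carrier U"
    and "\<And>v v' w. v \<in> carrier V \<Longrightarrow> v' \<in> carrier V \<Longrightarrow> w \<in> carrier W \<Longrightarrow>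
      b (v \<oplus>\<^bsub>V\<^esub> v') w = b v w \<oplus>\<^bsub>U\<^esub> b v' w"
    and "\<And>v w w'. v \<in> carrier V \<Longrightarrow> w \<in> carrier W \<Longrightarrow> w' \<in> carrier W \<Longrightarrow>
      b v (w \<oplus>\<^bsub>W\<^esub> w') = b v w \<oplus>\<^bsub>U\<^esub> b v w'"
    and "\<And>c v w. c \<in> carrier K \<Longrightarrow> v \<in> carrier V \<Longrightarrow> w \<in> carrier W \<Longrightarrow>
      b (c \<odot>\<^bsub>V\<^esub> v) w = c \<odot>\<^bsub>U\<^esub> b v w"
    and "\<And>c v w. c \<in> carrier K \<Longrightarrow> v \<in> carrier V \<Longrightarrow> w \<in> carrier W \<Longrightarrow>
      b v (c \<odot>\<^bsub>W\<^esub> w) = c \<odot>\<^bsub>U\<^esub> b v w"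
  shows "bilinear K V W U b"
  using assms by (auto simp: bilinear_def module_hom_def)

lemma bilinearD:
  assumes "bilinear K V W U b"
  shows "v \<in> carrier V \<Longrightarrow> w \<in> carrier W \<Longrightarrow> b v w \<in> carrier U"
    and "v \<in> carrier V \<Longrightarrow> v' \<in> carrier V \<Longrightarrow> w \<in> carrier W \<Longrightarrow>
      b (v \<oplus>\<^bsub>V\<^esub> v') w = b v w \<oplus>\<^bsub>U\<^esub> b v' w"
    and "v \<in> carrier V \<Longrightarrow> w \<in> carrier W \<Longrightarrow> w' \<in> carrier W \<Longrightarrow>
      b v (w \<oplus>\<^bsub>W\<^esub> w') = b v w \<oplus>\<^bsub>U\<^esub> b v w'"
    and "c \<in> carrier K \<Longrightarrow> v \<in> carrier V \<Longrightarrow> w \<in> carrier W \<Longrightarrow>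
      b (c \<odot>\<^bsub>V\<^esub> v) w = c \<odot>\<^bsub>U\<^esub> b v w"
    and "c \<in> carrier K \<Longrightarrow> v \<in> carrier V \<Longrightarrow> w \<in> carrier W \<Longrightarrow>
      b v (c \<odot>\<^bsub>W\<^esub> w) = c \<odot>\<^bsub>U\<^esub> b v w"
  using assms by (auto simp: bilinear_def module_hom_def)

locale tensor_product = V: module K V + W: module K W
  for K :: "('k, 'm) ring_scheme" and V :: "('k, 'v, 'n) module_scheme"
    and W :: "('k, 'w, 'p) module_scheme"
begin

abbreviation "F \<equiv> free_module K (carrier V \<times> carrier W)"
abbreviation "N \<equiv> tensor_null K V W"
abbreviation "T \<equiv> tensor K V W"
abbreviation "pure \<equiv> pure_tensor K V W"

sublocale F: module K F
  by (rule free_module_module) (rule V.R.is_cring)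

lemma delta_F: "v \<in> carrier V \<Longrightarrow> w \<in> carrier W \<Longrightarrow> delta K (v, w) \<in> carrier F"
  by (rule delta_closed) (auto intro: V.R.is_cring)

lemma relators_closed: "tensor_relators K V W \<subseteq> carrier F"
  unfolding tensor_relators_def Let_def using delta_F by auto

lemma N_submodule: "submodule K N F"
  unfolding tensor_null_def by (rule F.span_is_submodule[OF relators_closed])

sublocale N: abelian_subgroup N F
  by (rule submodule_abelian_subgroup[OF N_submodule])

sublocale T: module K T
  unfolding tensor_def by (rule quotient_module_module[OF N_submodule])

lemma projection_hom: "(\<lambda>f. N +>\<^bsub>F\<^esub> f) \<in> module_hom K F T"
  unfolding tensor_def by (rule quotient_projection_hom[OF N_submodule])

lemma relators_N: "tensor_relators K V W \<subseteq> N"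
  unfolding tensor_null_def by (rule F.in_own_span[OF relators_closed])

text \<open>Bilinearity puts the relators, and with them \<open>N\<close>, into the kernel of the
  free lift. So the representative picked by \<open>SOME\<close>, which differs from
  \<open>f\<close> by an element of \<open>N\<close>, gives the same value.\<close>

lemma tensor_lift_projection:
  assumes "module K U" "bilinear K V W U b" "f \<in> carrier F"
  shows "tensor_lift K V W U b (N +>\<^bsub>F\<^esub> f) = free_lift K U (\<lambda>p. b (fst p) (snd p)) f"
proof -
  interpret U: module K U by fact
  let ?b = "\<lambda>p. b (fst p) (snd p)"
  note b = bilinearD[OF assms(2)]
  have bc: "?b \<in> carrier V \<times> carrier W \<rightarrow> carrier U" using b(1) by auto
  interpret l: mod_hom K F U "free_lift K U ?b"
    by unfold_locales (rule free_lift_hom[OF assms(1) bc])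
  have d: "free_lift K U ?b (delta K (v, w)) = b v w" if "v \<in> carrier V" "w \<in> carrier W" for v w
    using free_lift_delta[OF assms(1) bc, of "(v, w)"] that by simp
  have "tensor_relators K V W \<subseteq> l.ker"
    unfolding tensor_relators_def Let_def
    by (auto simp: l.ker_def delta_F d b U.r_neg a_minus_def)
  then have NK: "N \<subseteq> l.ker"
    unfolding tensor_null_def by (rule F.span_is_subset[OF _ l.ker_is_submodule])
  have "f \<in> N +>\<^bsub>F\<^esub> f" using assms(3) by (rule N.a_rcos_self)
  then have "(SOME g. g \<in> N +>\<^bsub>F\<^esub> f) \<in> N +>\<^bsub>F\<^esub> f" by (rule someI[of "\<lambda>g. g \<in> N +>\<^bsub>F\<^esub> f"])
  then obtain n where n: "n \<in> N" "(SOME g. g \<in> N +>\<^bsub>F\<^esub> f) = n \<oplus>\<^bsub>F\<^esub> f"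
    by (auto simp: a_r_coset_def')
  have nF: "n \<in> carrier F" using n(1) N.a_subset by blast
  have "free_lift K U ?b n = \<zero>\<^bsub>U\<^esub>" using n(1) NK by (auto simp: l.ker_def)
  then have "free_lift K U ?b (n \<oplus>\<^bsub>F\<^esub> f) = free_lift K U ?b f"
    using nF assms(3) by simp
  then show ?thesis
    by (simp add: tensor_lift_def n(2) free_lift_def)
qed

lemma tensor_rep: "t \<in> carrier T \<Longrightarrow> \<exists>f\<in>carrier F. t = N +>\<^bsub>F\<^esub> f"
  unfolding tensor_def by (rule quotient_module_rep)

lemma pure_closed: "v \<in> carrier V \<Longrightarrow> w \<in> carrier W \<Longrightarrow> pure v w \<in> carrier T"
  unfolding pure_tensor_def using module_hom_closed[OF projection_hom] delta_F by blast

lemma tensor_lift_pure: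
  assumes "module K U" "bilinear K V W U b" "v \<in> carrier V" "w \<in> carrier W"
  shows "tensor_lift K V W U b (pure v w) = b v w"
proof -
  have bc: "(\<lambda>p. b (fst p) (snd p)) \<in> carrier V \<times> carrier W \<rightarrow> carrier U"
    using bilinearD(1)[OF assms(2)] by auto
  show ?thesis
    using tensor_lift_projection[OF assms(1,2) delta_F[OF assms(3,4)]]
      free_lift_delta[OF assms(1) bc, of "(v, w)"] assms(3,4)
    by (simp add: pure_tensor_def)
qed

lemma tensor_lift_hom:
  assumes "module K U" "bilinear K V W U b"
  shows "tensor_lift K V W U b \<in> module_hom K T U"
proof -
  have bc: "(\<lambda>p. b (fst p) (snd p)) \<in> carrier V \<times> carrier W \<rightarrow> carrier U"
    using bilinearD(1)[OF assms(2)] by auto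
  note h = free_lift_hom[OF assms(1) bc]
  note l = tensor_lift_projection[OF assms]
  note p = projection_hom
  have "tensor_lift K V W U b t \<in> carrier U" if "t \<in> carrier T" for t
    using tensor_rep[OF that] l module_hom_closed[OF h] by auto
  moreover have "tensor_lift K V W U b (s \<oplus>\<^bsub>T\<^esub> t) = tensor_lift K V W U b s \<oplus>\<^bsub>U\<^esub> tensor_lift K V W U b t"
    if "s \<in> carrier T" "t \<in> carrier T" for s t
    using tensor_rep[OF that(1)] tensor_rep[OF that(2)]
    by (auto simp: module_hom_add[OF p, symmetric] l module_hom_add[OF h])
  moreover have "tensor_lift K V W U b (c \<odot>\<^bsub>T\<^esub> t) = c \<odot>\<^bsub>U\<^esub> tensor_lift K V W U b t"
    if "c \<in> carrier K" "t \<in> carrier T" for c t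
    using tensor_rep[OF that(2)] that(1)
    by (auto simp: module_hom_smult[OF p, symmetric] l module_hom_smult[OF h])
  ultimately show ?thesis by (auto simp: module_hom_def)
qed

lemma tensor_induct [consumes 1, case_names pure add smult]:
  assumes "t \<in> carrier T"
    and "\<And>v w. v \<in> carrier V \<Longrightarrow> w \<in> carrier W \<Longrightarrow> P (pure v w)"
    and "\<And>s t. s \<in> carrier T \<Longrightarrow> t \<in> carrier T \<Longrightarrow> P s \<Longrightarrow> P t \<Longrightarrow> P (s \<oplus>\<^bsub>T\<^esub> t)"
    and "\<And>c t. c \<in> carrier K \<Longrightarrow> t \<in> carrier T \<Longrightarrow> P t \<Longrightarrow> P (c \<odot>\<^bsub>T\<^esub> t)"
  shows "P t"
proof -
  obtain f where f: "f \<in> carrier F" "t = N +>\<^bsub>F\<^esub> f" using tensor_rep[OF assms(1)] by blast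
  note p = projection_hom
  have pc: "N +>\<^bsub>F\<^esub> f \<in> carrier T" if "f \<in> carrier F" for f
    using module_hom_closed[OF p] that by auto
  have "P (N +>\<^bsub>F\<^esub> f)"
    using V.R.is_cring f(1)
  proof (induction f rule: free_module_induct)
    case zero
    \<comment> \<open>The induction rule offers no case for zero, so zero is reached as a null
      multiple of a pure tensor.\<close>
    have "\<zero>\<^bsub>K\<^esub> \<odot>\<^bsub>T\<^esub> pure \<zero>\<^bsub>V\<^esub> \<zero>\<^bsub>W\<^esub> = N +>\<^bsub>F\<^esub> \<zero>\<^bsub>F\<^esub>"
      by (subst T.smult_l_null) (simp_all add: pure_closed, simp add: tensor_def quotient_module_sel N.a_subset)
    moreover have "P (\<zero>\<^bsub>K\<^esub> \<odot>\<^bsub>T\<^esub> pure \<zero>\<^bsub>V\<^esub> \<zero>\<^bsub>W\<^esub>)"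
      by (intro assms(4) assms(2) pure_closed) auto
    ultimately show ?case by simp
  next
    case (step c x f)
    obtain v w where x: "x = (v, w)" "v \<in> carrier V" "w \<in> carrier W" using step.hyps(2) by auto
    have d: "delta K x \<in> carrier F" using x delta_F by simp
    have "N +>\<^bsub>F\<^esub> (c \<odot>\<^bsub>F\<^esub> delta K x \<oplus>\<^bsub>F\<^esub> f) = c \<odot>\<^bsub>T\<^esub> pure v w \<oplus>\<^bsub>T\<^esub> (N +>\<^bsub>F\<^esub> f)"
      using step.hyps d by (simp add: module_hom_add[OF p] module_hom_smult[OF p] pure_tensor_def x(1))
    moreover have "P (c \<odot>\<^bsub>T\<^esub> pure v w \<oplus>\<^bsub>T\<^esub> (N +>\<^bsub>F\<^esub> f))"
      using step x by (intro assms(3) assms(4) assms(2)) (auto simp: pure_closed pc)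
    ultimately show ?case by simp
  qed
  then show ?thesis using f(2) by simp
qed

text \<open>Pure tensors generate, so linear maps may be compared on them. This is the way in which
  the identities for slices are proved later.\<close>

lemma tensor_hom_eqI:
  assumes "\<phi> \<in> module_hom K T U" "\<psi> \<in> module_hom K T U"
    and "\<And>v w. v \<in> carrier V \<Longrightarrow> w \<in> carrier W \<Longrightarrow> \<phi> (pure v w) = \<psi> (pure v w)"
    and "t \<in> carrier T"
  shows "\<phi> t = \<psi> t"
  using assms(4)
  by (induction t rule: tensor_induct)
    (simp_all add: assms(3) module_hom_add[OF assms(1)] module_hom_add[OF assms(2)]
      module_hom_smult[OF assms(1)] module_hom_smult[OF assms(2)])

lemma pure_bilinear: "bilinear K V W T pure"
proof -
  note p = projection_hom
  have eq: "N +>\<^bsub>F\<^esub> f = N +>\<^bsub>F\<^esub> g" if "f \<ominus>\<^bsub>F\<^esub> g \<in> N" "f \<in> carrier F" "g \<in> carrier F" for f g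
    using N.a_rcos_module_rev[of g f] N.a_repr_independence' that by (simp add: a_minus_def)
  show ?thesis
  proof (rule bilinearI)
    show "pure (v \<oplus>\<^bsub>V\<^esub> v') w = pure v w \<oplus>\<^bsub>T\<^esub> pure v' w"
      if "v \<in> carrier V" "v' \<in> carrier V" "w \<in> carrier W" for v v' w
    proof -
      have "delta K (v \<oplus>\<^bsub>V\<^esub> v', w) \<ominus>\<^bsub>F\<^esub> (delta K (v, w) \<oplus>\<^bsub>F\<^esub> delta K (v', w)) \<in> N"
        using that relators_N unfolding tensor_relators_def Let_def by blast
      from eq[OF this] show ?thesis
        using that by (simp add: delta_F pure_tensor_def module_hom_add[OF p])
    qed
    show "pure v (w \<oplus>\<^bsub>W\<^esub> w') = pure v w \<oplus>\<^bsub>T\<^esub> pure v w'"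
      if "v \<in> carrier V" "w \<in> carrier W" "w' \<in> carrier W" for v w w'
    proof -
      have "delta K (v, w \<oplus>\<^bsub>W\<^esub> w') \<ominus>\<^bsub>F\<^esub> (delta K (v, w) \<oplus>\<^bsub>F\<^esub> delta K (v, w')) \<in> N"
        using that relators_N unfolding tensor_relators_def Let_def by blast
      from eq[OF this] show ?thesis
        using that by (simp add: delta_F pure_tensor_def module_hom_add[OF p])
    qed
    show "pure (c \<odot>\<^bsub>V\<^esub> v) w = c \<odot>\<^bsub>T\<^esub> pure v w"
      if "c \<in> carrier K" "v \<in> carrier V" "w \<in> carrier W" for c v w
    proof -
      have "delta K (c \<odot>\<^bsub>V\<^esub> v, w) \<ominus>\<^bsub>F\<^esub> (c \<odot>\<^bsub>F\<^esub> delta K (v, w)) \<in> N"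
        using that relators_N unfolding tensor_relators_def Let_def by blast
      from eq[OF this] show ?thesis
        using that by (simp add: delta_F pure_tensor_def module_hom_smult[OF p])
    qed
    show "pure v (c \<odot>\<^bsub>W\<^esub> w) = c \<odot>\<^bsub>T\<^esub> pure v w"
      if "c \<in> carrier K" "v \<in> carrier V" "w \<in> carrier W" for c v w
    proof -
      have "delta K (v, c \<odot>\<^bsub>W\<^esub> w) \<ominus>\<^bsub>F\<^esub> (c \<odot>\<^bsub>F\<^esub> delta K (v, w)) \<in> N"
        using that relators_N unfolding tensor_relators_def Let_def by blast
      from eq[OF this] show ?thesis
        using that by (simp add: delta_F pure_tensor_def module_hom_smult[OF p])
    qed
  qed (rule pure_closed)
qed

end

lemma self_module_sel:
    "carrier (self_module K) = carrier K" "\<zero>\<^bsub>self_module K\<^esub> = \<zero>\<^bsub>K\<^esub>"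
    "x \<oplus>\<^bsub>self_module K\<^esub> y = x \<oplus>\<^bsub>K\<^esub> y" "c \<odot>\<^bsub>self_module K\<^esub> x = c \<otimes>\<^bsub>K\<^esub> x"
  by (simp_all add: self_module_def)

lemma self_module_module: "cring K \<Longrightarrow> module K (self_module K)"
proof -
  assume "cring K"
  then interpret cring K .
  show ?thesis
    by (rule module_criteria[OF \<open>cring K\<close>])
      (auto simp: self_module_sel m_assoc l_distr r_distr a_ac intro: r_neg bexI[of _ "a_inv K _"])
qed

lemma module_hom_id: "(\<lambda>x. x) \<in> module_hom K M M"
  by (simp add: module_hom_def)

lemma module_hom_compose:
  "f \<in> module_hom K M N \<Longrightarrow> g \<in> module_hom K N P \<Longrightarrow> (\<lambda>x. g (f x)) \<in> module_hom K M P"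
  by (auto simp: module_hom_def Pi_iff)

lemma module_hom_finsum:
  assumes "module K M" "module K N" "f \<in> module_hom K M N" "finite A" "g \<in> A \<rightarrow> carrier M"
  shows "f (\<Oplus>\<^bsub>M\<^esub>a\<in>A. g a) = (\<Oplus>\<^bsub>N\<^esub>a\<in>A. f (g a))"
proof -
  interpret M: module K M by fact
  interpret N: module K N by fact
  interpret mod_hom K M N f by unfold_locales fact
  have fc: "f x \<in> carrier N" if "x \<in> carrier M" for x using that by simp
  show ?thesis
    using assms(4,5)
  proof (induction A rule: finite_induct)
    case (insert a A)
    then have ga: "g a \<in> carrier M" "g \<in> A \<rightarrow> carrier M" by auto
    then have "(\<Oplus>\<^bsub>N\<^esub>a\<in>insert a A. f (g a)) = f (g a) \<oplus>\<^bsub>N\<^esub> (\<Oplus>\<^bsub>N\<^esub>a\<in>A. f (g a))"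
      using insert.hyps fc by (intro N.finsum_insert) auto
    moreover have "(\<Oplus>\<^bsub>M\<^esub>a\<in>insert a A. g a) = g a \<oplus>\<^bsub>M\<^esub> (\<Oplus>\<^bsub>M\<^esub>a\<in>A. g a)"
      using insert.hyps ga by (intro M.finsum_insert) auto
    ultimately show ?case
      using insert.IH[OF ga(2)] ga by simp
  qed simp
qed

lemma tensor_map_bilinear:
  assumes "f \<in> module_hom K V V'" "g \<in> module_hom K W W'" "module K V'" "module K W'"
  shows "bilinear K V W (tensor K V' W') (\<lambda>v w. pure_tensor K V' W' (f v) (g w))"
proof -
  interpret T': tensor_product K V' W' using assms(3,4) by (rule tensor_product.intro)
  note b = bilinearD[OF T'.pure_bilinear]
  have fc: "f x \<in> carrier V'" if "x \<in> carrier V" for x using module_hom_closed[OF assms(1)] that by auto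
  have gc: "g x \<in> carrier W'" if "x \<in> carrier W" for x using module_hom_closed[OF assms(2)] that by auto
  show ?thesis
    by (rule bilinearI)
      (simp_all add: T'.pure_closed fc gc b module_hom_add[OF assms(1)] module_hom_add[OF assms(2)]
        module_hom_smult[OF assms(1)] module_hom_smult[OF assms(2)])
qed

lemma
  assumes "f \<in> module_hom K V V'" "g \<in> module_hom K W W'"
    and "module K V" "module K W" "module K V'" "module K W'"
  shows tensor_map_hom: "tensor_map K V W V' W' f g \<in> module_hom K (tensor K V W) (tensor K V' W')"
    and tensor_map_pure: "v \<in> carrier V \<Longrightarrow> w \<in> carrier W \<Longrightarrow>
      tensor_map K V W V' W' f g (pure_tensor K V W v w) = pure_tensor K V' W' (f v) (g w)"
proof -
  interpret T: tensor_product K V W using assms(3,4) by (rule tensor_product.intro)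
  interpret T': tensor_product K V' W' using assms(5,6) by (rule tensor_product.intro)
  note b = tensor_map_bilinear[OF assms(1,2,5,6)]
  show "tensor_map K V W V' W' f g \<in> module_hom K (tensor K V W) (tensor K V' W')"
    unfolding tensor_map_def by (rule T.tensor_lift_hom[OF T'.T.module_axioms b])
  show "tensor_map K V W V' W' f g (pure_tensor K V W v w) = pure_tensor K V' W' (f v) (g w)"
    if "v \<in> carrier V" "w \<in> carrier W"
    unfolding tensor_map_def by (rule T.tensor_lift_pure[OF T'.T.module_axioms b that])
qed

text \<open>A lift inside a lift. For fixed \<open>w\<close> the inner one is linear in the tensor
  over \<open>U\<close> and \<open>V\<close>; linearity in \<open>w\<close> compares different lifts
  and is therefore proved by induction on that tensor.\<close>

lemma
  assumes U: "module K U" and V: "module K V" and W: "module K W"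
  shows tensor_assoc_hom: "tensor_assoc K U V W \<in>
      module_hom K (tensor K (tensor K U V) W) (tensor K U (tensor K V W))"
    and tensor_assoc_pure: "u \<in> carrier U \<Longrightarrow> v \<in> carrier V \<Longrightarrow> w \<in> carrier W \<Longrightarrow>
      tensor_assoc K U V W (pure_tensor K (tensor K U V) W (pure_tensor K U V u v) w) =
      pure_tensor K U (tensor K V W) u (pure_tensor K V W v w)"
proof -
  interpret UV: tensor_product K U V using U V by (rule tensor_product.intro)
  interpret VW: tensor_product K V W using V W by (rule tensor_product.intro)
  interpret L: tensor_product K UV.T W using UV.T.module_axioms W by (rule tensor_product.intro)
  interpret R: tensor_product K U VW.T using U VW.T.module_axioms by (rule tensor_product.intro)
  note pb = bilinearD[OF R.pure_bilinear] and pvw = bilinearD[OF VW.pure_bilinear]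
  let ?b = "\<lambda>w u v. R.pure u (VW.pure v w)"
  have b: "bilinear K U V R.T (?b w)" if "w \<in> carrier W" for w
    using that by (intro bilinearI) (simp_all add: R.pure_closed VW.pure_closed pb pvw)
  let ?l = "\<lambda>x w. tensor_lift K U V R.T (?b w) x"
  note lh = UV.tensor_lift_hom[OF R.T.module_axioms b]
  note lp = UV.tensor_lift_pure[OF R.T.module_axioms b]
  have lc: "?l x w \<in> carrier R.T" if "x \<in> carrier UV.T" "w \<in> carrier W" for x w
    using module_hom_closed[OF lh[OF that(2)]] that(1) by auto
  have bl: "bilinear K UV.T W R.T ?l"
  proof (rule bilinearI)
    show "?l x (w \<oplus>\<^bsub>W\<^esub> w') = ?l x w \<oplus>\<^bsub>R.T\<^esub> ?l x w'"
      if "x \<in> carrier UV.T" and w: "w \<in> carrier W" "w' \<in> carrier W" for x w w'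
      using that(1)
    proof (induction x rule: UV.tensor_induct)
      case (pure u v)
      then show ?case using w by (simp add: lp pb pvw VW.pure_closed)
    next
      case (add s t)
      then show ?case using w by (simp add: module_hom_add[OF lh] lc R.T.M.a_ac)
    next
      case (smult c t)
      then show ?case using w by (simp add: module_hom_smult[OF lh] lc R.T.smult_r_distr)
    qed
    show "?l x (c \<odot>\<^bsub>W\<^esub> w) = c \<odot>\<^bsub>R.T\<^esub> ?l x w"
      if c: "c \<in> carrier K" and "x \<in> carrier UV.T" and w: "w \<in> carrier W" for c x w
      using that(2)
    proof (induction x rule: UV.tensor_induct)
      case (pure u v)
      then show ?case using w c by (simp add: lp pb pvw VW.pure_closed)
    next
      case (add s t)
      then show ?case using w c by (simp add: module_hom_add[OF lh] lc R.T.smult_r_distr)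
    next
      case (smult e t)
      then show ?case
        using w c
        by (simp add: module_hom_smult[OF lh] lc R.T.smult_assoc1[symmetric] UV.V.R.m_comm)
    qed
  qed (auto simp: lc module_hom_add[OF lh] module_hom_smult[OF lh])
  show "tensor_assoc K U V W \<in> module_hom K (tensor K (tensor K U V) W) (tensor K U (tensor K V W))"
    unfolding tensor_assoc_def by (rule L.tensor_lift_hom[OF R.T.module_axioms bl])
  show "tensor_assoc K U V W (L.pure (UV.pure u v) w) = R.pure u (VW.pure v w)"
    if "u \<in> carrier U" "v \<in> carrier V" "w \<in> carrier W"
    unfolding tensor_assoc_def using that
    by (subst L.tensor_lift_pure[OF R.T.module_axioms bl]) (simp_all add: lp UV.pure_closed)
qed

text \<open>For fixed \<open>t\<close> the inner lift is the tensor map of two left multiplications.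
  Its bilinear dependence on \<open>a\<close> and \<open>b\<close> is checked by induction on
  \<open>t\<close>.\<close>

lemma
  assumes A: "module K A" and B: "module K B"
    and mA: "bilinear K A A A (monoid.mult A)" and mB: "bilinear K B B B (monoid.mult B)"
    and t: "t \<in> carrier (tensor K A B)"
  shows tensor_mult_hom: "(\<lambda>s. tensor_mult K A B s t) \<in> module_hom K (tensor K A B) (tensor K A B)"
    and tensor_mult_pure: "a \<in> carrier A \<Longrightarrow> b \<in> carrier B \<Longrightarrow>
      tensor_mult K A B (pure_tensor K A B a b) t =
      tensor_map K A B A B (monoid.mult A a) (monoid.mult B b) t"
proof -
  interpret T: tensor_product K A B using A B by (rule tensor_product.intro)
  note pb = bilinearD[OF T.pure_bilinear] and ma = bilinearD[OF mA] and mb = bilinearD[OF mB]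
  let ?l = "\<lambda>a b. tensor_map K A B A B (monoid.mult A a) (monoid.mult B b)"
  have ha: "monoid.mult A a \<in> module_hom K A A" if "a \<in> carrier A" for a
    using mA that by (simp add: bilinear_def)
  have hb: "monoid.mult B b \<in> module_hom K B B" if "b \<in> carrier B" for b
    using mB that by (simp add: bilinear_def)
  note lh = tensor_map_hom[OF ha hb A B A B]
  note lp = tensor_map_pure[OF ha hb A B A B]
  have lc: "?l a b x \<in> carrier T.T" if "a \<in> carrier A" "b \<in> carrier B" "x \<in> carrier T.T" for a b x
    using module_hom_closed[OF lh[OF that(1,2)]] that(3) by auto
  have bl: "bilinear K A B T.T (\<lambda>a b. ?l a b t)"
  proof (rule bilinearI)
    show "?l (a \<oplus>\<^bsub>A\<^esub> a') b t = ?l a b t \<oplus>\<^bsub>T.T\<^esub> ?l a' b t"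
      if a: "a \<in> carrier A" "a' \<in> carrier A" "b \<in> carrier B" for a a' b
      using t
    proof (induction t rule: T.tensor_induct)
      case (pure u v)
      then show ?case using a by (simp add: lp pb ma mb)
    next
      case (add s t)
      then show ?case using a by (simp add: module_hom_add[OF lh] lc T.T.M.a_ac)
    next
      case (smult c t)
      then show ?case using a by (simp add: module_hom_smult[OF lh] lc T.T.smult_r_distr)
    qed
    show "?l a (b \<oplus>\<^bsub>B\<^esub> b') t = ?l a b t \<oplus>\<^bsub>T.T\<^esub> ?l a b' t"
      if a: "a \<in> carrier A" "b \<in> carrier B" "b' \<in> carrier B" for a b b'
      using t
    proof (induction t rule: T.tensor_induct)
      case (pure u v)
      then show ?case using a by (simp add: lp pb ma mb)
    next
      case (add s t)
      then show ?case using a by (simp add: module_hom_add[OF lh] lc T.T.M.a_ac)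
    next
      case (smult c t)
      then show ?case using a by (simp add: module_hom_smult[OF lh] lc T.T.smult_r_distr)
    qed
    show "?l (c \<odot>\<^bsub>A\<^esub> a) b t = c \<odot>\<^bsub>T.T\<^esub> ?l a b t"
      if a: "c \<in> carrier K" "a \<in> carrier A" "b \<in> carrier B" for c a b
      using t
    proof (induction t rule: T.tensor_induct)
      case (pure u v)
      then show ?case using a by (simp add: lp pb ma mb)
    next
      case (add s t)
      then show ?case using a by (simp add: module_hom_add[OF lh] lc T.T.smult_r_distr)
    next
      case (smult e t)
      then show ?case
        using a by (simp add: module_hom_smult[OF lh] lc T.T.smult_assoc1[symmetric] T.V.R.m_comm)
    qed
    show "?l a (c \<odot>\<^bsub>B\<^esub> b) t = c \<odot>\<^bsub>T.T\<^esub> ?l a b t"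
      if a: "c \<in> carrier K" "a \<in> carrier A" "b \<in> carrier B" for c a b
      using t
    proof (induction t rule: T.tensor_induct)
      case (pure u v)
      then show ?case using a by (simp add: lp pb ma mb)
    next
      case (add s t)
      then show ?case using a by (simp add: module_hom_add[OF lh] lc T.T.smult_r_distr)
    next
      case (smult e t)
      then show ?case
        using a by (simp add: module_hom_smult[OF lh] lc T.T.smult_assoc1[symmetric] T.V.R.m_comm)
    qed
  qed (simp add: lc t)
  have eq: "tensor_mult K A B s t = tensor_lift K A B T.T (\<lambda>a b. ?l a b t) s" for s
    by (simp add: tensor_mult_def tensor_map_def)
  show "(\<lambda>s. tensor_mult K A B s t) \<in> module_hom K T.T T.T"
    unfolding eq by (rule T.tensor_lift_hom[OF T.T.module_axioms bl])
  show "tensor_mult K A B (T.pure a b) t = ?l a b t" if "a \<in> carrier A" "b \<in> carrier B"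
    unfolding eq by (rule T.tensor_lift_pure[OF T.T.module_axioms bl that])
qed

section \<open>Slices and coordinates of a bialgebra\<close>

context bialgebra
begin

sublocale HH: tensor_product K H H
  by unfold_locales

definition forms :: "('a \<Rightarrow> 'k) set"
  where "forms = module_hom K H (self_module K)"

lemma form_closed: "\<phi> \<in> forms \<Longrightarrow> x \<in> carrier H \<Longrightarrow> \<phi> x \<in> carrier K"
  and form_add: "\<phi> \<in> forms \<Longrightarrow> x \<in> carrier H \<Longrightarrow> y \<in> carrier H \<Longrightarrow> \<phi> (x \<oplus>\<^bsub>H\<^esub> y) = \<phi> x \<oplus>\<^bsub>K\<^esub> \<phi> y"
  and form_smult: "\<phi> \<in> forms \<Longrightarrow> c \<in> carrier K \<Longrightarrow> x \<in> carrier H \<Longrightarrow> \<phi> (c \<odot>\<^bsub>H\<^esub> x) = c \<otimes>\<^bsub>K\<^esub> \<phi> x"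
  by (auto simp: forms_def module_hom_def self_module_sel)

lemma counit_form: "counit H \<in> forms"
  using counit_linear by (simp add: forms_def)

lemma mult_hom_left: "x \<in> carrier H \<Longrightarrow> monoid.mult H x \<in> module_hom K H H"
  and mult_hom_right: "y \<in> carrier H \<Longrightarrow> (\<lambda>x. x \<otimes>\<^bsub>H\<^esub> y) \<in> module_hom K H H"
  by (auto simp: module_hom_def smult_mult_left smult_mult_right alg.l_distr alg.r_distr)

lemma mult_bilinear: "bilinear K H H H (monoid.mult H)"
  by (simp add: bilinear_def mult_hom_left mult_hom_right)

lemma form_mult_left: "\<phi> \<in> forms \<Longrightarrow> x \<in> carrier H \<Longrightarrow> (\<lambda>v. \<phi> (x \<otimes>\<^bsub>H\<^esub> v)) \<in> forms"
  unfolding forms_def by (rule module_hom_compose[OF mult_hom_left])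

text \<open>These are \<phi> \<otimes> id and, for \<open>rslice\<close>, id \<otimes> \<phi>;
  composed with the comultiplication they become the operators \<open>L\<close> and
  \<open>R\<close>.\<close>

definition lslice :: "('a \<Rightarrow> 'k) \<Rightarrow> ('a \<times> 'a \<Rightarrow> 'k) set \<Rightarrow> 'a"
  where "lslice \<phi> = tensor_lift K H H H (\<lambda>a b. \<phi> a \<odot>\<^bsub>H\<^esub> b)"

definition rslice :: "('a \<Rightarrow> 'k) \<Rightarrow> ('a \<times> 'a \<Rightarrow> 'k) set \<Rightarrow> 'a"
  where "rslice \<phi> = tensor_lift K H H H (\<lambda>a b. \<phi> b \<odot>\<^bsub>H\<^esub> a)"

lemma lslice_bilinear: "\<phi> \<in> forms \<Longrightarrow> bilinear K H H H (\<lambda>a b. \<phi> a \<odot>\<^bsub>H\<^esub> b)"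
  by (rule bilinearI)
    (simp_all add: form_closed form_add form_smult smult_l_distr smult_r_distr
      smult_assoc1[symmetric] R.m_comm)

lemma rslice_bilinear: "\<phi> \<in> forms \<Longrightarrow> bilinear K H H H (\<lambda>a b. \<phi> b \<odot>\<^bsub>H\<^esub> a)"
  by (rule bilinearI)
    (simp_all add: form_closed form_add form_smult smult_l_distr smult_r_distr
      smult_assoc1[symmetric] R.m_comm)

lemma lslice_hom: "\<phi> \<in> forms \<Longrightarrow> lslice \<phi> \<in> module_hom K HH.T H"
  and lslice_pure: "\<phi> \<in> forms \<Longrightarrow> a \<in> carrier H \<Longrightarrow> b \<in> carrier H \<Longrightarrow>
    lslice \<phi> (HH.pure a b) = \<phi> a \<odot>\<^bsub>H\<^esub> b"
  and rslice_hom: "\<phi> \<in> forms \<Longrightarrow> rslice \<phi> \<in> module_hom K HH.T H"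
  and rslice_pure: "\<phi> \<in> forms \<Longrightarrow> a \<in> carrier H \<Longrightarrow> b \<in> carrier H \<Longrightarrow>
    rslice \<phi> (HH.pure a b) = \<phi> b \<odot>\<^bsub>H\<^esub> a"
  unfolding lslice_def rslice_def
  by (simp_all add: HH.tensor_lift_hom HH.tensor_lift_pure module_axioms lslice_bilinear rslice_bilinear)

lemma lslice_closed: "\<phi> \<in> forms \<Longrightarrow> t \<in> carrier HH.T \<Longrightarrow> lslice \<phi> t \<in> carrier H"
  and rslice_closed: "\<phi> \<in> forms \<Longrightarrow> t \<in> carrier HH.T \<Longrightarrow> rslice \<phi> t \<in> carrier H"
  using module_hom_closed[OF lslice_hom] module_hom_closed[OF rslice_hom] by blast+

lemma comult_closed [simp]: "x \<in> carrier H \<Longrightarrow> comult H x \<in> carrier HH.T"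
  using module_hom_closed[OF comult_linear] by blast

text \<open>Both sides are \<psi> \<otimes> \<phi>, evaluated in the two possible orders; in
  coordinates this becomes \<open>L_R_dual\<close>.\<close>

lemma form_slice:
  assumes "\<phi> \<in> forms" "\<psi> \<in> forms" "t \<in> carrier HH.T"
  shows "\<phi> (lslice \<psi> t) = \<psi> (rslice \<phi> t)"
proof (rule HH.tensor_hom_eqI[OF _ _ _ assms(3)])
  show "(\<lambda>t. \<phi> (lslice \<psi> t)) \<in> module_hom K HH.T (self_module K)"
    by (rule module_hom_compose[OF lslice_hom]) (use assms in \<open>auto simp: forms_def\<close>)
  show "(\<lambda>t. \<psi> (rslice \<phi> t)) \<in> module_hom K HH.T (self_module K)"
    by (rule module_hom_compose[OF rslice_hom]) (use assms in \<open>auto simp: forms_def\<close>)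
  show "\<phi> (lslice \<psi> (HH.pure v w)) = \<psi> (rslice \<phi> (HH.pure v w))"
    if "v \<in> carrier H" "w \<in> carrier H" for v w
    using assms that by (simp add: lslice_pure rslice_pure form_smult form_closed R.m_comm)
qed

text \<open>Both composites apply \<psi> \<otimes> id \<otimes> \<phi> to the twofold coproduct of
  \<open>x\<close>, bracketed in the two ways that coassociativity identifies.\<close>

lemma slices_commute:
  assumes \<phi>: "\<phi> \<in> forms" and \<psi>: "\<psi> \<in> forms" and x: "x \<in> carrier H"
  shows "rslice \<phi> (comult H (lslice \<psi> (comult H x))) = lslice \<psi> (comult H (rslice \<phi> (comult H x)))"
proof -
  interpret L: tensor_product K HH.T H by unfold_locales
  interpret R: tensor_product K H HH.T by unfold_locales
  note c = comult_linear
  \<comment> \<open>The map \<psi> \<otimes> id \<otimes> \<phi> for the bracketing H \<otimes> (H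
    \<otimes> H); the other bracketing reaches it through the associator.\<close>
  define \<Lambda> where "\<Lambda> = tensor_lift K H HH.T H (\<lambda>a s. \<psi> a \<odot>\<^bsub>H\<^esub> rslice \<phi> s)"
  have bl: "bilinear K H HH.T H (\<lambda>a s. \<psi> a \<odot>\<^bsub>H\<^esub> rslice \<phi> s)"
    using \<psi> module_hom_add[OF rslice_hom[OF \<phi>]] module_hom_smult[OF rslice_hom[OF \<phi>]]
    by (intro bilinearI)
      (simp_all add: form_closed form_add form_smult smult_l_distr smult_r_distr rslice_closed \<phi>
        smult_assoc1[symmetric] R.m_comm)
  have Lh: "\<Lambda> \<in> module_hom K R.T H" unfolding \<Lambda>_def by (rule R.tensor_lift_hom[OF module_axioms bl])
  have Lp: "\<Lambda> (R.pure a s) = \<psi> a \<odot>\<^bsub>H\<^esub> rslice \<phi> s" if "a \<in> carrier H" "s \<in> carrier HH.T" for a s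
    unfolding \<Lambda>_def by (rule R.tensor_lift_pure[OF module_axioms bl that])
  let ?l = "tensor_map K H H HH.T H (comult H) (\<lambda>b. b)"
    and ?r = "tensor_map K H H H HH.T (\<lambda>a. a) (comult H)"
  have lh: "?l \<in> module_hom K HH.T L.T"
    by (rule tensor_map_hom[OF c module_hom_id]) unfold_locales
  have lp: "?l (HH.pure a b) = L.pure (comult H a) b" if "a \<in> carrier H" "b \<in> carrier H" for a b
    by (rule tensor_map_pure[OF c module_hom_id]) (unfold_locales, use that in auto)
  have rh: "?r \<in> module_hom K HH.T R.T"
    by (rule tensor_map_hom[OF module_hom_id c]) unfold_locales
  have rp: "?r (HH.pure a b) = R.pure a (comult H b)" if "a \<in> carrier H" "b \<in> carrier H" for a b
    by (rule tensor_map_pure[OF module_hom_id c]) (unfold_locales, use that in auto)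
  let ?a = "tensor_assoc K H H H"
  have ah: "?a \<in> module_hom K L.T R.T" by (rule tensor_assoc_hom) unfold_locales
  have ap: "?a (L.pure (HH.pure u v) w) = R.pure u (HH.pure v w)"
    if "u \<in> carrier H" "v \<in> carrier H" "w \<in> carrier H" for u v w
    by (rule tensor_assoc_pure) (unfold_locales, use that in auto)
  have inner: "\<Lambda> (?a (L.pure s b)) = \<phi> b \<odot>\<^bsub>H\<^esub> lslice \<psi> s"
    if b: "b \<in> carrier H" and s: "s \<in> carrier HH.T" for b s
  proof (rule HH.tensor_hom_eqI[OF _ _ _ s])
    have "(\<lambda>s. L.pure s b) \<in> module_hom K HH.T L.T"
      using L.pure_bilinear b by (simp add: bilinear_def)
    then show "(\<lambda>s. \<Lambda> (?a (L.pure s b))) \<in> module_hom K HH.T H"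
      by (intro module_hom_compose[OF _ Lh] module_hom_compose[OF _ ah])
    show "(\<lambda>s. \<phi> b \<odot>\<^bsub>H\<^esub> lslice \<psi> s) \<in> module_hom K HH.T H"
      using \<phi> \<psi> b module_hom_add[OF lslice_hom[OF \<psi>]] module_hom_smult[OF lslice_hom[OF \<psi>]]
      by (auto simp: module_hom_def lslice_closed form_closed smult_r_distr smult_assoc1[symmetric]
          R.m_comm)
    show "\<Lambda> (?a (L.pure (HH.pure v w) b)) = \<phi> b \<odot>\<^bsub>H\<^esub> lslice \<psi> (HH.pure v w)"
      if "v \<in> carrier H" "w \<in> carrier H" for v w
      using that b \<phi> \<psi>
      by (simp add: ap Lp HH.pure_closed rslice_pure lslice_pure form_closed smult_assoc1[symmetric]
          R.m_comm)
  qed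
  let ?c = "comult H x"
  have "lslice \<psi> (comult H (rslice \<phi> ?c)) = \<Lambda> (?a (?l ?c))"
  proof (rule HH.tensor_hom_eqI[OF _ _ _ comult_closed[OF x], where \<phi> = "\<lambda>t. lslice \<psi> (comult H (rslice \<phi> t))"])
    show "(\<lambda>t. lslice \<psi> (comult H (rslice \<phi> t))) \<in> module_hom K HH.T H"
      by (intro module_hom_compose[OF _ lslice_hom[OF \<psi>]] module_hom_compose[OF _ c] rslice_hom \<phi>)
    show "(\<lambda>t. \<Lambda> (?a (?l t))) \<in> module_hom K HH.T H"
      by (intro module_hom_compose[OF _ Lh] module_hom_compose[OF _ ah] lh)
    show "lslice \<psi> (comult H (rslice \<phi> (HH.pure v w))) = \<Lambda> (?a (?l (HH.pure v w)))"
      if "v \<in> carrier H" "w \<in> carrier H" for v w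
      using that \<phi> \<psi>
      by (simp add: rslice_pure lp inner module_hom_smult[OF c] module_hom_smult[OF lslice_hom] form_closed)
  qed
  also have "?a (?l ?c) = ?r ?c" by (rule coassoc[OF x])
  also have "\<Lambda> (?r ?c) = rslice \<phi> (comult H (lslice \<psi> ?c))"
  proof (rule HH.tensor_hom_eqI[OF _ _ _ comult_closed[OF x], where \<phi> = "\<lambda>t. \<Lambda> (?r t)"])
    show "(\<lambda>t. rslice \<phi> (comult H (lslice \<psi> t))) \<in> module_hom K HH.T H"
      by (intro module_hom_compose[OF _ rslice_hom[OF \<phi>]] module_hom_compose[OF _ c] lslice_hom \<psi>)
    show "(\<lambda>t. \<Lambda> (?r t)) \<in> module_hom K HH.T H"
      by (intro module_hom_compose[OF _ Lh] rh)
    show "\<Lambda> (?r (HH.pure v w)) = rslice \<phi> (comult H (lslice \<psi> (HH.pure v w)))"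
      if "v \<in> carrier H" "w \<in> carrier H" for v w
      using that \<phi> \<psi>
      by (simp add: lslice_pure rp Lp module_hom_smult[OF c] module_hom_smult[OF rslice_hom] form_closed)
  qed
  finally show ?thesis by simp
qed

lemma lslice_tensor_map:
  assumes \<phi>: "\<phi> \<in> forms" and ab: "a \<in> carrier H" "b \<in> carrier H" and t: "t \<in> carrier HH.T"
  shows "lslice \<phi> (tensor_map K H H H H (monoid.mult H a) (monoid.mult H b) t)
    = b \<otimes>\<^bsub>H\<^esub> lslice (\<lambda>v. \<phi> (a \<otimes>\<^bsub>H\<^esub> v)) t"
proof (rule HH.tensor_hom_eqI[OF _ _ _ t])
  let ?m = "tensor_map K H H H H (monoid.mult H a) (monoid.mult H b)"
  note m = mult_hom_left[OF ab(1)] mult_hom_left[OF ab(2)]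
  have mh: "?m \<in> module_hom K HH.T HH.T" by (rule tensor_map_hom[OF m]) unfold_locales
  have mp: "?m (HH.pure v w) = HH.pure (a \<otimes>\<^bsub>H\<^esub> v) (b \<otimes>\<^bsub>H\<^esub> w)"
    if "v \<in> carrier H" "w \<in> carrier H" for v w
    by (rule tensor_map_pure[OF m]) (unfold_locales, use that in auto)
  note f = form_mult_left[OF \<phi> ab(1)]
  show "(\<lambda>t. lslice \<phi> (?m t)) \<in> module_hom K HH.T H"
    by (intro module_hom_compose[OF mh] lslice_hom \<phi>)
  show "(\<lambda>t. b \<otimes>\<^bsub>H\<^esub> lslice (\<lambda>v. \<phi> (a \<otimes>\<^bsub>H\<^esub> v)) t) \<in> module_hom K HH.T H"
    by (intro module_hom_compose[OF lslice_hom[OF f]] m(2))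
  show "lslice \<phi> (?m (HH.pure v w)) = b \<otimes>\<^bsub>H\<^esub> lslice (\<lambda>v. \<phi> (a \<otimes>\<^bsub>H\<^esub> v)) (HH.pure v w)"
    if "v \<in> carrier H" "w \<in> carrier H" for v w
    using that ab \<phi> by (simp add: mp lslice_pure f form_closed smult_mult_right)
qed

end

text \<open>The basis is a parameter because two are in use: an arbitrary one at the start, and the
  group-likes once they are known to span.\<close>

locale based_bialgebra = bialgebra K H
  for K :: "('k, 'm) ring_scheme" and H :: "('k, 'a, 'n) hopf_scheme" +
  fixes B :: "'a set" and coord :: "'a \<Rightarrow> 'a \<Rightarrow> 'k"
  assumes finite_B: "finite B" and B_H: "B \<subseteq> carrier H"
    and coord_form: "b \<in> B \<Longrightarrow> coord b \<in> forms"
    and coord_B: "b \<in> B \<Longrightarrow> b' \<in> B \<Longrightarrow> coord b b' = (if b = b' then \<one>\<^bsub>K\<^esub> else \<zero>\<^bsub>K\<^esub>)"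
    and coord_expand: "x \<in> carrier H \<Longrightarrow> x = (\<Oplus>\<^bsub>H\<^esub>b\<in>B. coord b x \<odot>\<^bsub>H\<^esub> b)"
begin

lemma B_closed: "b \<in> B \<Longrightarrow> b \<in> carrier H"
  using B_H by blast

lemma finsum_hom:
  assumes "\<And>b. b \<in> B \<Longrightarrow> g b \<in> module_hom K M U" "module K U"
  shows "(\<lambda>t. \<Oplus>\<^bsub>U\<^esub>b\<in>B. g b t) \<in> module_hom K M U"
proof -
  interpret U: module K U by fact
  have cl: "g b t \<in> carrier U" if "b \<in> B" "t \<in> carrier M" for b t
    using module_hom_closed[OF assms(1)] that by blast
  have "(\<Oplus>\<^bsub>U\<^esub>b\<in>B. g b (s \<oplus>\<^bsub>M\<^esub> t)) = (\<Oplus>\<^bsub>U\<^esub>b\<in>B. g b s) \<oplus>\<^bsub>U\<^esub> (\<Oplus>\<^bsub>U\<^esub>b\<in>B. g b t)"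
    if "s \<in> carrier M" "t \<in> carrier M" for s t
  proof -
    have "(\<Oplus>\<^bsub>U\<^esub>b\<in>B. g b (s \<oplus>\<^bsub>M\<^esub> t)) = (\<Oplus>\<^bsub>U\<^esub>b\<in>B. g b s \<oplus>\<^bsub>U\<^esub> g b t)"
      using that cl by (intro U.finsum_cong') (auto simp: module_hom_add[OF assms(1)])
    then show ?thesis using that cl by (simp add: U.finsum_addf Pi_iff)
  qed
  moreover have "(\<Oplus>\<^bsub>U\<^esub>b\<in>B. g b (c \<odot>\<^bsub>M\<^esub> t)) = c \<odot>\<^bsub>U\<^esub> (\<Oplus>\<^bsub>U\<^esub>b\<in>B. g b t)"
    if "c \<in> carrier K" "t \<in> carrier M" for c t
  proof -
    have "(\<Oplus>\<^bsub>U\<^esub>b\<in>B. g b (c \<odot>\<^bsub>M\<^esub> t)) = (\<Oplus>\<^bsub>U\<^esub>b\<in>B. c \<odot>\<^bsub>U\<^esub> g b t)"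
      using that cl by (intro U.finsum_cong') (auto simp: module_hom_smult[OF assms(1)])
    then show ?thesis using that cl finite_B by (simp add: U.finsum_smult_ldistr Pi_iff)
  qed
  ultimately show ?thesis using cl by (auto simp: module_hom_def intro!: U.M.finsum_closed)
qed

text \<open>When left factors are expanded in the basis, the coefficient of \<open>b\<close> is the
  slice along its coordinate form.\<close>

lemma tensor_expand_left:
  assumes "t \<in> carrier HH.T"
  shows "t = (\<Oplus>\<^bsub>HH.T\<^esub>b\<in>B. HH.pure b (lslice (coord b) t))"
proof (rule HH.tensor_hom_eqI[OF module_hom_id _ _ assms])
  have "HH.pure b \<in> module_hom K H HH.T" if "b \<in> B" for b
    using HH.pure_bilinear B_closed[OF that] by (simp add: bilinear_def)
  then show "(\<lambda>t. \<Oplus>\<^bsub>HH.T\<^esub>b\<in>B. HH.pure b (lslice (coord b) t)) \<in> module_hom K HH.T HH.T"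
    by (intro finsum_hom HH.T.module_axioms module_hom_compose[OF lslice_hom]) (auto simp: coord_form)
  fix v w assume v: "v \<in> carrier H" and w: "w \<in> carrier H"
  have p: "(\<lambda>v. HH.pure v w) \<in> module_hom K H HH.T"
    using HH.pure_bilinear w by (simp add: bilinear_def)
  have "HH.pure v w = HH.pure (\<Oplus>\<^bsub>H\<^esub>b\<in>B. coord b v \<odot>\<^bsub>H\<^esub> b) w"
    using coord_expand[OF v] by simp
  also have "\<dots> = (\<Oplus>\<^bsub>HH.T\<^esub>b\<in>B. HH.pure (coord b v \<odot>\<^bsub>H\<^esub> b) w)"
    using v by (intro module_hom_finsum[OF _ _ p finite_B])
      (auto simp: module_axioms HH.T.module_axioms B_closed form_closed coord_form)
  also have "\<dots> = (\<Oplus>\<^bsub>HH.T\<^esub>b\<in>B. HH.pure b (lslice (coord b) (HH.pure v w)))"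
    using v w
    by (intro HH.T.M.finsum_cong')
      (auto simp: B_closed form_closed coord_form HH.pure_closed lslice_pure
        bilinearD(4,5)[OF HH.pure_bilinear])
  finally show "HH.pure v w = (\<Oplus>\<^bsub>HH.T\<^esub>b\<in>B. HH.pure b (lslice (coord b) (HH.pure v w)))" .
qed

lemma tensor_expand_right:
  assumes "t \<in> carrier HH.T"
  shows "t = (\<Oplus>\<^bsub>HH.T\<^esub>b\<in>B. HH.pure (rslice (coord b) t) b)"
proof (rule HH.tensor_hom_eqI[OF module_hom_id _ _ assms])
  have "(\<lambda>a. HH.pure a b) \<in> module_hom K H HH.T" if "b \<in> B" for b
    using HH.pure_bilinear B_closed[OF that] by (simp add: bilinear_def)
  then show "(\<lambda>t. \<Oplus>\<^bsub>HH.T\<^esub>b\<in>B. HH.pure (rslice (coord b) t) b) \<in> module_hom K HH.T HH.T"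
    by (intro finsum_hom HH.T.module_axioms module_hom_compose[OF rslice_hom]) (auto simp: coord_form)
  fix v w assume v: "v \<in> carrier H" and w: "w \<in> carrier H"
  have p: "HH.pure v \<in> module_hom K H HH.T"
    using HH.pure_bilinear v by (simp add: bilinear_def)
  have "HH.pure v w = HH.pure v (\<Oplus>\<^bsub>H\<^esub>b\<in>B. coord b w \<odot>\<^bsub>H\<^esub> b)"
    using coord_expand[OF w] by simp
  also have "\<dots> = (\<Oplus>\<^bsub>HH.T\<^esub>b\<in>B. HH.pure v (coord b w \<odot>\<^bsub>H\<^esub> b))"
    using w by (intro module_hom_finsum[OF _ _ p finite_B])
      (auto simp: module_axioms HH.T.module_axioms B_closed form_closed coord_form)
  also have "\<dots> = (\<Oplus>\<^bsub>HH.T\<^esub>b\<in>B. HH.pure (rslice (coord b) (HH.pure v w)) b)"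
    using v w
    by (intro HH.T.M.finsum_cong')
      (auto simp: B_closed form_closed coord_form HH.pure_closed rslice_pure
        bilinearD(4,5)[OF HH.pure_bilinear])
  finally show "HH.pure v w = (\<Oplus>\<^bsub>HH.T\<^esub>b\<in>B. HH.pure (rslice (coord b) (HH.pure v w)) b)" .
qed

text \<open>Expanding the left factors of the coproduct of \<open>x\<close> reduces the product of
  tensors to left multiplications by basis elements. In coordinates this is the axiom
  \<open>L_mul\<close>.\<close>

lemma lslice_comult_mult:
  assumes \<phi>: "\<phi> \<in> forms" and x: "x \<in> carrier H" and y: "y \<in> carrier H"
  shows "lslice \<phi> (comult H (x \<otimes>\<^bsub>H\<^esub> y)) =
    (\<Oplus>\<^bsub>H\<^esub>b\<in>B. lslice (coord b) (comult H x) \<otimes>\<^bsub>H\<^esub> lslice (\<lambda>v. \<phi> (b \<otimes>\<^bsub>H\<^esub> v)) (comult H y))"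
proof -
  let ?x = "\<lambda>b. lslice (coord b) (comult H x)"
  have xc: "?x b \<in> carrier H" if "b \<in> B" for b using that x by (simp add: lslice_closed coord_form)
  have tm: "(\<lambda>s. tensor_mult K H H s (comult H y)) \<in> module_hom K HH.T HH.T"
    and tp: "\<And>a b. a \<in> carrier H \<Longrightarrow> b \<in> carrier H \<Longrightarrow> tensor_mult K H H (HH.pure a b) (comult H y) =
      tensor_map K H H H H (monoid.mult H a) (monoid.mult H b) (comult H y)"
    using tensor_mult_hom[OF _ _ mult_bilinear mult_bilinear] tensor_mult_pure[OF _ _ mult_bilinear mult_bilinear]
      y module_axioms by auto
  have h: "(\<lambda>s. lslice \<phi> (tensor_mult K H H s (comult H y))) \<in> module_hom K HH.T H"
    by (rule module_hom_compose[OF tm lslice_hom[OF \<phi>]])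
  have "lslice \<phi> (comult H (x \<otimes>\<^bsub>H\<^esub> y))
      = lslice \<phi> (tensor_mult K H H (\<Oplus>\<^bsub>HH.T\<^esub>b\<in>B. HH.pure b (?x b)) (comult H y))"
    using tensor_expand_left[OF comult_closed[OF x]] comult_mult[OF x y] by simp
  also have "\<dots> = (\<Oplus>\<^bsub>H\<^esub>b\<in>B. lslice \<phi> (tensor_mult K H H (HH.pure b (?x b)) (comult H y)))"
    by (rule module_hom_finsum[OF HH.T.module_axioms module_axioms h finite_B])
      (auto simp: HH.pure_closed B_closed xc)
  also have "\<dots> = (\<Oplus>\<^bsub>H\<^esub>b\<in>B. ?x b \<otimes>\<^bsub>H\<^esub> lslice (\<lambda>v. \<phi> (b \<otimes>\<^bsub>H\<^esub> v)) (comult H y))"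
    using y by (intro finsum_cong')
      (auto simp: tp B_closed xc lslice_tensor_map \<phi> lslice_closed form_mult_left)
  finally show ?thesis .
qed

end

lemma (in bialgebra) ex_basis_coordinates:
  assumes "fin_dim"
  shows "\<exists>B coord. based_bialgebra K H B coord"
proof -
  obtain B where B: "finite B" "basis B" using finite_basis_exists[OF assms] by blast
  then have BH: "B \<subseteq> carrier H" by (simp add: basis_def)
  have ex: "\<exists>!a. a \<in> B \<rightarrow>\<^sub>E carrier K \<and> lincomb a B = v" if "v \<in> carrier H" for v
    using basis_criterion[OF B(1) BH] B(2) that by simp
  define cf where "cf v = (THE a. a \<in> B \<rightarrow>\<^sub>E carrier K \<and> lincomb a B = v)" for v
  have cf: "cf v \<in> B \<rightarrow>\<^sub>E carrier K" "lincomb (cf v) B = v" if "v \<in> carrier H" for v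
    using theI'[OF ex[OF that]] by (simp_all add: cf_def)
  have cfc: "cf v b \<in> carrier K" if "v \<in> carrier H" "b \<in> B" for v b using cf(1)[OF that(1)] that(2) by auto
  have cf_eq: "cf v b = a b" if "v \<in> carrier H" "a \<in> B \<rightarrow> carrier K" "lincomb a B = v" "b \<in> B" for v a b
  proof -
    have "restrict a B \<in> B \<rightarrow>\<^sub>E carrier K" using that(2) by auto
    moreover have "lincomb (restrict a B) B = v"
      using that(2,3) BH unfolding lincomb_def
      by (subst finsum_cong'[where g = "\<lambda>b. a b \<odot>\<^bsub>H\<^esub> b" and B = B]) auto
    ultimately have "cf v = restrict a B" using ex[OF that(1)] cf[OF that(1)] by blast
    then show ?thesis using that(4) by simp
  qed
  have "based_bialgebra K H B (\<lambda>b v. cf v b)"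
  proof
    show "finite B" "B \<subseteq> carrier H" by fact+
    show "(\<lambda>v. cf v b) \<in> forms" if b: "b \<in> B" for b
    proof -
      have "cf (v \<oplus>\<^bsub>H\<^esub> w) b = cf v b \<oplus>\<^bsub>K\<^esub> cf w b" if v: "v \<in> carrier H" "w \<in> carrier H" for v w
      proof (rule cf_eq)
        have "lincomb (\<lambda>b. cf v b \<oplus>\<^bsub>K\<^esub> cf w b) B = (\<Oplus>\<^bsub>H\<^esub>b\<in>B. cf v b \<odot>\<^bsub>H\<^esub> b \<oplus>\<^bsub>H\<^esub> cf w b \<odot>\<^bsub>H\<^esub> b)"
          unfolding lincomb_def using v BH cfc
          by (intro finsum_cong') (auto simp: smult_l_distr subset_iff)
        also have "\<dots> = lincomb (cf v) B \<oplus>\<^bsub>H\<^esub> lincomb (cf w) B"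
          unfolding lincomb_def using v BH cfc by (intro finsum_addf) auto
        finally show "lincomb (\<lambda>b. cf v b \<oplus>\<^bsub>K\<^esub> cf w b) B = v \<oplus>\<^bsub>H\<^esub> w" using cf v by simp
      qed (use v b cfc in auto)
      moreover have "cf (c \<odot>\<^bsub>H\<^esub> v) b = c \<otimes>\<^bsub>K\<^esub> cf v b" if v: "v \<in> carrier H" and c: "c \<in> carrier K" for v c
      proof (rule cf_eq)
        have "lincomb (\<lambda>b. c \<otimes>\<^bsub>K\<^esub> cf v b) B = (\<Oplus>\<^bsub>H\<^esub>b\<in>B. c \<odot>\<^bsub>H\<^esub> (cf v b \<odot>\<^bsub>H\<^esub> b))"
          unfolding lincomb_def using v c BH cfc
          by (intro finsum_cong') (auto simp: smult_assoc1 subset_iff)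
        also have "\<dots> = c \<odot>\<^bsub>H\<^esub> lincomb (cf v) B"
          unfolding lincomb_def using v c BH cfc B(1) by (intro finsum_smult_ldistr[symmetric]) auto
        finally show "lincomb (\<lambda>b. c \<otimes>\<^bsub>K\<^esub> cf v b) B = c \<odot>\<^bsub>H\<^esub> v" using cf v by simp
      qed (use v c b cfc in auto)
      ultimately show ?thesis
        using b cfc by (auto simp: forms_def module_hom_def self_module_sel)
    qed
    show "cf b' b = (if b = b' then \<one>\<^bsub>K\<^esub> else \<zero>\<^bsub>K\<^esub>)" if b: "b \<in> B" "b' \<in> B" for b b'
    proof (rule cf_eq)
      have "lincomb (\<lambda>b. if b = b' then \<one>\<^bsub>K\<^esub> else \<zero>\<^bsub>K\<^esub>) B = (\<Oplus>\<^bsub>H\<^esub>b\<in>B. if b' = b then b else \<zero>\<^bsub>H\<^esub>)"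
        unfolding lincomb_def using BH by (intro finsum_cong') (auto simp: subset_iff)
      also have "\<dots> = b'" using b BH B(1) by (intro M.add.finprod_singleton) auto
      finally show "lincomb (\<lambda>b. if b = b' then \<one>\<^bsub>K\<^esub> else \<zero>\<^bsub>K\<^esub>) B = b'" .
    qed (use b BH in auto)
    show "x = (\<Oplus>\<^bsub>H\<^esub>b\<in>B. cf x b \<odot>\<^bsub>H\<^esub> b)" if "x \<in> carrier H" for x
      using cf(2)[OF that] by (simp add: lincomb_def)
  qed
  then show ?thesis by blast
qed

section \<open>Transport to coordinate functions over the complex numbers\<close>

definition fscale :: "complex \<Rightarrow> ('h \<Rightarrow> complex) \<Rightarrow> 'h \<Rightarrow> complex"
  where "fscale c u = (\<lambda>b. c * u b)"

interpretation fs: linear_space fscale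
  by unfold_locales (auto simp: fscale_def algebra_simps)

lemma complex_field_sel [simp]:
    "carrier complex_field = UNIV" "x \<oplus>\<^bsub>complex_field\<^esub> y = x + y" "x \<otimes>\<^bsub>complex_field\<^esub> y = x * y"
    "\<zero>\<^bsub>complex_field\<^esub> = 0" "\<one>\<^bsub>complex_field\<^esub> = 1"
  by (simp_all add: ring_of_type_algebra_def)

lemma submodule_finsum:
  assumes "submodule K N M" "finite A" "\<And>a. a \<in> A \<Longrightarrow> f a \<in> N"
  shows "(\<Oplus>\<^bsub>M\<^esub>a\<in>A. f a) \<in> N"
proof -
  interpret N: submodule K N M by fact
  interpret module K M by (rule N.module)
  show ?thesis
    using assms(2,3)
  proof (induction A rule: finite_induct)
    case (insert a A)
    then have "f \<in> A \<rightarrow> carrier M" "f a \<in> carrier M" using N.subset by auto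
    then have "(\<Oplus>\<^bsub>M\<^esub>a\<in>insert a A. f a) = f a \<oplus>\<^bsub>M\<^esub> (\<Oplus>\<^bsub>M\<^esub>a\<in>A. f a)"
      using insert.hyps by (intro M.finsum_insert)
    then show ?case using submodule.m_closed[OF assms(1)] insert by simp
  qed (simp add: submodule.zero_closed[OF assms(1)])
qed

lemma (in vectorspace) dim_1_line:
  assumes "fin_dim" "dim = 1"
  shows "\<exists>v\<in>carrier V. \<forall>x\<in>carrier V. \<exists>c\<in>carrier K. x = c \<odot>\<^bsub>V\<^esub> v"
proof -
  obtain \<beta> where \<beta>: "finite \<beta>" "basis \<beta>" using finite_basis_exists[OF assms(1)] by blast
  then have "card \<beta> = 1" using dim_basis assms(2) by simp
  then obtain v where v: "\<beta> = {v}" by (auto simp: card_1_singleton_iff)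
  have vV: "v \<in> carrier V" "span {v} = carrier V" using \<beta> v by (auto simp: basis_def)
  have "\<exists>c\<in>carrier K. x = c \<odot>\<^bsub>V\<^esub> v" if "x \<in> carrier V" for x
  proof -
    have "x \<in> {lincomb a {v} | a. a \<in> {v} \<rightarrow> carrier K}"
      using that vV finite_span[of "{v}"] by simp
    then show ?thesis using vV(1) by (auto simp: lincomb_def)
  qed
  then show ?thesis using vV(1) by blast
qed

text \<open>\<open>H\<close> lives on a carrier with its own operations, whereas
  \<open>linear_space\<close> wants a vector space on a whole type. Complex functions on that type
  provide one, and \<open>coords\<close> and \<open>vec\<close> become mutually inverse between
  \<open>carrier H\<close> and the subspace \<open>vspace\<close> of functions supported in
  \<open>B\<close>.\<close>

locale complex_based_bialgebra = based_bialgebra complex_field H B coord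
  for H :: "(complex, 'h, 'n) hopf_scheme" and B coord
begin

definition vec :: "('h \<Rightarrow> complex) \<Rightarrow> 'h"
  where "vec u = (\<Oplus>\<^bsub>H\<^esub>b\<in>B. u b \<odot>\<^bsub>H\<^esub> b)"

definition coords :: "'h \<Rightarrow> 'h \<Rightarrow> complex"
  where "coords x = (\<lambda>b. if b \<in> B then coord b x else 0)"

definition vspace :: "('h \<Rightarrow> complex) set"
  where "vspace = {u. \<forall>b. b \<notin> B \<longrightarrow> u b = 0}"

lemma vec_closed [simp]: "vec u \<in> carrier H"
  unfolding vec_def by (rule finsum_closed) (auto simp: B_closed)

lemma vec_add: "vec (u + v) = vec u \<oplus>\<^bsub>H\<^esub> vec v"
proof -
  have "vec (u + v) = (\<Oplus>\<^bsub>H\<^esub>b\<in>B. u b \<odot>\<^bsub>H\<^esub> b \<oplus>\<^bsub>H\<^esub> v b \<odot>\<^bsub>H\<^esub> b)"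
    unfolding vec_def using smult_l_distr by (intro finsum_cong') (auto simp: B_closed)
  then show ?thesis unfolding vec_def by (simp add: finsum_addf Pi_iff B_closed)
qed

lemma vec_scale: "vec (fscale c u) = c \<odot>\<^bsub>H\<^esub> vec u"
proof -
  have "vec (fscale c u) = (\<Oplus>\<^bsub>H\<^esub>b\<in>B. c \<odot>\<^bsub>H\<^esub> (u b \<odot>\<^bsub>H\<^esub> b))"
    unfolding vec_def fscale_def using smult_assoc1 by (intro finsum_cong') (auto simp: B_closed)
  then show ?thesis
    unfolding vec_def using finite_B by (simp add: finsum_smult_ldistr Pi_iff B_closed)
qed

lemma vec_coords [simp]: "x \<in> carrier H \<Longrightarrow> vec (coords x) = x"
proof -
  assume x: "x \<in> carrier H"
  have "vec (coords x) = (\<Oplus>\<^bsub>H\<^esub>b\<in>B. coord b x \<odot>\<^bsub>H\<^esub> b)"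
    unfolding vec_def coords_def by (intro finsum_cong') (auto simp: B_closed)
  then show ?thesis using coord_expand[OF x] by simp
qed

lemma coords_add: "x \<in> carrier H \<Longrightarrow> y \<in> carrier H \<Longrightarrow> coords (x \<oplus>\<^bsub>H\<^esub> y) = coords x + coords y"
  by (auto simp: coords_def form_add coord_form)

lemma coords_smult: "x \<in> carrier H \<Longrightarrow> coords (c \<odot>\<^bsub>H\<^esub> x) = fscale c (coords x)"
  by (auto simp: coords_def form_smult coord_form fscale_def)

lemma coords_zero: "coords \<zero>\<^bsub>H\<^esub> = 0"
  using coords_add[of "\<zero>\<^bsub>H\<^esub>" "\<zero>\<^bsub>H\<^esub>"] by simp

lemma vec_zero: "vec 0 = \<zero>\<^bsub>H\<^esub>"
  using vec_coords[of "\<zero>\<^bsub>H\<^esub>"] coords_zero by simp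

lemma coords_finsum:
  assumes "finite A" "f \<in> A \<rightarrow> carrier H"
  shows "coords (\<Oplus>\<^bsub>H\<^esub>a\<in>A. f a) = (\<Sum>a\<in>A. coords (f a))"
  using assms
proof (induction A rule: finite_induct)
  case (insert a A)
  then show ?case by (simp add: finsum_insert coords_add Pi_iff)
qed (simp add: coords_zero)

lemma coords_B: "b \<in> B \<Longrightarrow> coords b = (\<lambda>b'. if b' = b then 1 else 0)"
  by (auto simp: coords_def coord_B)

lemma coords_vspace [simp]: "coords x \<in> vspace"
  by (simp add: coords_def vspace_def)

lemma sum_fun_apply: "(\<Sum>a\<in>A. f a) x = (\<Sum>a\<in>A. f a x)" for f :: "'i \<Rightarrow> 'j \<Rightarrow> complex"
  by (induct A rule: infinite_finite_induct) simp_all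

lemma coords_vec: "coords (vec u) = (\<lambda>b. if b \<in> B then u b else 0)"
proof
  fix b
  have "coords (vec u) = (\<Sum>b\<in>B. fscale (u b) (coords b))"
    unfolding vec_def using finite_B by (simp add: coords_finsum Pi_iff B_closed coords_smult cong: sum.cong)
  then show "coords (vec u) b = (if b \<in> B then u b else 0)"
    using finite_B by (simp add: sum_fun_apply fscale_def coords_B if_distrib cong: sum.cong if_cong)
qed

lemma coords_vec_vspace [simp]: "u \<in> vspace \<Longrightarrow> coords (vec u) = u"
  by (auto simp: coords_vec vspace_def)

lemma coords_inject: "x \<in> carrier H \<Longrightarrow> y \<in> carrier H \<Longrightarrow> coords x = coords y \<longleftrightarrow> x = y"
  by (metis vec_coords)

lemma functional_form: "fs.functional f \<Longrightarrow> (\<lambda>x. f (coords x)) \<in> forms"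
  by (auto simp: forms_def module_hom_def self_module_sel coords_add coords_smult fs.functional_simps)

lemma form_functional: "\<phi> \<in> forms \<Longrightarrow> fs.functional (\<lambda>u. \<phi> (vec u))"
  by (rule fs.functionalI) (simp_all add: vec_add vec_scale form_add form_smult)

lemma slice_cong:
  assumes "\<phi> \<in> forms" "\<psi> \<in> forms" "\<And>x. x \<in> carrier H \<Longrightarrow> \<phi> x = \<psi> x" "t \<in> carrier HH.T"
  shows "lslice \<phi> t = lslice \<psi> t" "rslice \<phi> t = rslice \<psi> t"
  by (rule HH.tensor_hom_eqI[OF lslice_hom lslice_hom _ assms(4)]; simp add: assms lslice_pure)
    (rule HH.tensor_hom_eqI[OF rslice_hom rslice_hom _ assms(4)]; simp add: assms rslice_pure)

definition vmul :: "('h \<Rightarrow> complex) \<Rightarrow> ('h \<Rightarrow> complex) \<Rightarrow> 'h \<Rightarrow> complex"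
  where "vmul u v = coords (vec u \<otimes>\<^bsub>H\<^esub> vec v)"

definition Lop :: "(('h \<Rightarrow> complex) \<Rightarrow> complex) \<Rightarrow> ('h \<Rightarrow> complex) \<Rightarrow> 'h \<Rightarrow> complex"
  where "Lop f u = coords (lslice (\<lambda>x. f (coords x)) (comult H (vec u)))"

definition Rop :: "(('h \<Rightarrow> complex) \<Rightarrow> complex) \<Rightarrow> ('h \<Rightarrow> complex) \<Rightarrow> 'h \<Rightarrow> complex"
  where "Rop f u = coords (rslice (\<lambda>x. f (coords x)) (comult H (vec u)))"

lemma Lop_coords: "x \<in> carrier H \<Longrightarrow> Lop f (coords x) = coords (lslice (\<lambda>x. f (coords x)) (comult H x))"
  and Rop_coords: "x \<in> carrier H \<Longrightarrow> Rop f (coords x) = coords (rslice (\<lambda>x. f (coords x)) (comult H x))"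
  by (simp_all add: Lop_def Rop_def)

lemma vec_Lop: "fs.functional f \<Longrightarrow> vec (Lop f u) = lslice (\<lambda>x. f (coords x)) (comult H (vec u))"
  and vec_Rop: "fs.functional f \<Longrightarrow> vec (Rop f u) = rslice (\<lambda>x. f (coords x)) (comult H (vec u))"
  by (simp_all add: Lop_def Rop_def lslice_closed rslice_closed functional_form)

lemma vspace_subspace: "fs.subspace vspace"
  by (rule fs.subspaceI) (auto simp: vspace_def fscale_def)

lemma inj_coords: "inj_on coords (carrier H)"
  by (rule inj_onI) (simp add: coords_inject)

lemma lslice_add: "\<phi> \<in> forms \<Longrightarrow> s \<in> carrier HH.T \<Longrightarrow> t \<in> carrier HH.T \<Longrightarrow>
    lslice \<phi> (s \<oplus>\<^bsub>HH.T\<^esub> t) = lslice \<phi> s \<oplus>\<^bsub>H\<^esub> lslice \<phi> t"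
  and lslice_smult: "\<phi> \<in> forms \<Longrightarrow> t \<in> carrier HH.T \<Longrightarrow> lslice \<phi> (c \<odot>\<^bsub>HH.T\<^esub> t) = c \<odot>\<^bsub>H\<^esub> lslice \<phi> t"
  using module_hom_add[OF lslice_hom] module_hom_smult[OF lslice_hom] by simp_all

lemma coords_image_subspace:
  assumes "submodule complex_field C H"
  shows "fs.subspace (coords ` C)"
proof -
  have CH: "x \<in> carrier H" if "x \<in> C" for x using submodule.subset[OF assms] that by blast
  show ?thesis
  proof (rule fs.subspaceI)
    show "0 \<in> coords ` C" using submodule.zero_closed[OF assms] coords_zero by (metis imageI)
    show "u + v \<in> coords ` C" if "u \<in> coords ` C" "v \<in> coords ` C" for u v
      using that submodule.m_closed[OF assms] CH by (auto simp: coords_add[symmetric])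
    show "fscale c u \<in> coords ` C" if "u \<in> coords ` C" for c u
      using that submodule.smult_closed[OF assms] CH by (auto simp: coords_smult[symmetric])
  qed
qed

lemma vec_image_submodule:
  assumes "fs.subspace S"
  shows "submodule complex_field (vec ` S) H"
proof
  show "vec ` S \<subseteq> carrier H" by auto
  show "x \<oplus>\<^bsub>H\<^esub> y \<in> vec ` S" if "x \<in> vec ` S" "y \<in> vec ` S" for x y
    using that fs.subspace_add[OF assms] by (auto simp: vec_add[symmetric])
  show "\<zero>\<^bsub>H\<^esub> \<in> vec ` S"
    using fs.subspace_0[OF assms] coords_zero vec_coords[of "\<zero>\<^bsub>H\<^esub>"] by (metis image_eqI zero_closed)
  show "c \<odot>\<^bsub>H\<^esub> x \<in> vec ` S" if "x \<in> vec ` S" for c x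
    using that fs.subspace_scale[OF assms] by (auto simp: vec_scale[symmetric])
qed

text \<open>The tensors whose slice lies in \<open>D\<close> form a submodule containing the pure
  tensors of \<open>D\<close>, hence their span, to which the coproduct of \<open>x\<close>
  belongs.\<close>

lemma subcoalgebra_slices:
  assumes D: "subcoalgebra complex_field D H" and \<phi>: "\<phi> \<in> forms" and x: "x \<in> D"
  shows "lslice \<phi> (comult H x) \<in> D" "rslice \<phi> (comult H x) \<in> D"
proof -
  have sub: "submodule complex_field D H"
    using D by (simp add: subcoalgebra_def subspace_def)
  have DH: "y \<in> carrier H" if "y \<in> D" for y using submodule.subset[OF sub] that by blast
  let ?P = "{HH.pure c d | c d. c \<in> D \<and> d \<in> D}"
  have c: "comult H x \<in> HH.T.span ?P" using D x by (simp add: subcoalgebra_def)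
  have *: "\<psi> (comult H x) \<in> D"
    if \<psi>: "\<psi> \<in> module_hom complex_field HH.T H" and P: "\<And>c d. c \<in> D \<Longrightarrow> d \<in> D \<Longrightarrow> \<psi> (HH.pure c d) \<in> D" for \<psi>
  proof -
    interpret mod_hom complex_field HH.T H \<psi> by unfold_locales fact
    have "submodule complex_field {t \<in> carrier HH.T. \<psi> t \<in> D} HH.T"
      by unfold_locales
        (auto simp: submodule.m_closed[OF sub] submodule.smult_closed[OF sub] submodule.zero_closed[OF sub])
    then have "HH.T.span ?P \<subseteq> {t \<in> carrier HH.T. \<psi> t \<in> D}"
      by (rule HH.T.span_is_subset[rotated]) (use P DH in \<open>auto simp: HH.pure_closed\<close>)
    then show ?thesis using c by blast
  qed
  show "lslice \<phi> (comult H x) \<in> D"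
    by (rule *[OF lslice_hom[OF \<phi>]])
      (simp add: lslice_pure \<phi> DH submodule.smult_closed[OF sub])
  show "rslice \<phi> (comult H x) \<in> D"
    by (rule *[OF rslice_hom[OF \<phi>]])
      (simp add: rslice_pure \<phi> DH submodule.smult_closed[OF sub])
qed

lemma vspace_span: "vspace \<subseteq> fs.span (coords ` B)"
proof
  fix u assume u: "u \<in> vspace"
  have "u = (\<Sum>b\<in>B. fscale (u b) (coords b))"
  proof
    fix b show "u b = (\<Sum>b\<in>B. fscale (u b) (coords b)) b"
      using u finite_B
      by (simp add: sum_fun_apply fscale_def coords_B if_distrib vspace_def cong: sum.cong if_cong)
  qed
  also have "\<dots> \<in> fs.span (coords ` B)"
    by (intro fs.span_sum fs.span_scale fs.span_base) auto
  finally show "u \<in> fs.span (coords ` B)" .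
qed

text \<open>A basis of \<open>S\<close>, finite because \<open>S\<close> lies in a finite span,
  together with functionals dual to it.\<close>

lemma ex_projection:
  assumes "fs.subspace S" "S \<subseteq> vspace"
  shows "\<exists>A. finite A \<and> A \<subseteq> S \<and> S = fs.span A"
    and "\<exists>p. (\<forall>u v. p (u + v) = p u + p v) \<and> (\<forall>c u. p (fscale c u) = fscale c (p u)) \<and>
      (\<forall>u. p u \<in> S) \<and> (\<forall>u\<in>S. p u = u)"
proof -
  obtain A where A: "A \<subseteq> S" "fs.independent A" "S \<subseteq> fs.span A"
    using fs.maximal_independent_subset by blast
  have fin: "finite A"
    using fs.independent_span_bound[OF _ A(2), of "coords ` B"] finite_B A(1) assms(2) vspace_span by auto
  have SA: "S = fs.span A" using fs.span_subspace[OF A(1,3) assms(1)] by simp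
  show "\<exists>A. finite A \<and> A \<subseteq> S \<and> S = fs.span A" using fin A(1) SA by blast
  have "\<exists>f. fs.functional f \<and> (\<forall>a'\<in>A. f a' = (if a' = a then 1 else 0))" for a
    by (rule fs.functional_extend[OF A(2)])
  then obtain f where f: "\<And>a. fs.functional (f a)" "\<And>a a'. a' \<in> A \<Longrightarrow> f a a' = (if a' = a then 1 else 0)"
    by metis
  define p where "p u = (\<Sum>a\<in>A. fscale (f a u) a)" for u
  have padd: "p (u + v) = p u + p v" for u v
    by (simp add: p_def fs.functional_add[OF f(1)] fs.scale_left_distrib sum.distrib)
  have pscale: "p (fscale c u) = fscale c (p u)" for c u
    by (simp add: p_def fs.functional_scale[OF f(1)] fs.scale_sum_right)
  have pS: "p u \<in> S" for u
    unfolding p_def SA by (intro fs.span_sum fs.span_scale fs.span_base)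
  have pA: "p a = a" if "a \<in> A" for a
  proof -
    have "p a = (\<Sum>a'\<in>A. if a' = a then a' else 0)"
      unfolding p_def using that by (intro sum.cong) (auto simp: f)
    then show ?thesis using fin that by simp
  qed
  have p0: "p 0 = 0" using pscale[of 0 0] by simp
  have "p u = u" if "u \<in> S" for u
    using that unfolding SA
    by (induction u rule: fs.span_induct_alt) (simp_all only: p0 padd pscale pA)
  with padd pscale pS show "\<exists>p. (\<forall>u v. p (u + v) = p u + p v) \<and> (\<forall>c u. p (fscale c u) = fscale c (p u)) \<and>
      (\<forall>u. p u \<in> S) \<and> (\<forall>u\<in>S. p u = u)" by blast
qed

text \<open>With a projection \<open>p\<close> onto \<open>C\<close>, stability under right slices gives \<open>(p \<otimes> id) \<Delta>(x) = \<Delta>(x)\<close>, and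
  stability under left slices puts \<open>(p \<otimes> id) \<Delta>(x)\<close> into \<open>C \<otimes> C\<close>.\<close>
lemma stable_subcoalgebra:
  assumes S: "fs.subspace S" "S \<subseteq> vspace"
    and L: "\<And>f u. fs.functional f \<Longrightarrow> u \<in> S \<Longrightarrow> Lop f u \<in> S"
    and R: "\<And>f u. fs.functional f \<Longrightarrow> u \<in> S \<Longrightarrow> Rop f u \<in> S"
  shows "subcoalgebra complex_field (vec ` S) H"
  unfolding subcoalgebra_def
proof (intro conjI ballI)
  show "subspace complex_field (vec ` S) H"
    unfolding subspace_def using vec_image_submodule[OF S(1)] vectorspace_axioms by simp
  fix x assume "x \<in> vec ` S"
  then obtain s where s: "s \<in> S" "x = vec s" by blast
  then have x: "x \<in> carrier H" by simp
  let ?C = "vec ` S" and ?D = "comult H x"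
  obtain p where p: "\<And>u v. p (u + v) = p u + p v" "\<And>c u. p (fscale c u) = fscale c (p u)"
    "\<And>u. p u \<in> S" "\<And>u. u \<in> S \<Longrightarrow> p u = u"
    using ex_projection(2)[OF S] by blast
  define q where "q y = vec (p (coords y))" for y
  have q_hom: "q \<in> module_hom complex_field H H"
    by (auto simp: q_def module_hom_def coords_add coords_smult p vec_add vec_scale)
  have q_C: "q y \<in> ?C" for y using p(3) by (auto simp: q_def)
  have q_id: "q y = y" if "y \<in> ?C" for y
    using that p(4) S(2) by (auto simp: q_def subset_iff)
  have coordf: "fs.functional (\<lambda>u. u b)" for b :: 'h
    by (rule fs.functionalI) (auto simp: fscale_def)
  have sl: "lslice (coord b) ?D \<in> ?C" "rslice (coord b) ?D \<in> ?C" if b: "b \<in> B" for b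
  proof -
    have "coord b = (\<lambda>x. coords x b)" using b by (simp add: coords_def fun_eq_iff)
    then show "lslice (coord b) ?D \<in> ?C" "rslice (coord b) ?D \<in> ?C"
      using vec_Lop[OF coordf, of b s] vec_Rop[OF coordf, of b s] L[OF coordf s(1)] R[OF coordf s(1)] s(2)
      by (metis imageI)+
  qed
  let ?m = "tensor_map complex_field H H H H q (\<lambda>b. b)"
  have mh: "?m \<in> module_hom complex_field HH.T HH.T"
    by (rule tensor_map_hom[OF q_hom module_hom_id]) unfold_locales
  have mp: "?m (HH.pure a b) = HH.pure (q a) b" if "a \<in> carrier H" "b \<in> carrier H" for a b
    by (rule tensor_map_pure[OF q_hom module_hom_id]) (unfold_locales, use that in auto)
  note T = HH.T.module_axioms
  have CH: "y \<in> carrier H" if "y \<in> ?C" for y using that by auto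
  \<comment> \<open>The right slices lie in \<open>?C\<close>, where \<open>q\<close> is the
    identity, so \<open>?m\<close> fixes the coproduct.\<close>
  have "?m ?D = ?m (\<Oplus>\<^bsub>HH.T\<^esub>b\<in>B. HH.pure (rslice (coord b) ?D) b)"
    using tensor_expand_right[OF comult_closed[OF x]] by simp
  also have "\<dots> = (\<Oplus>\<^bsub>HH.T\<^esub>b\<in>B. ?m (HH.pure (rslice (coord b) ?D) b))"
    using sl by (intro module_hom_finsum[OF T T mh finite_B]) (auto simp: HH.pure_closed B_closed CH)
  also have "\<dots> = (\<Oplus>\<^bsub>HH.T\<^esub>b\<in>B. HH.pure (rslice (coord b) ?D) b)"
    using sl by (intro HH.T.M.finsum_cong') (auto simp: mp HH.pure_closed B_closed CH q_id)
  also have "\<dots> = ?D" using tensor_expand_right[OF comult_closed[OF x]] by simp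
  \<comment> \<open>Expanded with basis elements on the left instead, \<open>q\<close> carries each
    \<open>b\<close> into \<open>?C\<close>, and the left slices are there already.\<close>
  finally have "?D = ?m (\<Oplus>\<^bsub>HH.T\<^esub>b\<in>B. HH.pure b (lslice (coord b) ?D))"
    using tensor_expand_left[OF comult_closed[OF x]] by simp
  also have "\<dots> = (\<Oplus>\<^bsub>HH.T\<^esub>b\<in>B. ?m (HH.pure b (lslice (coord b) ?D)))"
    using sl by (intro module_hom_finsum[OF T T mh finite_B]) (auto simp: HH.pure_closed B_closed CH)
  also have "\<dots> \<in> HH.T.span {HH.pure c d | c d. c \<in> ?C \<and> d \<in> ?C}" (is "_ \<in> HH.T.span ?P")
  proof (rule submodule_finsum[OF _ finite_B])
    have PT: "?P \<subseteq> carrier HH.T" by (auto simp: HH.pure_closed)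
    show "submodule complex_field (HH.T.span ?P) HH.T" by (rule HH.T.span_is_submodule[OF PT])
    fix b assume b: "b \<in> B"
    then have "?m (HH.pure b (lslice (coord b) ?D)) = HH.pure (q b) (lslice (coord b) ?D)"
      by (intro mp B_closed CH sl)
    then have "?m (HH.pure b (lslice (coord b) ?D)) \<in> ?P"
      using sl(1)[OF b] q_C[of b] by blast
    then show "?m (HH.pure b (lslice (coord b) ?D)) \<in> HH.T.span ?P"
      using HH.T.in_own_span[OF PT] by blast
  qed
  finally show "?D \<in> HH.T.span ?P" .
qed

text \<open>\<open>vec\<close> and \<open>coords\<close> match stable subspaces with subcoalgebras,
  so simplicity is preserved and pointedness gives dimension 1.\<close>

lemma simple_stable_line:
  assumes ptd: "pointed complex_field H" and S: "fs.subspace S" "S \<subseteq> vspace" "S \<noteq> {0}"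
    and L: "\<And>f u. fs.functional f \<Longrightarrow> u \<in> S \<Longrightarrow> Lop f u \<in> S"
    and R: "\<And>f u. fs.functional f \<Longrightarrow> u \<in> S \<Longrightarrow> Rop f u \<in> S"
    and simple: "\<And>T. \<lbrakk>fs.subspace T; T \<subseteq> S; T \<noteq> {0};
        \<And>f x. fs.functional f \<Longrightarrow> x \<in> T \<Longrightarrow> Lop f x \<in> T; \<And>f x. fs.functional f \<Longrightarrow> x \<in> T \<Longrightarrow> Rop f x \<in> T\<rbrakk>
        \<Longrightarrow> T = S"
  shows "\<exists>u\<in>S. S \<subseteq> range (\<lambda>c. fscale c u)"
proof -
  let ?C = "vec ` S"
  have sub: "submodule complex_field ?C H" by (rule vec_image_submodule[OF S(1)])
  have coordsC: "coords ` ?C = S"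
    using S(2) by (force simp: subset_iff image_iff)
  have "simple_subcoalgebra complex_field ?C H"
    unfolding simple_subcoalgebra_def
  proof (intro conjI allI impI)
    show "subcoalgebra complex_field ?C H" by (rule stable_subcoalgebra[OF S(1,2) L R])
    show "?C \<noteq> {\<zero>\<^bsub>H\<^esub>}" using coordsC S(3) coords_zero by auto
    fix D assume D: "subcoalgebra complex_field D H \<and> D \<subseteq> ?C"
    then have Dsub: "submodule complex_field D H" by (simp add: subcoalgebra_def subspace_def)
    have DH: "D \<subseteq> carrier H" using submodule.subset[OF Dsub] .
    have "D = ?C" if D0: "D \<noteq> {\<zero>\<^bsub>H\<^esub>}"
    proof -
      have vecD: "vec ` coords ` D = D" using DH by (force simp: subset_iff image_iff)
      have "coords ` D = S"
      proof (rule simple)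
        show "fs.subspace (coords ` D)" by (rule coords_image_subspace[OF Dsub])
        show "coords ` D \<subseteq> S" using D coordsC by blast
        show "coords ` D \<noteq> {0}"
        proof
          assume "coords ` D = {0}"
          then have "vec ` {0} = D" using vecD by simp
          then show False using D0 vec_zero by simp
        qed
        show "Lop f u \<in> coords ` D" if "fs.functional f" "u \<in> coords ` D" for f u
          using that subcoalgebra_slices(1)[of D "\<lambda>x. f (coords x)"] D DH
          by (auto simp: Lop_coords functional_form subset_iff)
        show "Rop f u \<in> coords ` D" if "fs.functional f" "u \<in> coords ` D" for f u
          using that subcoalgebra_slices(2)[of D "\<lambda>x. f (coords x)"] D DH
          by (auto simp: Rop_coords functional_form subset_iff)
      qed
      then show ?thesis using vecD by simp
    qed
    then show "D = {\<zero>\<^bsub>H\<^esub>} \<or> D = ?C" by blast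
  qed
  then have dim: "vectorspace.dim complex_field (H\<lparr>carrier := ?C\<rparr>) = 1"
    using ptd by (simp add: pointed_def)
  interpret C: vectorspace complex_field "H\<lparr>carrier := ?C\<rparr>"
    by (rule subspace_is_vs) (simp add: subspace_def sub vectorspace_axioms)
  \<comment> \<open>\<open>dim_1_line\<close> presupposes finite dimension of the subcoalgebra,
    which a finite generating set of \<open>S\<close> supplies.\<close>
  obtain A where A: "finite A" "A \<subseteq> S" "S = fs.span A" using ex_projection(1)[OF S(1,2)] by blast
  have AC: "vec ` A \<subseteq> ?C" using A(2) by blast
  have "C.span (vec ` A) = span (vec ` A)" by (rule span_li_not_depend[OF AC sub])
  moreover have "span (vec ` A) = ?C"
  proof
    show "span (vec ` A) \<subseteq> ?C" by (rule span_is_subset[OF AC sub])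
    have AH: "vec ` A \<subseteq> carrier H" by auto
    have sp: "submodule complex_field (span (vec ` A)) H" by (rule span_is_submodule[OF AH])
    have "vec u \<in> span (vec ` A)" if "u \<in> S" for u
      using that unfolding A(3)
    proof (induction u rule: fs.span_induct_alt)
      case base
      show ?case unfolding vec_zero by (rule submodule.zero_closed[OF sp])
    next
      case (step c x y)
      have "vec x \<in> span (vec ` A)" using in_own_span[OF AH] step(1) by blast
      then show ?case
        unfolding vec_add vec_scale
        by (intro submodule.m_closed[OF sp] submodule.smult_closed[OF sp] step(2)) simp_all
    qed
    then show "?C \<subseteq> span (vec ` A)" by blast
  qed
  ultimately have "C.fin_dim"
    unfolding C.fin_dim_def using A(1) AC by (intro exI[of _ "vec ` A"]) simp
  from C.dim_1_line[OF this dim]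
  obtain v where v: "v \<in> ?C" "\<And>x. x \<in> ?C \<Longrightarrow> \<exists>c. x = c \<odot>\<^bsub>H\<^esub> v" by auto
  have "\<exists>c. u = fscale c (coords v)" if "u \<in> S" for u
  proof -
    obtain c where "vec u = c \<odot>\<^bsub>H\<^esub> v" using v(2) \<open>u \<in> S\<close> by blast
    then have "coords (vec u) = fscale c (coords v)" using v(1) by (auto simp: coords_smult)
    then show ?thesis using that S(2) by auto
  qed
  moreover have "coords v \<in> S" using v(1) coordsC by blast
  ultimately show ?thesis by (intro bexI[of _ "coords v"]) auto
qed

end

context complex_based_bialgebra
begin

lemma functional_apply: "fs.functional (\<lambda>u. u b)" for b :: 'h
  by (rule fs.functionalI) (auto simp: fscale_def)

lemma comult_add: "x \<in> carrier H \<Longrightarrow> y \<in> carrier H \<Longrightarrow>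
    comult H (x \<oplus>\<^bsub>H\<^esub> y) = comult H x \<oplus>\<^bsub>HH.T\<^esub> comult H y"
  and comult_smult: "x \<in> carrier H \<Longrightarrow> comult H (c \<odot>\<^bsub>H\<^esub> x) = c \<odot>\<^bsub>HH.T\<^esub> comult H x"
  using module_hom_add[OF comult_linear] module_hom_smult[OF comult_linear] by simp_all

text \<open>The basis vectors are now the functions \<open>coords b\<close>, and \<open>vec\<close>
  recovers the point \<open>b\<close> at which the coordinate is read; hence the form
  \<open>\<lambda>v u. u (vec v)\<close>.\<close>

lemma pointed_bialgebra:
  assumes "pointed complex_field H"
  shows "pointed_bialgebra fscale vspace (coords ` B) (\<lambda>v u. u (vec v)) vmul (coords \<one>\<^bsub>H\<^esub>)
    (\<lambda>u. counit H (vec u)) Lop Rop"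
proof unfold_locales
  show "fs.subspace vspace" by (rule vspace_subspace)
  show "finite (coords ` B)" using finite_B by simp
  show "coords ` B \<subseteq> vspace" by auto
  show "fs.functional (\<lambda>u. u (vec b))" for b :: "'h \<Rightarrow> complex" by (rule functional_apply)
  have inj: "inj_on coords B" using inj_coords B_H by (rule inj_on_subset)
  have sum_B: "(\<Sum>v\<in>coords ` B. F v) = (\<Sum>b\<in>B. F (coords b))" for F :: "('h \<Rightarrow> complex) \<Rightarrow> 'h \<Rightarrow> complex"
    by (simp add: sum.reindex[OF inj])
  show "x = (\<Sum>b\<in>coords ` B. fscale (x (vec b)) b)" if x: "x \<in> vspace" for x
  proof
    fix b
    have "(\<Sum>v\<in>coords ` B. fscale (x (vec v)) v) = (\<Sum>b\<in>B. fscale (x b) (coords b))"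
      unfolding sum_B by (intro sum.cong) (simp_all add: B_closed)
    then show "x b = (\<Sum>v\<in>coords ` B. fscale (x (vec v)) v) b"
      using x finite_B
      by (simp add: sum_fun_apply fscale_def coords_B vspace_def if_distrib cong: sum.cong if_cong)
  qed
  show "vmul x y \<in> vspace" for x y by (simp add: vmul_def)
  show "vmul (x + y) z = vmul x z + vmul y z" "vmul z (x + y) = vmul z x + vmul z y" for x y z
    by (simp_all only: vmul_def vec_add alg.l_distr alg.r_distr vec_closed coords_add alg.m_closed)
  show "vmul (fscale c x) y = fscale c (vmul x y)" "vmul x (fscale c y) = fscale c (vmul x y)" for c x y
    by (simp_all add: vmul_def vec_scale smult_mult_left smult_mult_right coords_smult)
  show "vmul (vmul x y) z = vmul x (vmul y z)" for x y z
    by (simp add: vmul_def alg.m_assoc)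
  show "coords \<one>\<^bsub>H\<^esub> \<in> vspace" by simp
  show "vmul (coords \<one>\<^bsub>H\<^esub>) x = x" "vmul x (coords \<one>\<^bsub>H\<^esub>) = x" if "x \<in> vspace" for x
    using that by (simp_all add: vmul_def)
  show eps: "fs.functional (\<lambda>u. counit H (vec u))" by (rule form_functional[OF counit_form])
  show "Lop f x \<in> vspace" "Rop f x \<in> vspace" for f x by (simp_all add: Lop_def Rop_def)
  show "Lop f (x + y) = Lop f x + Lop f y" if "fs.functional f" for f x y
    unfolding Lop_def vec_add
    by (simp only: comult_add vec_closed lslice_add functional_form[OF that] comult_closed coords_add lslice_closed)
  show "Lop f (fscale c x) = fscale c (Lop f x)" if "fs.functional f" for f c x
    by (simp add: Lop_def vec_scale comult_smult lslice_smult functional_form[OF that] coords_smult lslice_closed)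
  show "f (Lop g x) = g (Rop f x)" if "fs.functional f" "fs.functional g" for f g x
    using form_slice[OF functional_form[OF that(1)] functional_form[OF that(2)], of "comult H (vec x)"]
    by (simp add: Lop_def Rop_def)
  show "Rop f (Lop g x) = Lop g (Rop f x)" if "fs.functional f" "fs.functional g" for f g x
    using slices_commute[OF functional_form[OF that(1)] functional_form[OF that(2)], of "vec x"]
    by (simp add: vec_Lop vec_Rop that Lop_def[of _ "Rop _ _"] Rop_def[of _ "Lop _ _"])
  have cf: "(\<lambda>x. counit H (vec (coords x))) \<in> forms" using functional_form[OF eps] .
  show "Lop (\<lambda>u. counit H (vec u)) x = x" if "x \<in> vspace" for x
    unfolding Lop_def
    by (subst slice_cong(1)[OF cf counit_form]) (simp_all add: that lslice_def counit_left)
  show "Rop (\<lambda>u. counit H (vec u)) x = x" if "x \<in> vspace" for x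
    unfolding Rop_def
    by (subst slice_cong(2)[OF cf counit_form]) (simp_all add: that rslice_def counit_right)
  show "Lop f (vmul x y) = (\<Sum>b\<in>coords ` B. vmul (Lop (\<lambda>u. u (vec b)) x) (Lop (\<lambda>v. f (vmul b v)) y))"
    if f: "fs.functional f" and "x \<in> vspace" for f x y
  proof -
    let ?F = "\<lambda>x. f (coords x)"
    note F = functional_form[OF f]
    have fl: "fs.functional (\<lambda>v. f (vmul u v))" for u
    proof (rule fs.functionalI)
      show "f (vmul u (x + y)) = f (vmul u x) + f (vmul u y)" for x y
        unfolding vmul_def vec_add
        by (simp only: alg.r_distr vec_closed coords_add alg.m_closed fs.functional_add[OF f])
      show "f (vmul u (fscale c x)) = c * f (vmul u x)" for c x
        by (simp add: vmul_def vec_scale smult_mult_right coords_smult fs.functional_scale[OF f])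
    qed
    have ff: "(\<lambda>v. ?F (b \<otimes>\<^bsub>H\<^esub> v)) \<in> forms" if "b \<in> B" for b
      by (rule form_mult_left[OF F B_closed[OF that]])
    have 1: "Lop (\<lambda>u. u (vec (coords b))) x = coords (lslice (coord b) (comult H (vec x)))" if "b \<in> B" for b
    proof -
      have "(\<lambda>x. coords x (vec (coords b))) = coord b"
        using that vec_coords[OF B_closed[OF that]] by (simp only:) (simp add: coords_def)
      then show ?thesis by (simp add: Lop_def)
    qed
    have 2: "Lop (\<lambda>v. f (vmul (coords b) v)) y = coords (lslice (\<lambda>v. ?F (b \<otimes>\<^bsub>H\<^esub> v)) (comult H (vec y)))"
      if "b \<in> B" for b
      unfolding Lop_def
      by (subst slice_cong(1)[OF functional_form[OF fl] form_mult_left[OF F]])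
        (use that in \<open>simp_all add: vmul_def B_closed\<close>)
    have "Lop f (vmul x y) = coords (lslice ?F (comult H (vec x \<otimes>\<^bsub>H\<^esub> vec y)))"
      by (simp add: Lop_def vmul_def)
    also have "\<dots> = (\<Sum>b\<in>B. coords (lslice (coord b) (comult H (vec x)) \<otimes>\<^bsub>H\<^esub>
        lslice (\<lambda>v. ?F (b \<otimes>\<^bsub>H\<^esub> v)) (comult H (vec y))))"
      unfolding lslice_comult_mult[OF F vec_closed vec_closed]
      by (rule coords_finsum[OF finite_B])
        (auto simp: lslice_closed coord_form ff)
    also have "\<dots> = (\<Sum>b\<in>B. vmul (Lop (\<lambda>u. u (vec (coords b))) x) (Lop (\<lambda>v. f (vmul (coords b) v)) y))"
      by (intro sum.cong refl)
        (simp only: 1 2, simp add: vmul_def lslice_closed coord_form ff)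
    finally show ?thesis unfolding sum_B .
  qed
  show "\<exists>u\<in>S. S \<subseteq> range (\<lambda>c. fscale c u)"
    if "fs.subspace S" "S \<subseteq> vspace" "S \<noteq> {0}"
      "\<And>f x. fs.functional f \<Longrightarrow> x \<in> S \<Longrightarrow> Lop f x \<in> S"
      "\<And>f x. fs.functional f \<Longrightarrow> x \<in> S \<Longrightarrow> Rop f x \<in> S"
      "\<And>T. \<lbrakk>fs.subspace T; T \<subseteq> S; T \<noteq> {0};
        \<And>f x. fs.functional f \<Longrightarrow> x \<in> T \<Longrightarrow> Lop f x \<in> T; \<And>f x. fs.functional f \<Longrightarrow> x \<in> T \<Longrightarrow> Rop f x \<in> T\<rbrakk>
        \<Longrightarrow> T = S" for S
    using assms that by (rule simple_stable_line)
qed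

end

section \<open>Group-likes as a group and as a basis\<close>

lemma (in bialgebra)
  assumes "x \<in> carrier (grouplikes K H)"
  shows grouplike_closed: "x \<in> carrier H" and comult_grouplike: "comult H x = HH.pure x x"
    and counit_grouplike: "counit H x = \<one>\<^bsub>K\<^esub>"
  using assms by (simp_all add: grouplikes_def)

lemma (in bialgebra) grouplikes_mult_closed:
  assumes "x \<in> carrier (grouplikes K H)" "y \<in> carrier (grouplikes K H)"
  shows "x \<otimes>\<^bsub>H\<^esub> y \<in> carrier (grouplikes K H)"
proof -
  note x = grouplike_closed[OF assms(1)] and y = grouplike_closed[OF assms(2)]
  have "comult H (x \<otimes>\<^bsub>H\<^esub> y) = tensor_mult K H H (HH.pure x x) (HH.pure y y)"
    using assms by (simp add: comult_mult grouplike_closed comult_grouplike)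
  also have "\<dots> = tensor_map K H H H H (monoid.mult H x) (monoid.mult H x) (HH.pure y y)"
    by (rule tensor_mult_pure[OF module_axioms module_axioms mult_bilinear mult_bilinear HH.pure_closed[OF y y] x x])
  also have "\<dots> = HH.pure (x \<otimes>\<^bsub>H\<^esub> y) (x \<otimes>\<^bsub>H\<^esub> y)"
    by (rule tensor_map_pure[OF mult_hom_left[OF x] mult_hom_left[OF x]]) (unfold_locales, use y in auto)
  finally show ?thesis
    using assms x y by (simp add: grouplikes_def counit_mult)
qed

lemma (in bialgebra) one_grouplike: "\<one>\<^bsub>H\<^esub> \<in> carrier (grouplikes K H)"
  by (simp add: grouplikes_def comult_one counit_one)

context complex_based_bialgebra
begin

text \<open>For a member of \<open>grp\<close> every left slice of the coproduct is a multiple of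
  the element; reassembled over the basis these slices give \<Delta>(x) = x \<otimes> x. Conversely,
  counit 1 keeps a group-like from being zero.\<close>

lemma grp_eq_grouplikes:
  assumes "pointed complex_field H"
  shows "pointed_bialgebra.grp fscale vspace Lop = coords ` carrier (grouplikes complex_field H)"
proof -
  interpret pb: pointed_bialgebra fscale vspace "coords ` B" "\<lambda>v u. u (vec v)" vmul "coords \<one>\<^bsub>H\<^esub>"
    "\<lambda>u. counit H (vec u)" Lop Rop
    by (rule pointed_bialgebra[OF assms])
  show ?thesis
  proof (intro equalityI subsetI)
    fix u assume u: "u \<in> pb.grp"
    let ?x = "vec u"
    have sl: "lslice (coord b) (comult H ?x) = u b \<odot>\<^bsub>H\<^esub> ?x" if "b \<in> B" for b
    proof -
      have "coord b = (\<lambda>x. coords x b)" using that by (simp add: coords_def fun_eq_iff)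
      then have "lslice (coord b) (comult H ?x) = vec (Lop (\<lambda>u. u b) u)"
        by (simp add: vec_Lop functional_apply)
      then show ?thesis
        using pb.L_grp[OF u functional_apply, of b] by (simp add: vec_scale)
    qed
    have p: "(\<lambda>v. HH.pure v ?x) \<in> module_hom complex_field H HH.T"
      using HH.pure_bilinear by (simp add: bilinear_def)
    have "comult H ?x = (\<Oplus>\<^bsub>HH.T\<^esub>b\<in>B. HH.pure b (lslice (coord b) (comult H ?x)))"
      by (rule tensor_expand_left) simp
    also have "\<dots> = (\<Oplus>\<^bsub>HH.T\<^esub>b\<in>B. HH.pure (u b \<odot>\<^bsub>H\<^esub> b) ?x)"
      by (intro HH.T.M.finsum_cong')
        (auto simp: sl B_closed HH.pure_closed bilinearD(4,5)[OF HH.pure_bilinear])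
    also have "\<dots> = HH.pure (\<Oplus>\<^bsub>H\<^esub>b\<in>B. u b \<odot>\<^bsub>H\<^esub> b) ?x"
      by (rule module_hom_finsum[OF module_axioms HH.T.module_axioms p finite_B, symmetric])
        (auto simp: B_closed)
    also have "\<dots> = HH.pure ?x ?x" by (simp add: vec_def)
    finally have "?x \<in> carrier (grouplikes complex_field H)"
      using pb.eps_grp[OF u] by (simp add: grouplikes_def)
    moreover have "u = coords ?x" using pb.grp_V[OF u] by simp
    ultimately show "u \<in> coords ` carrier (grouplikes complex_field H)" by blast
  next
    fix u assume "u \<in> coords ` carrier (grouplikes complex_field H)"
    then obtain x where u: "u = coords x" and x: "x \<in> carrier (grouplikes complex_field H)" by blast
    note xH = grouplike_closed[OF x]
    have "u \<noteq> 0"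
    proof
      assume "u = 0"
      then have "x = \<zero>\<^bsub>H\<^esub>" using u vec_coords[OF xH] vec_zero by metis
      then have "counit H x = 0" using form_smult[OF counit_form, of 0 "\<zero>\<^bsub>H\<^esub>"] by simp
      then show False using counit_grouplike[OF x] by simp
    qed
    then show "u \<in> pb.grp"
      unfolding pb.grp_def
      using xH by (simp add: u Lop_coords comult_grouplike[OF x] lslice_pure functional_form coords_smult)
  qed
qed

end

lemma (in bialgebra) grouplikes_iso_inverse:
  assumes "group \<Gamma>" "grouplikes K H \<cong> \<Gamma>"
  obtains \<theta> where "bij_betw \<theta> (carrier \<Gamma>) (carrier (grouplikes K H))"
    and "\<And>\<sigma> \<tau>. \<sigma> \<in> carrier \<Gamma> \<Longrightarrow> \<tau> \<in> carrier \<Gamma> \<Longrightarrow> \<theta> (\<sigma> \<otimes>\<^bsub>\<Gamma>\<^esub> \<tau>) = \<theta> \<sigma> \<otimes>\<^bsub>H\<^esub> \<theta> \<tau>"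
    and "\<theta> \<one>\<^bsub>\<Gamma>\<^esub> = \<one>\<^bsub>H\<^esub>"
proof -
  interpret \<Gamma>: group \<Gamma> by fact
  let ?G = "carrier (grouplikes K H)"
  obtain h where h: "h \<in> iso (grouplikes K H) \<Gamma>" using assms(2) by (auto simp: is_iso_def)
  then have bij: "bij_betw h ?G (carrier \<Gamma>)"
    and mult: "\<And>x y. x \<in> ?G \<Longrightarrow> y \<in> ?G \<Longrightarrow> h (x \<otimes>\<^bsub>H\<^esub> y) = h x \<otimes>\<^bsub>\<Gamma>\<^esub> h y"
    by (auto simp: iso_def hom_def grouplikes_def)
  define \<theta> where "\<theta> = inv_into ?G h"
  have bij': "bij_betw \<theta> (carrier \<Gamma>) ?G" unfolding \<theta>_def by (rule bij_betw_inv_into[OF bij])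
  have \<theta>G: "\<theta> \<sigma> \<in> ?G" "h (\<theta> \<sigma>) = \<sigma>" if "\<sigma> \<in> carrier \<Gamma>" for \<sigma>
    using bij_betwE[OF bij'] that bij_betw_inv_into_right[OF bij that] by (auto simp: \<theta>_def)
  have inj: "x = y" if "x \<in> ?G" "y \<in> ?G" "h x = h y" for x y
    using bij that by (auto simp: bij_betw_def inj_on_def)
  show ?thesis
  proof
    show "bij_betw \<theta> (carrier \<Gamma>) ?G" by (rule bij')
    show "\<theta> (\<sigma> \<otimes>\<^bsub>\<Gamma>\<^esub> \<tau>) = \<theta> \<sigma> \<otimes>\<^bsub>H\<^esub> \<theta> \<tau>" if "\<sigma> \<in> carrier \<Gamma>" "\<tau> \<in> carrier \<Gamma>" for \<sigma> \<tau>
      using that by (intro inj grouplikes_mult_closed \<theta>G) (simp_all add: \<theta>G mult)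
    \<comment> \<open>The isomorphism is only known to respect products; the unit is preserved since
      an idempotent in a group is its unit.\<close>
    have "h \<one>\<^bsub>H\<^esub> \<otimes>\<^bsub>\<Gamma>\<^esub> h \<one>\<^bsub>H\<^esub> = h \<one>\<^bsub>H\<^esub>"
      using mult[OF one_grouplike one_grouplike] by simp
    moreover have "h \<one>\<^bsub>H\<^esub> \<in> carrier \<Gamma>" using bij_betwE[OF bij] one_grouplike by blast
    ultimately have "h \<one>\<^bsub>H\<^esub> = \<one>\<^bsub>\<Gamma>\<^esub>" by simp
    then show "\<theta> \<one>\<^bsub>\<Gamma>\<^esub> = \<one>\<^bsub>H\<^esub>"
      by (intro inj \<theta>G one_grouplike) (simp_all add: \<theta>G)
  qed
qed

context complex_based_bialgebra
begin

text \<open>Finiteness and inverses are carried over from \<Gamma> along \<theta>.\<close>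

lemma pointed_bialgebra_group:
  assumes ptd: "pointed complex_field H" and "group \<Gamma>" "finite (carrier \<Gamma>)"
    and bij: "bij_betw \<theta> (carrier \<Gamma>) (carrier (grouplikes complex_field H))"
    and mult: "\<And>\<sigma> \<tau>. \<sigma> \<in> carrier \<Gamma> \<Longrightarrow> \<tau> \<in> carrier \<Gamma> \<Longrightarrow> \<theta> (\<sigma> \<otimes>\<^bsub>\<Gamma>\<^esub> \<tau>) = \<theta> \<sigma> \<otimes>\<^bsub>H\<^esub> \<theta> \<tau>"
    and one: "\<theta> \<one>\<^bsub>\<Gamma>\<^esub> = \<one>\<^bsub>H\<^esub>"
  shows "pointed_bialgebra_group fscale vspace (coords ` B) (\<lambda>v u. u (vec v)) vmul (coords \<one>\<^bsub>H\<^esub>)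
    (\<lambda>u. counit H (vec u)) Lop Rop"
proof -
  interpret \<Gamma>: group \<Gamma> by fact
  interpret pb: pointed_bialgebra fscale vspace "coords ` B" "\<lambda>v u. u (vec v)" vmul "coords \<one>\<^bsub>H\<^esub>"
    "\<lambda>u. counit H (vec u)" Lop Rop
    by (rule pointed_bialgebra[OF ptd])
  let ?G = "carrier (grouplikes complex_field H)"
  have G: "?G = \<theta> ` carrier \<Gamma>" using bij by (simp add: bij_betw_def)
  have grp: "pb.grp = (\<lambda>\<sigma>. coords (\<theta> \<sigma>)) ` carrier \<Gamma>"
    using grp_eq_grouplikes[OF ptd] G by (simp add: image_image)
  have cl: "\<theta> \<sigma> \<in> carrier H" if "\<sigma> \<in> carrier \<Gamma>" for \<sigma>
    using G that by (intro grouplike_closed) auto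
  have vm: "vmul (coords (\<theta> \<sigma>)) (coords (\<theta> \<tau>)) = coords (\<theta> (\<sigma> \<otimes>\<^bsub>\<Gamma>\<^esub> \<tau>))"
    if "\<sigma> \<in> carrier \<Gamma>" "\<tau> \<in> carrier \<Gamma>" for \<sigma> \<tau>
    using that by (simp add: vmul_def cl mult)
  show ?thesis
  proof
    show "finite pb.grp" using grp assms(3) by simp
    show "coords \<one>\<^bsub>H\<^esub> \<in> pb.grp" using grp one by (metis \<Gamma>.one_closed imageI)
    show "vmul g h \<in> pb.grp" if "g \<in> pb.grp" "h \<in> pb.grp" for g h
      using that unfolding grp by (auto simp: vm)
    show "\<exists>h\<in>pb.grp. vmul g h = coords \<one>\<^bsub>H\<^esub> \<and> vmul h g = coords \<one>\<^bsub>H\<^esub>" if g: "g \<in> pb.grp" for g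
    proof -
      obtain \<sigma> where \<sigma>: "\<sigma> \<in> carrier \<Gamma>" "g = coords (\<theta> \<sigma>)" using g unfolding grp by blast
      then have "vmul g (coords (\<theta> (inv\<^bsub>\<Gamma>\<^esub> \<sigma>))) = coords \<one>\<^bsub>H\<^esub>" "vmul (coords (\<theta> (inv\<^bsub>\<Gamma>\<^esub> \<sigma>))) g = coords \<one>\<^bsub>H\<^esub>"
        by (simp_all add: vm one)
      moreover have "coords (\<theta> (inv\<^bsub>\<Gamma>\<^esub> \<sigma>)) \<in> pb.grp" using \<sigma>(1) unfolding grp by simp
      ultimately show ?thesis by blast
    qed
  qed
qed

lemma vspace_eq_span_grouplikes:
  assumes ptd: "pointed complex_field H"
    and bij: "bij_betw \<theta> (carrier (alt_group 5)) (carrier (grouplikes complex_field H))"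
    and mult: "\<And>\<sigma> \<tau>. \<sigma> \<in> carrier (alt_group 5) \<Longrightarrow> \<tau> \<in> carrier (alt_group 5) \<Longrightarrow>
      \<theta> (\<sigma> \<circ> \<tau>) = \<theta> \<sigma> \<otimes>\<^bsub>H\<^esub> \<theta> \<tau>"
    and one: "\<theta> id = \<one>\<^bsub>H\<^esub>"
  shows "vspace = fs.span (coords ` carrier (grouplikes complex_field H))"
proof -
  let ?A = "carrier (alt_group 5)"
  have fin: "finite ?A" by (simp add: alt_group_5_eq_tables)
  interpret A: group "alt_group 5" by (rule alt_group_is_group)
  interpret pg: pointed_bialgebra_group fscale vspace "coords ` B" "\<lambda>v u. u (vec v)" vmul "coords \<one>\<^bsub>H\<^esub>"
    "\<lambda>u. counit H (vec u)" Lop Rop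
    by (rule pointed_bialgebra_group[OF ptd alt_group_is_group fin bij])
      (simp_all add: alt_group_mult alt_group_one mult one)
  define g where "g \<sigma> = coords (\<theta> \<sigma>)" for \<sigma>
  have G: "carrier (grouplikes complex_field H) = \<theta> ` ?A" using bij by (simp add: bij_betw_def)
  have grp: "pg.grp = g ` ?A"
    using grp_eq_grouplikes[OF ptd] G by (simp add: image_image g_def)
  have cl: "\<theta> \<sigma> \<in> carrier H" if "\<sigma> \<in> ?A" for \<sigma> using G that by (intro grouplike_closed) auto
  have comp: "\<sigma> \<circ> \<tau> \<in> ?A" if "\<sigma> \<in> ?A" "\<tau> \<in> ?A" for \<sigma> \<tau>
    using A.m_closed[OF that] by (simp add: alt_group_mult)
  have vm: "vmul (g \<sigma>) (g \<tau>) = g (\<sigma> \<circ> \<tau>)" if "\<sigma> \<in> ?A" "\<tau> \<in> ?A" for \<sigma> \<tau>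
    using that by (simp add: vmul_def g_def cl mult)
  have g_id: "coords \<one>\<^bsub>H\<^esub> = g id" by (simp add: g_def one)
  have id: "id \<in> ?A" using A.one_closed by (simp add: alt_group_one)
  have g_inj: "g \<sigma> = g \<tau> \<longleftrightarrow> \<sigma> = \<tau>" if "\<sigma> \<in> ?A" "\<tau> \<in> ?A" for \<sigma> \<tau>
    using that bij by (auto simp: g_def coords_inject cl bij_betw_def inj_on_def)
  have "vspace = fs.span pg.grp"
  proof (rule pg.V_eq_span_grp)
    fix h assume h: "h \<in> pg.grp"
    then obtain p where p: "p \<in> ?A" "h = g p" unfolding grp by blast
    have gA: "g \<sigma> \<in> pg.grp" if "\<sigma> \<in> ?A" for \<sigma> using that unfolding grp by blast
    from alt_group_5_element_cases[OF p(1)]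
    show "(\<exists>n u. odd n \<and> pg.gpow h n = coords \<one>\<^bsub>H\<^esub> \<and> u \<in> pg.grp \<and> vmul u h = vmul (pg.ginv h) u) \<or>
      (\<exists>t s. vmul h h = coords \<one>\<^bsub>H\<^esub> \<and> h \<noteq> coords \<one>\<^bsub>H\<^esub> \<and> t \<in> pg.grp \<and> vmul t t = coords \<one>\<^bsub>H\<^esub> \<and>
        vmul h t = vmul t h \<and> t \<noteq> h \<and> s \<in> pg.grp \<and> vmul s h = vmul t s \<and> vmul s t = vmul (vmul h t) s)"
    proof
      assume "\<exists>u\<in>?A. p \<circ> (u \<circ> p) = u \<and> (p = id \<or> p \<circ> (p \<circ> p) = id \<or> p \<circ> p \<circ> (p \<circ> (p \<circ> p)) = id)"
      then obtain u where u: "u \<in> ?A" "p \<circ> (u \<circ> p) = u"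
        and cases: "p = id \<or> p \<circ> (p \<circ> p) = id \<or> p \<circ> p \<circ> (p \<circ> (p \<circ> p)) = id" by blast
      \<comment> \<open>Cancelling \<open>h\<close> on the left turns p u p = u into the form with
        an inverse that \<open>V_eq_span_grp\<close> expects.\<close>
      have "vmul h (vmul (g u) h) = g u" using u p by (simp add: vm comp)
      then have "vmul (pg.ginv h) (g u) = vmul (pg.ginv h) (vmul h (vmul (g u) h))" by simp
      then have uh: "vmul (g u) h = vmul (pg.ginv h) (g u)" using h by simp
      have p0: "pg.gpow h 0 = g id" and pS: "\<And>n. pg.gpow h (Suc n) = vmul h (pg.gpow h n)"
        by (simp_all add: pg.gpow_def) (simp_all add: g_id)
      have pow: "pg.gpow h (Suc 0) = g p" "pg.gpow h (Suc (Suc (Suc 0))) = g (p \<circ> (p \<circ> p))"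
        "pg.gpow h (Suc (Suc (Suc (Suc (Suc 0))))) = g (p \<circ> p \<circ> (p \<circ> (p \<circ> p)))"
        unfolding pS p0 unfolding p(2) using p(1) by (simp_all add: vm comp id o_assoc)
      have "\<exists>n. odd n \<and> pg.gpow h n = coords \<one>\<^bsub>H\<^esub>"
        using cases
      proof (elim disjE)
        assume "p = id" then show ?thesis using pow(1) g_id by (intro exI[of _ "Suc 0"]) simp
      next
        assume "p \<circ> (p \<circ> p) = id" then show ?thesis using pow(2) g_id by (intro exI[of _ "Suc (Suc (Suc 0))"]) simp
      next
        assume "p \<circ> p \<circ> (p \<circ> (p \<circ> p)) = id" then show ?thesis using pow(3) g_id by (intro exI[of _ "Suc (Suc (Suc (Suc (Suc 0))))"]) simp
      qed
      then show ?thesis using uh gA[OF u(1)] by blast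
    next
      assume "p \<noteq> id \<and> p \<circ> p = id \<and> (\<exists>t\<in>?A. \<exists>s\<in>?A.
        t \<noteq> p \<and> t \<circ> t = id \<and> p \<circ> t = t \<circ> p \<and> s \<circ> p = t \<circ> s \<and> s \<circ> t = p \<circ> (t \<circ> s))"
      then obtain t s where "t \<in> ?A" "s \<in> ?A" "p \<noteq> id" "p \<circ> p = id" "t \<noteq> p" "t \<circ> t = id"
        "p \<circ> t = t \<circ> p" "s \<circ> p = t \<circ> s" "s \<circ> t = p \<circ> (t \<circ> s)" by blast
      then have "vmul h h = coords \<one>\<^bsub>H\<^esub> \<and> h \<noteq> coords \<one>\<^bsub>H\<^esub> \<and> g t \<in> pg.grp \<and> vmul (g t) (g t) = coords \<one>\<^bsub>H\<^esub> \<and>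
        vmul h (g t) = vmul (g t) h \<and> g t \<noteq> h \<and> g s \<in> pg.grp \<and> vmul (g s) h = vmul (g t) (g s) \<and>
        vmul (g s) (g t) = vmul (vmul h (g t)) (g s)"
        using p id by (simp add: g_id vm comp g_inj gA o_assoc)
      then show ?thesis by blast
    qed
  qed
  then show ?thesis using grp_eq_grouplikes[OF ptd] by simp
qed

text \<open>The group-likes are independent and now span, so they can replace \<open>B\<close>, with
  the functionals \<open>dual\<close> as coordinates.\<close>

lemma grouplikes_based:
  assumes ptd: "pointed complex_field H" and \<Gamma>: "group \<Gamma>" "finite (carrier \<Gamma>)"
    and bij: "bij_betw \<theta> (carrier \<Gamma>) (carrier (grouplikes complex_field H))"
    and mult: "\<And>\<sigma> \<tau>. \<sigma> \<in> carrier \<Gamma> \<Longrightarrow> \<tau> \<in> carrier \<Gamma> \<Longrightarrow> \<theta> (\<sigma> \<otimes>\<^bsub>\<Gamma>\<^esub> \<tau>) = \<theta> \<sigma> \<otimes>\<^bsub>H\<^esub> \<theta> \<tau>"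
    and one: "\<theta> \<one>\<^bsub>\<Gamma>\<^esub> = \<one>\<^bsub>H\<^esub>"
    and span: "vspace = fs.span (coords ` carrier (grouplikes complex_field H))"
  shows "\<exists>c. complex_based_bialgebra H (carrier (grouplikes complex_field H)) c"
proof -
  let ?G = "carrier (grouplikes complex_field H)"
  interpret pg: pointed_bialgebra_group fscale vspace "coords ` B" "\<lambda>v u. u (vec v)" vmul "coords \<one>\<^bsub>H\<^esub>"
    "\<lambda>u. counit H (vec u)" Lop Rop
    by (rule pointed_bialgebra_group[OF ptd \<Gamma> bij mult one])
  have grp: "pg.grp = coords ` ?G" by (rule grp_eq_grouplikes[OF ptd])
  define c where "c g x = pg.dual (coords g) (coords x)" for g x
  have finG: "finite ?G" using bij \<Gamma>(2) bij_betw_finite by blast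
  have GH: "?G \<subseteq> carrier H" using grouplike_closed by blast
  have "complex_based_bialgebra H ?G c"
  proof (unfold complex_based_bialgebra_def, unfold_locales)
    show "finite ?G" "?G \<subseteq> carrier H" by fact+
    show c_form: "c b \<in> forms" for b
      unfolding c_def by (rule functional_form[OF pg.functional_dual])
    show "c b b' = (if b = b' then \<one>\<^bsub>complex_field\<^esub> else \<zero>\<^bsub>complex_field\<^esub>)" if "b \<in> ?G" "b' \<in> ?G" for b b'
      using pg.dual_grp[of "coords b'" "coords b"] that GH grp
      by (auto simp: c_def coords_inject subset_iff)
    show "x = (\<Oplus>\<^bsub>H\<^esub>b\<in>?G. c b x \<odot>\<^bsub>H\<^esub> b)" if x: "x \<in> carrier H" for x
    proof -
      have "coords x \<in> fs.span pg.grp" using span grp coords_vspace[of x] by simp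
      then have "coords x = (\<Sum>h\<in>coords ` ?G. fscale (pg.dual h (coords x)) h)"
        using pg.span_grp_expand[of "coords x"] grp by simp
      also have "\<dots> = (\<Sum>b\<in>?G. fscale (c b x) (coords b))"
        using inj_on_subset[OF inj_coords GH] by (simp add: sum.reindex c_def)
      also have "\<dots> = coords (\<Oplus>\<^bsub>H\<^esub>b\<in>?G. c b x \<odot>\<^bsub>H\<^esub> b)"
        using finG GH by (subst coords_finsum) (auto simp: coords_smult subset_iff intro!: sum.cong)
      finally show ?thesis
        using x GH by (subst (asm) coords_inject) (auto intro!: finsum_closed)
    qed
  qed
  then show ?thesis by blast
qed

end

section \<open>Group algebras\<close>

lemma module_cong:
  assumes "module K M" "carrier N = carrier M" "\<zero>\<^bsub>N\<^esub> = \<zero>\<^bsub>M\<^esub>"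
    and "\<And>x y. x \<oplus>\<^bsub>N\<^esub> y = x \<oplus>\<^bsub>M\<^esub> y" "\<And>c x. c \<odot>\<^bsub>N\<^esub> x = c \<odot>\<^bsub>M\<^esub> x"
  shows "module K N"
proof -
  interpret module K M by fact
  show ?thesis
    by (rule module_criteria[OF R.is_cring])
      (auto simp: assms(2-5) M.a_ac smult_assoc1 smult_l_distr smult_r_distr intro: M.r_neg bexI[of _ "a_inv M _"])
qed

lemma free_module_hom_eqI:
  assumes "module K U" "\<phi> \<in> module_hom K (free_module K S) U" "\<psi> \<in> module_hom K (free_module K S) U"
    and "\<And>x. x \<in> S \<Longrightarrow> \<phi> (delta K x) = \<psi> (delta K x)" and "f \<in> carrier (free_module K S)"
  shows "\<phi> f = \<psi> f"
proof -
  interpret module K U by fact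
  interpret F: module K "free_module K S" by (rule free_module_module) (rule R.is_cring)
  interpret \<phi>: mod_hom K "free_module K S" U \<phi> by unfold_locales fact
  interpret \<psi>: mod_hom K "free_module K S" U \<psi> by unfold_locales fact
  have d: "delta K x \<in> carrier (free_module K S)" if "x \<in> S" for x
    using R.is_cring that by (rule delta_closed)
  show ?thesis
    using R.is_cring assms(5)
  proof (induction rule: free_module_induct)
    case zero
    then show ?case by simp
  next
    case (step c x f)
    then show ?case by (simp add: d assms(4))
  qed
qed

lemma (in based_bialgebra) hom_eq_on_basis:
  assumes "module K U" "\<phi> \<in> module_hom K H U" "\<psi> \<in> module_hom K H U"
    and "\<And>b. b \<in> B \<Longrightarrow> \<phi> b = \<psi> b" and x: "x \<in> carrier H"
  shows "\<phi> x = \<psi> x"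
proof -
  interpret U: module K U by fact
  have \<chi>: "\<chi> x = (\<Oplus>\<^bsub>U\<^esub>b\<in>B. coord b x \<odot>\<^bsub>U\<^esub> \<chi> b)" if h: "\<chi> \<in> module_hom K H U" for \<chi>
  proof -
    have "\<chi> x = \<chi> (\<Oplus>\<^bsub>H\<^esub>b\<in>B. coord b x \<odot>\<^bsub>H\<^esub> b)" using coord_expand[OF x] by simp
    also have "\<dots> = (\<Oplus>\<^bsub>U\<^esub>b\<in>B. \<chi> (coord b x \<odot>\<^bsub>H\<^esub> b))"
      using x by (intro module_hom_finsum[OF module_axioms assms(1) h finite_B])
        (auto simp: B_closed form_closed coord_form)
    also have "\<dots> = (\<Oplus>\<^bsub>U\<^esub>b\<in>B. coord b x \<odot>\<^bsub>U\<^esub> \<chi> b)"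
      using x module_hom_closed[OF h, THEN funcset_mem]
      by (intro U.finsum_cong') (auto simp: module_hom_smult[OF h] B_closed form_closed coord_form)
    finally show ?thesis .
  qed
  have "(\<Oplus>\<^bsub>U\<^esub>b\<in>B. coord b x \<odot>\<^bsub>U\<^esub> \<phi> b) = (\<Oplus>\<^bsub>U\<^esub>b\<in>B. coord b x \<odot>\<^bsub>U\<^esub> \<psi> b)"
    using x module_hom_closed[OF assms(3), THEN funcset_mem]
    by (intro U.finsum_cong') (auto simp: assms(4) B_closed form_closed coord_form)
  then show ?thesis using \<chi>[OF assms(2)] \<chi>[OF assms(3)] by simp
qed

lemma group_algebra_sel:
    "carrier (group_algebra K G) = carrier (free_module K (carrier G))"
    "\<zero>\<^bsub>group_algebra K G\<^esub> = \<zero>\<^bsub>free_module K (carrier G)\<^esub>"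
    "f \<oplus>\<^bsub>group_algebra K G\<^esub> h = f \<oplus>\<^bsub>free_module K (carrier G)\<^esub> h"
    "c \<odot>\<^bsub>group_algebra K G\<^esub> f = c \<odot>\<^bsub>free_module K (carrier G)\<^esub> f"
    "\<one>\<^bsub>group_algebra K G\<^esub> = delta K \<one>\<^bsub>G\<^esub>"
    "antipode (group_algebra K G) f = (\<lambda>x. if x \<in> carrier G then f (inv\<^bsub>G\<^esub> x) else \<zero>\<^bsub>K\<^esub>)"
  by (simp_all add: group_algebra_def Let_def)

lemma group_algebra_mult: "(f \<otimes>\<^bsub>group_algebra K G\<^esub> h) x =
    (\<Oplus>\<^bsub>K\<^esub>p\<in>{p \<in> supp K f \<times> supp K h. fst p \<otimes>\<^bsub>G\<^esub> snd p = x}. f (fst p) \<otimes>\<^bsub>K\<^esub> h (snd p))"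
  by (simp add: group_algebra_def Let_def)

text \<open>The tensor constructions read only the carrier and the linear structure, which the group
  algebra shares with the free module.\<close>

lemma tensor_group_algebra:
    "tensor K (group_algebra K G) (group_algebra K G) =
      tensor K (free_module K (carrier G)) (free_module K (carrier G))"
    "pure_tensor K (group_algebra K G) (group_algebra K G) =
      pure_tensor K (free_module K (carrier G)) (free_module K (carrier G))"
  by (simp_all add: fun_eq_iff tensor_def pure_tensor_def tensor_null_def tensor_relators_def group_algebra_sel)

lemma comult_group_algebra: "comult (group_algebra K G) =
    free_lift K (tensor K (group_algebra K G) (group_algebra K G))
      (\<lambda>g. pure_tensor K (group_algebra K G) (group_algebra K G) (delta K g) (delta K g))"
  unfolding tensor_group_algebra
  by (simp add: fun_eq_iff group_algebra_def Let_def free_lift_def)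

lemma counit_group_algebra:
  assumes "cring K" "f \<in> carrier (group_algebra K G)"
  shows "counit (group_algebra K G) f = free_lift K (self_module K) (\<lambda>g. \<one>\<^bsub>K\<^esub>) f"
proof -
  interpret cring K by fact
  have f: "f x \<in> carrier K" for x using assms(2) by (simp add: group_algebra_sel free_module_closed)
  have "finsum (self_module K) f A = finsum K f A" for A
    by (simp add: finsum_def finprod_def self_module_def fun_eq_iff)
  then show ?thesis
    using f by (simp add: group_algebra_def Let_def free_lift_def self_module_sel)
qed

lemma module_group_algebra: "cring K \<Longrightarrow> module K (group_algebra K G)"
  by (rule module_cong[OF free_module_module]) (auto simp: group_algebra_sel)

lemma module_hom_group_algebra:
    "module_hom K (group_algebra K G) U = module_hom K (free_module K (carrier G)) U"
    "module_hom K U (group_algebra K G) = module_hom K U (free_module K (carrier G))"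
  by (simp_all add: module_hom_def group_algebra_sel)

lemma supp_delta: "\<one>\<^bsub>K\<^esub> \<noteq> \<zero>\<^bsub>K\<^esub> \<Longrightarrow> supp K (delta K x) = {x}"
  by (auto simp: supp_def delta_def)

lemma group_algebra_mult_delta:
  assumes "cring K" "\<one>\<^bsub>K\<^esub> \<noteq> \<zero>\<^bsub>K\<^esub>"
  shows "delta K g \<otimes>\<^bsub>group_algebra K G\<^esub> delta K h = delta K (g \<otimes>\<^bsub>G\<^esub> h)"
proof
  fix x
  interpret cring K by fact
  have "{p \<in> supp K (delta K g) \<times> supp K (delta K h). fst p \<otimes>\<^bsub>G\<^esub> snd p = x} =
      (if x = g \<otimes>\<^bsub>G\<^esub> h then {(g, h)} else {})"
    by (auto simp: supp_delta[OF assms(2)])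
  then show "(delta K g \<otimes>\<^bsub>group_algebra K G\<^esub> delta K h) x = delta K (g \<otimes>\<^bsub>G\<^esub> h) x"
    by (simp add: group_algebra_mult) (simp add: delta_def)
qed

lemma group_algebra_mult_bilinear:
  assumes "cring K" "group G" "finite (carrier G)"
  shows "bilinear K (group_algebra K G) (group_algebra K G) (group_algebra K G)
    (monoid.mult (group_algebra K G))"
proof -
  interpret cring K by fact
  interpret G: group G by fact
  let ?A = "group_algebra K G"
  let ?P = "\<lambda>x. {p \<in> carrier G \<times> carrier G. fst p \<otimes>\<^bsub>G\<^esub> snd p = x}"
  have fin: "finite (?P x)" for x
    by (rule finite_subset[of _ "carrier G \<times> carrier G"]) (use assms(3) in auto)
  have cl: "f x \<in> carrier K" if "f \<in> carrier ?A" for f x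
    using that by (simp add: group_algebra_sel free_module_closed)
  \<comment> \<open>Summing over all pairs of the finite group, not over the supports, makes the
    index set independent of the factors; bilinearity is then termwise.\<close>
  have mult: "f \<otimes>\<^bsub>?A\<^esub> h = (\<lambda>x. \<Oplus>\<^bsub>K\<^esub>p\<in>?P x. f (fst p) \<otimes>\<^bsub>K\<^esub> h (snd p))"
    if "f \<in> carrier ?A" "h \<in> carrier ?A" for f h
  proof
    fix x
    have "supp K f \<subseteq> carrier G" "supp K h \<subseteq> carrier G"
      using that by (auto simp: group_algebra_sel free_module_sel)
    then show "(f \<otimes>\<^bsub>?A\<^esub> h) x = (\<Oplus>\<^bsub>K\<^esub>p\<in>?P x. f (fst p) \<otimes>\<^bsub>K\<^esub> h (snd p))"
      unfolding group_algebra_mult using fin cl that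
      by (intro add.finprod_mono_neutral_cong_left) (auto simp: supp_def)
  qed
  interpret A: module K ?A by (rule module_group_algebra) fact
  have mc: "f \<otimes>\<^bsub>?A\<^esub> h \<in> carrier ?A" if f: "f \<in> carrier ?A" and h: "h \<in> carrier ?A" for f h
    unfolding group_algebra_sel(1)
  proof (rule free_moduleI[OF _ assms(3) subset_refl])
    show "(f \<otimes>\<^bsub>?A\<^esub> h) x \<in> carrier K" for x
      unfolding mult[OF f h] using f h cl by (intro finsum_closed) auto
    show "(f \<otimes>\<^bsub>?A\<^esub> h) x = \<zero>\<^bsub>K\<^esub>" if "x \<notin> carrier G" for x
    proof -
      have "?P x = {}" using that by auto
      then show ?thesis unfolding mult[OF f h] by (simp only: finsum_empty)
    qed
  qed
  note sel = group_algebra_sel(3,4) free_module_sel(3,4)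
  show ?thesis
  proof (rule bilinearI)
    fix f f' h assume "f \<in> carrier ?A" "f' \<in> carrier ?A" "h \<in> carrier ?A"
    then show "(f \<oplus>\<^bsub>?A\<^esub> f') \<otimes>\<^bsub>?A\<^esub> h = f \<otimes>\<^bsub>?A\<^esub> h \<oplus>\<^bsub>?A\<^esub> f' \<otimes>\<^bsub>?A\<^esub> h"
      "h \<otimes>\<^bsub>?A\<^esub> (f \<oplus>\<^bsub>?A\<^esub> f') = h \<otimes>\<^bsub>?A\<^esub> f \<oplus>\<^bsub>?A\<^esub> h \<otimes>\<^bsub>?A\<^esub> f'"
      using fin cl
      by (simp_all add: mult) (simp_all add: sel l_distr r_distr finsum_addf Pi_iff)
  next
    fix c f h assume "c \<in> carrier K" "f \<in> carrier ?A" "h \<in> carrier ?A"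
    then show "(c \<odot>\<^bsub>?A\<^esub> f) \<otimes>\<^bsub>?A\<^esub> h = c \<odot>\<^bsub>?A\<^esub> (f \<otimes>\<^bsub>?A\<^esub> h)"
      "f \<otimes>\<^bsub>?A\<^esub> (c \<odot>\<^bsub>?A\<^esub> h) = c \<odot>\<^bsub>?A\<^esub> (f \<otimes>\<^bsub>?A\<^esub> h)"
      using fin cl
      by (simp_all add: mult) (simp_all add: sel finsum_rdistr Pi_iff m_ac)
  qed (rule mc)
qed

lemma antipode_group_algebra_hom:
  assumes "cring K" "group G" "finite (carrier G)"
  shows "antipode (group_algebra K G) \<in> module_hom K (group_algebra K G) (group_algebra K G)"
proof -
  interpret cring K by fact
  interpret G: group G by fact
  have "antipode (group_algebra K G) f \<in> carrier (group_algebra K G)"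
    if "f \<in> carrier (group_algebra K G)" for f
    unfolding group_algebra_sel
    by (rule free_moduleI[OF _ assms(3) subset_refl])
      (use that in \<open>auto simp: group_algebra_sel free_module_closed\<close>)
  then show ?thesis
    by (auto simp: module_hom_def group_algebra_sel free_module_sel)
qed

lemma antipode_group_algebra_delta:
  assumes "group G" "g \<in> carrier G"
  shows "antipode (group_algebra K G) (delta K g) = delta K (inv\<^bsub>G\<^esub> g)"
proof -
  interpret G: group G by fact
  show ?thesis
    using assms(2) by (auto simp: group_algebra_sel delta_def fun_eq_iff)
qed

text \<open>The map \<Phi> reads off coordinates along the group-likes and sends
  \<open>\<theta> \<sigma>\<close> to \<open>delta K \<sigma>\<close>. Each compatibility is an
  equality of linear maps, so it suffices to check it on group-likes.\<close>

lemma hopf_isomorphic_group_algebra: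
  assumes "hopf_algebra K H" and "based_bialgebra K H (carrier (grouplikes K H)) coord"
    and "group \<Gamma>" and bij: "bij_betw \<theta> (carrier \<Gamma>) (carrier (grouplikes K H))"
    and mult: "\<And>\<sigma> \<tau>. \<sigma> \<in> carrier \<Gamma> \<Longrightarrow> \<tau> \<in> carrier \<Gamma> \<Longrightarrow> \<theta> (\<sigma> \<otimes>\<^bsub>\<Gamma>\<^esub> \<tau>) = \<theta> \<sigma> \<otimes>\<^bsub>H\<^esub> \<theta> \<tau>"
    and one: "\<theta> \<one>\<^bsub>\<Gamma>\<^esub> = \<one>\<^bsub>H\<^esub>"
  shows "hopf_isomorphic K H (group_algebra K \<Gamma>)"
proof -
  let ?G = "carrier (grouplikes K H)" and ?A = "group_algebra K \<Gamma>"
  interpret hopf_algebra K H by fact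
  interpret based_bialgebra K H ?G coord by fact
  interpret \<Gamma>: group \<Gamma> by fact
  have fin: "finite (carrier \<Gamma>)" using bij finite_B bij_betw_finite by blast
  note K = R.is_cring
  interpret A: module K ?A by (rule module_group_algebra[OF K])
  interpret AA: tensor_product K ?A ?A by unfold_locales
  have \<theta>G: "\<theta> \<sigma> \<in> ?G" if "\<sigma> \<in> carrier \<Gamma>" for \<sigma> using bij_betwE[OF bij] that by blast
  then have \<theta>H: "\<theta> \<sigma> \<in> carrier H" if "\<sigma> \<in> carrier \<Gamma>" for \<sigma> using that grouplike_closed by blast
  have Gex: "\<exists>\<sigma>\<in>carrier \<Gamma>. b = \<theta> \<sigma>" if "b \<in> ?G" for b using bij that by (auto simp: bij_betw_def)
  have dA: "delta K \<sigma> \<in> carrier ?A" if "\<sigma> \<in> carrier \<Gamma>" for \<sigma>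
    using delta_closed[OF K that] by (simp add: group_algebra_sel)
  define \<Phi> where "\<Phi> x = (\<lambda>\<sigma>. if \<sigma> \<in> carrier \<Gamma> then coord (\<theta> \<sigma>) x else \<zero>\<^bsub>K\<^esub>)" for x
  have "\<Phi> x \<in> carrier ?A" if "x \<in> carrier H" for x
    unfolding group_algebra_sel
    by (rule free_moduleI[OF _ fin subset_refl])
      (use that in \<open>auto simp: \<Phi>_def \<theta>G coord_form form_closed\<close>)
  then have \<Phi>: "\<Phi> \<in> module_hom K H ?A"
    by (auto simp: module_hom_def group_algebra_sel free_module_sel \<Phi>_def \<theta>G coord_form form_add form_smult)
  note \<Phi>A = module_hom_closed[OF \<Phi>, THEN funcset_mem]
  have \<Phi>\<theta>: "\<Phi> (\<theta> \<sigma>) = delta K \<sigma>" if "\<sigma> \<in> carrier \<Gamma>" for \<sigma>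
    using bij that by (auto simp: \<Phi>_def delta_def fun_eq_iff coord_B \<theta>G bij_betw_def inj_on_def)
  note eqI = hom_eq_on_basis[OF A.module_axioms] 
  have bmult: "bilinear K ?A ?A ?A (monoid.mult ?A)"
    by (rule group_algebra_mult_bilinear[OF K \<open>group \<Gamma>\<close> fin])
  have \<Phi>mult: "\<Phi> (x \<otimes>\<^bsub>H\<^esub> y) = \<Phi> x \<otimes>\<^bsub>?A\<^esub> \<Phi> y" if x: "x \<in> carrier H" and y: "y \<in> carrier H" for x y
  proof (rule eqI[where \<phi> = "\<lambda>x. \<Phi> (x \<otimes>\<^bsub>H\<^esub> y)" and \<psi> = "\<lambda>x. \<Phi> x \<otimes>\<^bsub>?A\<^esub> \<Phi> y", OF _ _ _ x])
    show "(\<lambda>x. \<Phi> (x \<otimes>\<^bsub>H\<^esub> y)) \<in> module_hom K H ?A"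
      by (rule module_hom_compose[OF mult_hom_right[OF y] \<Phi>])
    show "(\<lambda>x. \<Phi> x \<otimes>\<^bsub>?A\<^esub> \<Phi> y) \<in> module_hom K H ?A"
      using bmult \<Phi>A[OF y] by (intro module_hom_compose[OF \<Phi>]) (simp add: bilinear_def)
    fix b assume b: "b \<in> ?G"
    then obtain \<sigma> where \<sigma>: "\<sigma> \<in> carrier \<Gamma>" "b = \<theta> \<sigma>" using Gex by blast
    note bH = grouplike_closed[OF b]
    show "\<Phi> (b \<otimes>\<^bsub>H\<^esub> y) = \<Phi> b \<otimes>\<^bsub>?A\<^esub> \<Phi> y"
    proof (rule eqI[where \<phi> = "\<lambda>y. \<Phi> (b \<otimes>\<^bsub>H\<^esub> y)" and \<psi> = "\<lambda>y. \<Phi> b \<otimes>\<^bsub>?A\<^esub> \<Phi> y", OF _ _ _ y])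
      show "(\<lambda>y. \<Phi> (b \<otimes>\<^bsub>H\<^esub> y)) \<in> module_hom K H ?A"
        by (rule module_hom_compose[OF mult_hom_left[OF bH] \<Phi>])
      show "(\<lambda>y. \<Phi> b \<otimes>\<^bsub>?A\<^esub> \<Phi> y) \<in> module_hom K H ?A"
        using bmult \<Phi>A[OF bH] by (intro module_hom_compose[OF \<Phi>]) (simp add: bilinear_def)
      fix d assume "d \<in> ?G"
      then obtain \<tau> where \<tau>: "\<tau> \<in> carrier \<Gamma>" "d = \<theta> \<tau>" using Gex by blast
      have "\<Phi> (b \<otimes>\<^bsub>H\<^esub> d) = delta K (\<sigma> \<otimes>\<^bsub>\<Gamma>\<^esub> \<tau>)"
        using \<sigma> \<tau> by (simp add: mult[symmetric] \<Phi>\<theta>)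
      then show "\<Phi> (b \<otimes>\<^bsub>H\<^esub> d) = \<Phi> b \<otimes>\<^bsub>?A\<^esub> \<Phi> d"
        using \<sigma> \<tau> by (simp add: \<Phi>\<theta> group_algebra_mult_delta[OF K])
    qed
  qed
  have "\<Phi> \<one>\<^bsub>H\<^esub> = \<one>\<^bsub>?A\<^esub>"
    using \<Phi>\<theta>[OF \<Gamma>.one_closed] by (simp add: one group_algebra_sel)
  then have ring: "\<Phi> \<in> ring_hom H ?A"
    using \<Phi>A \<Phi>mult module_hom_add[OF \<Phi>] by (auto simp: ring_hom_def)
  have cm: "comult ?A (\<Phi> x) = tensor_map K H H ?A ?A \<Phi> \<Phi> (comult H x)" if x: "x \<in> carrier H" for x
  proof (rule hom_eq_on_basis[OF AA.T.module_axioms _ _ _ x,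
        where \<phi> = "\<lambda>x. comult ?A (\<Phi> x)" and \<psi> = "\<lambda>x. tensor_map K H H ?A ?A \<Phi> \<Phi> (comult H x)"])
    have pd: "(\<lambda>g. AA.pure (delta K g) (delta K g)) \<in> carrier \<Gamma> \<rightarrow> carrier AA.T"
      using dA AA.pure_closed by simp
    have "comult ?A \<in> module_hom K ?A AA.T"
      unfolding comult_group_algebra module_hom_group_algebra by (rule free_lift_hom[OF AA.T.module_axioms pd])
    then show "(\<lambda>x. comult ?A (\<Phi> x)) \<in> module_hom K H AA.T" by (rule module_hom_compose[OF \<Phi>])
    show "(\<lambda>x. tensor_map K H H ?A ?A \<Phi> \<Phi> (comult H x)) \<in> module_hom K H AA.T"
      by (rule module_hom_compose[OF comult_linear], rule tensor_map_hom[OF \<Phi> \<Phi>]) unfold_locales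
    fix b assume "b \<in> ?G"
    then obtain \<sigma> where \<sigma>: "\<sigma> \<in> carrier \<Gamma>" "b = \<theta> \<sigma>" using Gex by blast
    have "tensor_map K H H ?A ?A \<Phi> \<Phi> (HH.pure b b) = AA.pure (\<Phi> b) (\<Phi> b)"
      by (rule tensor_map_pure[OF \<Phi> \<Phi>]) (unfold_locales, use \<sigma> \<theta>H in auto)
    moreover have "comult ?A (delta K \<sigma>) = AA.pure (delta K \<sigma>) (delta K \<sigma>)"
      unfolding comult_group_algebra by (rule free_lift_delta[OF AA.T.module_axioms pd \<sigma>(1)])
    ultimately show "comult ?A (\<Phi> b) = tensor_map K H H ?A ?A \<Phi> \<Phi> (comult H b)"
      using \<sigma> by (simp add: comult_grouplike[OF \<theta>G] \<Phi>\<theta>)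
  qed
  have cu: "counit ?A (\<Phi> x) = counit H x" if x: "x \<in> carrier H" for x
  proof -
    have s: "module K (self_module K)" by (rule self_module_module[OF K])
    have o: "(\<lambda>g. \<one>\<^bsub>K\<^esub>) \<in> carrier \<Gamma> \<rightarrow> carrier (self_module K)" by (simp add: self_module_sel)
    have "free_lift K (self_module K) (\<lambda>g. \<one>\<^bsub>K\<^esub>) (\<Phi> x) = counit H x"
    proof (rule hom_eq_on_basis[OF s _ counit_linear _ x])
      have "free_lift K (self_module K) (\<lambda>g. \<one>\<^bsub>K\<^esub>) \<in> module_hom K ?A (self_module K)"
        unfolding module_hom_group_algebra by (rule free_lift_hom[OF s o])
      then show "(\<lambda>x. free_lift K (self_module K) (\<lambda>g. \<one>\<^bsub>K\<^esub>) (\<Phi> x)) \<in> module_hom K H (self_module K)"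
        by (rule module_hom_compose[OF \<Phi>])
      fix b assume "b \<in> ?G"
      then obtain \<sigma> where \<sigma>: "\<sigma> \<in> carrier \<Gamma>" "b = \<theta> \<sigma>" using Gex by blast
      then show "free_lift K (self_module K) (\<lambda>g. \<one>\<^bsub>K\<^esub>) (\<Phi> b) = counit H b"
        using free_lift_delta[OF s o \<sigma>(1)] by (simp add: \<Phi>\<theta> counit_grouplike[OF \<theta>G])
    qed
    then show ?thesis using counit_group_algebra[OF K \<Phi>A[OF x]] by simp
  qed
  have ant: "antipode ?A (\<Phi> x) = \<Phi> (antipode H x)" if x: "x \<in> carrier H" for x
  proof (rule eqI[where \<phi> = "\<lambda>x. antipode ?A (\<Phi> x)" and \<psi> = "\<lambda>x. \<Phi> (antipode H x)", OF _ _ _ x])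
    show "(\<lambda>x. antipode ?A (\<Phi> x)) \<in> module_hom K H ?A"
      by (rule module_hom_compose[OF \<Phi> antipode_group_algebra_hom[OF K \<open>group \<Gamma>\<close> fin]])
    show "(\<lambda>x. \<Phi> (antipode H x)) \<in> module_hom K H ?A"
      by (rule module_hom_compose[OF antipode_linear \<Phi>])
    fix b assume "b \<in> ?G"
    then obtain \<sigma> where \<sigma>: "\<sigma> \<in> carrier \<Gamma>" "b = \<theta> \<sigma>" using Gex by blast
    let ?s = "antipode H b"
    have sc: "?s \<in> carrier H" using module_hom_closed[OF antipode_linear] \<theta>H \<sigma> by blast
    have "bilinear K H H H (\<lambda>a b. antipode H a \<otimes>\<^bsub>H\<^esub> b)"
      unfolding bilinear_def
      using module_hom_closed[OF antipode_linear]
      by (auto intro: mult_hom_left module_hom_compose[OF antipode_linear mult_hom_right])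
    then have "tensor_lift K H H H (\<lambda>a b. antipode H a \<otimes>\<^bsub>H\<^esub> b) (HH.pure b b) = ?s \<otimes>\<^bsub>H\<^esub> b"
      using \<sigma> \<theta>H by (intro HH.tensor_lift_pure[OF module_axioms]) auto
    \<comment> \<open>At a group-like the antipode axiom says that \<open>?s\<close> is a left
      inverse of \<open>b\<close>; as \<open>b\<close> has the inverse coming from \<Gamma>, this
      determines \<open>?s\<close>.\<close>
    then have sb: "?s \<otimes>\<^bsub>H\<^esub> b = \<one>\<^bsub>H\<^esub>"
      using antipode_left[of b] \<sigma> \<theta>H by (simp add: comult_grouplike[OF \<theta>G] counit_grouplike[OF \<theta>G])
    have "?s = ?s \<otimes>\<^bsub>H\<^esub> (b \<otimes>\<^bsub>H\<^esub> \<theta> (inv\<^bsub>\<Gamma>\<^esub> \<sigma>))"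
      using \<sigma> sc by (simp add: mult[symmetric] one)
    also have "\<dots> = \<theta> (inv\<^bsub>\<Gamma>\<^esub> \<sigma>)"
      using \<sigma> sc sb \<theta>H by (simp add: alg.m_assoc[symmetric])
    finally show "antipode ?A (\<Phi> b) = \<Phi> ?s"
      using \<sigma> by (simp add: \<Phi>\<theta> antipode_group_algebra_delta)
  qed
  have "bij_betw \<Phi> (carrier H) (carrier ?A)"
    unfolding bij_betw_def
  proof
    show "inj_on \<Phi> (carrier H)"
    proof (rule inj_onI)
      fix x y assume x: "x \<in> carrier H" and y: "y \<in> carrier H" and eq: "\<Phi> x = \<Phi> y"
      have c: "coord b x = coord b y" if "b \<in> ?G" for b
      proof -
        obtain \<sigma> where "\<sigma> \<in> carrier \<Gamma>" "b = \<theta> \<sigma>" using Gex \<open>b \<in> ?G\<close> by blast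
        then show ?thesis using fun_cong[OF eq, of \<sigma>] by (simp add: \<Phi>_def)
      qed
      have "(\<Oplus>\<^bsub>H\<^esub>b\<in>?G. coord b x \<odot>\<^bsub>H\<^esub> b) = (\<Oplus>\<^bsub>H\<^esub>b\<in>?G. coord b y \<odot>\<^bsub>H\<^esub> b)"
        using y by (intro finsum_cong') (auto simp: c B_closed coord_form form_closed)
      then show "x = y" using coord_expand[OF x] coord_expand[OF y] by simp
    qed
    have b: "\<theta> \<in> carrier \<Gamma> \<rightarrow> carrier H" using \<theta>H by blast
    note \<Psi> = free_lift_hom[OF module_axioms b]
    \<comment> \<open>The linear extension of \<theta> is a right inverse of \<Phi>, which yields
      surjectivity.\<close>
    have "\<Phi> (free_lift K H \<theta> f) = f" if f: "f \<in> carrier ?A" for f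
      by (rule free_module_hom_eqI[where \<phi> = "\<lambda>f. \<Phi> (free_lift K H \<theta> f)" and \<psi> = "\<lambda>f. f",
            OF A.module_axioms module_hom_compose[OF \<Psi> \<Phi>]])
        (use f module_hom_id[of K ?A] in \<open>simp_all add: free_lift_delta[OF module_axioms b] \<Phi>\<theta> group_algebra_sel(1) module_hom_group_algebra\<close>)
    moreover have "free_lift K H \<theta> f \<in> carrier H" if "f \<in> carrier ?A" for f
      using module_hom_closed[OF \<Psi>] that by (auto simp: group_algebra_sel)
    ultimately show "\<Phi> ` carrier H = carrier ?A" using \<Phi>A by (auto simp: image_iff) metis
  qed
  then show ?thesis
    using \<Phi> ring cm cu ant unfolding hopf_isomorphic_def hopf_hom_def by blast
qed

theorem theorem2p6:
  fixes H :: "(complex, 'h, 'm) hopf_scheme"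
  assumes "hopf_algebra complex_field H"
    and "vectorspace.fin_dim complex_field H"
    and "pointed complex_field H"
    and "grouplikes complex_field H \<cong> alt_group 5"
  shows "hopf_isomorphic complex_field H (group_algebra complex_field (alt_group 5))"
proof -
  interpret hopf_algebra complex_field H by fact
  let ?A = "carrier (alt_group 5)" and ?G = "carrier (grouplikes complex_field H)"
  obtain B coord where "based_bialgebra complex_field H B coord"
    using ex_basis_coordinates[OF assms(2)] by blast
  then interpret complex_based_bialgebra H B coord by (rule complex_based_bialgebra.intro)
  show ?thesis
  proof (rule grouplikes_iso_inverse[OF alt_group_is_group assms(4)])
    fix \<theta>
    assume bij: "bij_betw \<theta> ?A ?G"
      and mult: "\<And>\<sigma> \<tau>. \<sigma> \<in> ?A \<Longrightarrow> \<tau> \<in> ?A \<Longrightarrow> \<theta> (\<sigma> \<otimes>\<^bsub>alt_group 5\<^esub> \<tau>) = \<theta> \<sigma> \<otimes>\<^bsub>H\<^esub> \<theta> \<tau>"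
      and one: "\<theta> \<one>\<^bsub>alt_group 5\<^esub> = \<one>\<^bsub>H\<^esub>"
    have fin: "finite ?A" by (simp add: alt_group_5_eq_tables)
    have span: "vspace = fs.span (coords ` ?G)"
      by (rule vspace_eq_span_grouplikes[OF assms(3) bij])
        (use mult one in \<open>simp_all add: alt_group_mult alt_group_one\<close>)
    \<comment> \<open>The change of basis: the arbitrary \<open>B\<close> served to prove spanning,
      and the group-likes now match the basis of the group algebra.\<close>
    have "\<exists>c. complex_based_bialgebra H ?G c"
      by (rule grouplikes_based[where \<Gamma> = "alt_group 5" and \<theta> = \<theta>])
        (fact assms(3) alt_group_is_group fin bij mult one span)+
    then obtain c where "complex_based_bialgebra H ?G c" by blast
    then have based: "based_bialgebra complex_field H ?G c" by (simp add: complex_based_bialgebra_def)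
    show ?thesis
      by (rule hopf_isomorphic_group_algebra[where \<theta> = \<theta>])
        (fact assms(1) based alt_group_is_group bij mult one)+
  qed
qed

end
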